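(* Let $K^{1}_{3DSA}(N)$ denote the tile complexity of a 3D $N\times N$ square at temperature $1$, i.e., the minimum number of distinct 3-dimensional tile types in a temperature-$1$ tile assembly system that uniquely produces some 3D $N\times N$ square. Then, as $N\to\infty$ over the natural numbers, $$K^{1}_{3DSA}(N) = O\left(\frac{\log N}{\log\log N}\right).$$ That is, there exist constants $C>0$ and $N_0\in\mathbb{N}$ such that for every integer $N\ge N_0$, $K^{1}_{3DSA}(N)\le C\,\frac{\log N}{\log\log N}$.
   Context: The model is a 3-dimensional version of Winfree's abstract Tile Assembly Model. **Tiles.** Let $\Sigma$ be an alphabet. A 3-dimensional tile type is a tuple $t\in(\Sigma^*\times\mathbb{N})^6$, thought of as a unit cube with six sides listed in a standardized order ($\pm x,\pm y,\pm z$ directions), each side having a glue $g\in\Sigma^*\times\mathbb{N}$ consisting of a finite string label and a non-negative integer strength. All glues have strength $1$ (a side carrying no glue is regarded as having strength $0$). Tiles may be translated but not rotated. There is a finite set $T$ of tile types, with infinitely many copies (tiles) of each type available. **Assemblies.** An assembly is a partial function $\alpha:\mathbb{Z}^3\dashrightarrow T$. Two tiles at adjacent positions (differing by a unit vector) bind if the glue labels on their abutting sides are equal and have positive strength. The binding graph of an assembly has as vertices the positions of its tiles, with edges joining positions whose tiles bind. For an integer $\tau$, an assembly is $\tau$-stable if every cut of its binding graph has strength at least $\tau$, where the strength of a cut is the sum of the glue strengths of the edges in the cut. Mismatching glues on adjacent sides are allowed; they simply contribute no binding. **Tile assembly systems.** A tile assembly system (TAS) is a triple $\mathcal{T}=(T,\sigma,\tau)$,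 where $T$ is a finite set of tile types, $\sigma:\mathbb{Z}^3\dashrightarrow T$ is a finite $\tau$-stable seed assembly, and $\tau$ is the temperature. It is assumed throughout that the seed is a single tile, $|\mathrm{dom}\,\sigma|=1$, and that $\tau=1$. An assembly $\alpha$ is producible if $\alpha=\sigma$, or if $\alpha$ is obtained from a producible assembly $\beta$ by the stable binding of a single tile (placing one tile at an empty position so that the new tile binds to its neighbours with total strength at least $\tau$; for $\tau=1$ this means it binds to at least one adjacent tile). An assembly is terminal if no tile can be $\tau$-stably bound to it. $\mathcal{A}_{\Box}[\mathcal{T}]$ denotes the set of producible, terminal assemblies of $\mathcal{T}$. $\mathcal{T}$ is directed if $|\mathcal{A}_{\Box}[\mathcal{T}]|=1$. **Unique production.** $\mathcal{T}$ uniquely produces a set $X\subseteq\mathbb{Z}^3$ if $\mathcal{T}$ is directed, with $\mathcal{A}_{\Box}[\mathcal{T}]=\{\alpha\}$ and $\mathrm{dom}\,\alpha=X$. **Squares and tile complexity.** For $N\in\mathbb{N}$, a set $S^3_N\subseteq\mathbb{Z}^3$ is a 3D $N\times N$ square if $$\{0,\ldots,N-1\}\times\{0,\ldots,N-1\}\times\{0\}\subseteq S^3_N\subseteq\{0,\ldots,N-1\}\times\{0,\ldots,N-1\}\times\{0,1\}.$$ The tile complexity of a 3D $N\times N$ square at temperature $\tau$ is $$K^{\tau}_{3DSA}(N)=\min\{n \mid \text{there is a TAS } \mathcal{T}=(T,\sigma,\tau) \text{ with } |T|=n \text{ that uniquely produces some 3D } N\times N \text{ square } S^3_N\}.$$ 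*)

theory Defs
  imports Complex_Main "HOL-Library.Product_Plus" "HOL-Library.Landau_Symbols"
begin

text \<open>
  The alphabet is the type \<open>'a\<close>, so that glue labels are of type \<open>'a list\<close>.  The second component
  of a glue is its strength; a side without glue is one of strength 0, whatever its label.
  Tiles, being functions on the six directions, are 6-tuples of glues; they are never rotated.
\<close>

datatype dir = PosX | NegX | PosY | NegY | PosZ | NegZ

type_synonym pos = "int \<times> int \<times> int"
type_synonym 'a glue = "'a list \<times> nat"
type_synonym 'a tile = "dir \<Rightarrow> 'a glue"
type_synonym 'a assembly = "pos \<Rightarrow> 'a tile option"

fun opposite :: "dir \<Rightarrow> dir" where
  "opposite PosX = NegX"
| "opposite NegX = PosX"
| "opposite PosY = NegY"
| "opposite NegY = PosY"
| "opposite PosZ = NegZ"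
| "opposite NegZ = PosZ"

fun unit_vec :: "dir \<Rightarrow> pos" where
  "unit_vec PosX = (1, 0, 0)"
| "unit_vec NegX = (- 1, 0, 0)"
| "unit_vec PosY = (0, 1, 0)"
| "unit_vec NegY = (0, - 1, 0)"
| "unit_vec PosZ = (0, 0, 1)"
| "unit_vec NegZ = (0, 0, - 1)"

definition glues_bind :: "'a glue \<Rightarrow> 'a glue \<Rightarrow> bool" where
  "glues_bind g h \<longleftrightarrow> fst g = fst h \<and> 0 < snd g \<and> 0 < snd h"

text \<open>
  The binding graph, each edge being represented by both of its orientations \<open>(p, d)\<close>, from \<open>p\<close>
  to \<open>p + unit_vec d\<close>.
\<close>

definition binding_edges :: "'a assembly \<Rightarrow> (pos \<times> dir) set" where
  "binding_edges \<alpha> = {(p, d). \<exists>t u. \<alpha> p = Some t \<and> \<alpha> (p + unit_vec d) = Some u \<and>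
      glues_bind (t d) (u (opposite d))}"

text \<open>
  The cut separates \<open>A\<close> from \<open>dom \<alpha> - A\<close>; orienting the edges out of \<open>A\<close> counts each edge once.
  The strength of an edge is read off at its source: the strengths in use below are at most 1,
  so both glues of an edge have the same strength.  Only meant for finite assemblies.
\<close>

definition cut_strength :: "'a assembly \<Rightarrow> pos set \<Rightarrow> nat" where
  "cut_strength \<alpha> A =
     (\<Sum>(p, d) \<in> {(p, d) \<in> binding_edges \<alpha>. p \<in> A \<and> p + unit_vec d \<notin> A}. snd (the (\<alpha> p) d))"

definition stable :: "nat \<Rightarrow> 'a assembly \<Rightarrow> bool" where
  "stable \<tau> \<alpha> \<longleftrightarrow> (\<forall>A. A \<noteq> {} \<and> A \<subset> dom \<alpha> \<longrightarrow> \<tau> \<le> cut_strength \<alpha> A)"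

definition tile_assembly_system :: "'a tile set \<Rightarrow> 'a assembly \<Rightarrow> nat \<Rightarrow> bool" where
  "tile_assembly_system T \<sigma> \<tau> \<longleftrightarrow>
     finite T \<and> (\<forall>t\<in>T. \<forall>d. snd (t d) \<le> 1) \<and>
     ran \<sigma> \<subseteq> T \<and> card (dom \<sigma>) = 1 \<and> stable \<tau> \<sigma>"

definition attach_strength :: "'a assembly \<Rightarrow> pos \<Rightarrow> 'a tile \<Rightarrow> nat" where
  "attach_strength \<beta> p t = (\<Sum>d | (p, d) \<in> binding_edges (\<beta>(p \<mapsto> t)). snd (t d))"

definition can_attach :: "'a tile set \<Rightarrow> nat \<Rightarrow> 'a assembly \<Rightarrow> pos \<Rightarrow> 'a tile \<Rightarrow> bool" where
  "can_attach T \<tau> \<beta> p t \<longleftrightarrow> t \<in> T \<and> p \<notin> dom \<beta> \<and> \<tau> \<le> attach_strength \<beta> p t"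

inductive producible :: "'a tile set \<Rightarrow> 'a assembly \<Rightarrow> nat \<Rightarrow> 'a assembly \<Rightarrow> bool"
  for T \<sigma> \<tau> where
  seed: "producible T \<sigma> \<tau> \<sigma>"
| attach: "producible T \<sigma> \<tau> \<beta> \<Longrightarrow> can_attach T \<tau> \<beta> p t \<Longrightarrow> producible T \<sigma> \<tau> (\<beta>(p \<mapsto> t))"

definition terminal :: "'a tile set \<Rightarrow> nat \<Rightarrow> 'a assembly \<Rightarrow> bool" where
  "terminal T \<tau> \<alpha> \<longleftrightarrow> \<not> (\<exists>p t. can_attach T \<tau> \<alpha> p t)"

definition terminal_assemblies :: "'a tile set \<Rightarrow> 'a assembly \<Rightarrow> nat \<Rightarrow> 'a assembly set" where
  "terminal_assemblies T \<sigma> \<tau> = {\<alpha>. producible T \<sigma> \<tau> \<alpha> \<and> terminal T \<tau> \<alpha>}"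

definition directed :: "'a tile set \<Rightarrow> 'a assembly \<Rightarrow> nat \<Rightarrow> bool" where
  "directed T \<sigma> \<tau> \<longleftrightarrow> card (terminal_assemblies T \<sigma> \<tau>) = 1"

definition uniquely_produces :: "'a tile set \<Rightarrow> 'a assembly \<Rightarrow> nat \<Rightarrow> pos set \<Rightarrow> bool" where
  "uniquely_produces T \<sigma> \<tau> X \<longleftrightarrow>
     directed T \<sigma> \<tau> \<and> (\<exists>\<alpha>. terminal_assemblies T \<sigma> \<tau> = {\<alpha>} \<and> dom \<alpha> = X)"

definition square_3d :: "nat \<Rightarrow> pos set \<Rightarrow> bool" where
  "square_3d N S \<longleftrightarrow>
     {0..<int N} \<times> {0..<int N} \<times> {0} \<subseteq> S \<and> S \<subseteq> {0..<int N} \<times> {0..<int N} \<times> {0, 1}"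

text \<open>
  The type argument fixes the alphabet.  For \<open>\<tau> = 1\<close> and \<open>N \<ge> 1\<close> the minimum is over a nonempty set: a
  square can always be assembled from pairwise different tiles, one for each position.
\<close>

definition tile_complexity :: "'a itself \<Rightarrow> nat \<Rightarrow> nat \<Rightarrow> nat" where
  "tile_complexity (_ :: 'a itself) \<tau> N =
     (LEAST n. \<exists>(T :: 'a tile set) \<sigma> S. tile_assembly_system T \<sigma> \<tau> \<and> card T = n \<and>
        square_3d N S \<and> uniquely_produces T \<sigma> \<tau> S)"

end

theory Submission
  imports Defs "HOL-Library.Countable" "HOL-Real_Asymp.Real_Asymp"
begin

text \<open>
  Every tile has one input side, which carries its own code, and some output sides, which carry the
  codes of the tiles to be placed there.  A path of such tiles grows like a self-avoiding turtle that
  senses occupied cells: of two outputs, only the one towards a free cell can be used.  With the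
  plane \<open>z = 1\<close> as additional room, a zigzag path can leave the bits of a tape as bumps in its next
  row and read them there, and thus runs a finite transducer on the tape, one pass for two rows.

  The transducer knows \<open>m\<close> digits of \<open>k\<close> bits each.  It first writes them on the tape one after the
  other; what it has to remember, namely how many are done, is stored on the tape in unary.  Then it
  decrements the resulting number in each pass until it is zero.  Hence \<open>O(m + 2\<^sup>k)\<close> tile types build
  a strip of logarithmic width whose height is an arbitrary number of \<open>m k\<close> bits.  The path runs
  through three such strips, along the left, the top and the right side of the square.  The
  ends of the rows of the last one emit straight rays of tiles, which fill the remaining cells;
  they are stopped by the first two strips, which are complete by then.  Digits of about
  \<open>log log N / 2\<close> bits give the bound.
\<close>

section \<open>Growth along a tree of tiles\<close>

text \<open>At temperature 1 a tile attaches through a single side, so two inputs can never be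
  combined. Earlier growth can influence later growth only by occupying cells, and the second plane
  is what lets a path probe an obstacle and still get past it.

  One tile type per bit of \<open>N\<close> would cost about \<open>log N\<close>. The saving lies
  in one transition: on meeting the mark, \<open>Addr j\<close> loads all \<open>k\<close> bits of
  \<open>dig j\<close> into the state at once. The address and the queue contents never have to be
  remembered together, so the numbers of states add up instead of multiplying: about
  \<open>m + 2 ^ k\<close> states determine \<open>m * k\<close> bits.

  Attachments may happen in many orders once rays and strip grow at the same time. Directedness is
  therefore not derived from runs but from a static description: a target state for each cell, one
  parent for each cell, and a local condition on outputs. The deterministic run of the turtle only
  serves to produce that description.\<close>

text \<open>The alphabet may have a single letter, so only the length of a label carries information.\<close>

definition label :: "nat \<Rightarrow> 'a list" where
  "label n = replicate n undefined"

lemma label_eq_iff [simp]: "label m = label n \<longleftrightarrow> m = n"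
  unfolding label_def by (metis length_replicate)

lemma UNIV_dir: "(UNIV :: dir set) = {PosX, NegX, PosY, NegY, PosZ, NegZ}"
  using dir.exhaust by auto

lemma finite_dir [simp]: "finite (A :: dir set)"
  by (metis UNIV_dir finite.emptyI finite_insert finite_subset subset_UNIV)

lemma opposite_opposite [simp]: "opposite (opposite d) = d"
  by (cases d) auto

lemma opposite_neq [simp]: "opposite d \<noteq> d" "d \<noteq> opposite d"
  by (cases d; simp)+

lemma unit_vec_opposite: "unit_vec (opposite d) = - unit_vec d"
  by (cases d) auto

lemma add_unit_vec_opposite [simp]:
  "p + unit_vec d + unit_vec (opposite d) = p" "p + unit_vec (opposite d) + unit_vec d = p"
  by (simp_all add: unit_vec_opposite)

lemma unit_vec_nonzero [simp]: "unit_vec d \<noteq> 0"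
  by (cases d) (auto simp: zero_prod_def)

lemma unit_vec_inject [simp]: "unit_vec d = unit_vec e \<longleftrightarrow> d = e"
  by (cases d; cases e) auto

text \<open>\<open>ind s = Some e\<close> records the direction \<open>e\<close> in which the tile
  is entered, so the input glue sits on the side \<open>opposite e\<close>. It takes precedence over
  an output on that side; \<open>unmasked\<close> shows that no needed output is lost this
  way.\<close>

definition tile_of :: "('s::countable \<Rightarrow> dir \<Rightarrow> 's option) \<Rightarrow> ('s \<Rightarrow> dir option) \<Rightarrow> 's \<Rightarrow> 'a tile" where
  "tile_of out ind s d =
     (if ind s = Some (opposite d) then (label (to_nat s), 1)
      else case out s d of None \<Rightarrow> ([], 0) | Some s' \<Rightarrow> (label (to_nat s'), 1))"

lemma snd_tile_of_le: "snd (tile_of out ind s d) \<le> 1"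
  by (auto simp: tile_of_def split: option.split)

text \<open>Two inputs or two outputs never bind: equal codes would give one state both entry
  directions \<open>d\<close> and \<open>opposite d\<close>, which \<open>out_ind\<close> and the
  input rule exclude. So each bond leads from an output to an input.\<close>

lemma glues_bind_tile_of:
  assumes out_ind: "\<And>s d s'. out s d = Some s' \<Longrightarrow> ind s' = Some d"
  shows "glues_bind (tile_of out ind s d) (tile_of out ind s' (opposite d)) \<longleftrightarrow>
     (out s d = Some s' \<and> ind s \<noteq> Some (opposite d)) \<or>
     (out s' (opposite d) = Some s \<and> ind s' \<noteq> Some d)"
  using out_ind[of s d] out_ind[of s' "opposite d"]
  by (cases "ind s = Some (opposite d)"; cases "ind s' = Some d"; cases "out s d"; cases "out s' (opposite d)")
    (auto simp: glues_bind_def tile_of_def)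

lemma attach_strength_ge_1_iff:
  "1 \<le> attach_strength \<beta> p t \<longleftrightarrow>
     (\<exists>d u. \<beta> (p + unit_vec d) = Some u \<and> glues_bind (t d) (u (opposite d)))"
proof -
  have edge: "(p, d) \<in> binding_edges (\<beta>(p \<mapsto> t)) \<longleftrightarrow>
      (\<exists>u. \<beta> (p + unit_vec d) = Some u \<and> glues_bind (t d) (u (opposite d)))" for d
    by (auto simp: binding_edges_def)
  have "1 \<le> attach_strength \<beta> p t \<longleftrightarrow> attach_strength \<beta> p t \<noteq> 0" by auto
  also have "\<dots> \<longleftrightarrow> (\<exists>d. (p, d) \<in> binding_edges (\<beta>(p \<mapsto> t)) \<and> snd (t d) \<noteq> 0)"
    unfolding attach_strength_def by (subst sum_eq_0_iff) auto
  also have "\<dots> \<longleftrightarrow> (\<exists>d u. \<beta> (p + unit_vec d) = Some u \<and> glues_bind (t d) (u (opposite d)))"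
    unfolding edge by (auto simp: glues_bind_def)
  finally show ?thesis .
qed

text \<open>
  \<open>G c\<close> is a set of cells that are certainly occupied when the tile at \<open>c\<close> attaches, so that
  an output of that tile towards such a cell is harmless.
\<close>

locale growth_tree =
  fixes out :: "'s::countable \<Rightarrow> dir \<Rightarrow> 's option" and ind :: "'s \<Rightarrow> dir option"
    and S :: "'s set" and st :: "pos \<Rightarrow> 's option" and root :: pos and r :: 's
    and par :: "pos \<Rightarrow> pos" and rank :: "pos \<Rightarrow> nat" and G :: "pos \<Rightarrow> pos set"
  assumes out_ind: "out s d = Some s' \<Longrightarrow> ind s' = Some d"
    and finite_S: "finite S" and ran_st: "ran st \<subseteq> S" and finite_st: "finite (dom st)"
    and root: "st root = Some r" "ind r = None" "G root = {}"
    and child: "\<lbrakk>st c = Some s; c \<noteq> root\<rbrakk> \<Longrightarrow>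
      \<exists>d s'. c = par c + unit_vec d \<and> st (par c) = Some s' \<and> out s' d = Some s"
    and rank: "c \<in> dom st \<Longrightarrow> c \<noteq> root \<Longrightarrow> rank (par c) < rank c"
    and G: "c \<in> dom st \<Longrightarrow> c \<noteq> root \<Longrightarrow> par c \<in> G c \<and> G c \<subseteq> insert (par c) (G (par c))"
    and emit: "\<lbrakk>st c = Some s; out s d = Some s'\<rbrakk> \<Longrightarrow>
      c + unit_vec d \<in> G c \<or>
      (c + unit_vec d \<noteq> root \<and> st (c + unit_vec d) = Some s' \<and> par (c + unit_vec d) = c)"
begin

abbreviation tile :: "'s \<Rightarrow> 'a tile" where "tile \<equiv> tile_of out ind"

lemma glues_bind_tile:
  "glues_bind (tile s d) (tile s' (opposite d)) \<longleftrightarrow>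
     (out s d = Some s' \<and> ind s \<noteq> Some (opposite d)) \<or>
     (out s' (opposite d) = Some s \<and> ind s' \<noteq> Some d)"
  by (rule glues_bind_tile_of) (rule out_ind)

lemma par_in_dom: "st c = Some s \<Longrightarrow> c \<noteq> root \<Longrightarrow> par c \<in> dom st"
  using child by (metis domI)

definition grown :: "pos set \<Rightarrow> pos \<Rightarrow> 'a tile option" where
  "grown D p = (if p \<in> D then map_option tile (st p) else None)"

text \<open>The invariant of the domains of producible assemblies. As \<open>par c\<close> lies in
  \<open>G c\<close> for each cell except the root, such a set is closed under parents; it also
  contains all cells that \<open>G\<close> promises to be occupied.\<close>

definition closed_dom :: "pos set \<Rightarrow> bool" where
  "closed_dom D \<longleftrightarrow> root \<in> D \<and> D \<subseteq> dom st \<and> (\<forall>c\<in>D. G c \<subseteq> D)"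

lemma dom_grown: "D \<subseteq> dom st \<Longrightarrow> dom (grown D) = D"
  by (auto simp: grown_def dom_def)

lemma grown_insert: "st p = Some s \<Longrightarrow> (grown D)(p \<mapsto> tile s) = grown (insert p D)"
  by (auto simp: grown_def fun_eq_iff)

lemma closed_dom_insert:
  assumes D: "closed_dom D" and c: "c \<in> dom st" and p: "c = root \<or> par c \<in> D"
  shows "closed_dom (insert c D)"
proof (cases "c = root")
  case True
  then show ?thesis using D by (simp add: closed_dom_def insert_absorb)
next
  case False
  then have "G c \<subseteq> D"
    using G[OF c False] p False D unfolding closed_dom_def by blast
  then show ?thesis using D c by (auto simp: closed_dom_def)
qed

text \<open>If the input side covered this output, the tile at \<open>par c\<close> would have been
  entered from \<open>c\<close>. Then \<open>c\<close> would be the parent of its own parent,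
  against \<open>rank\<close>.\<close>

lemma unmasked:
  assumes "st c = Some s" "c \<noteq> root" "c = par c + unit_vec d" "st (par c) = Some s'" "out s' d = Some s"
  shows "ind s' \<noteq> Some (opposite d)"
proof
  assume masked: "ind s' = Some (opposite d)"
  then have ne: "par c \<noteq> root" using assms(4) root(1,2) by auto
  obtain e s'' where e: "par c = par (par c) + unit_vec e" "out s'' e = Some s'"
    using child[OF assms(4) ne] by auto
  then have "e = opposite d" using out_ind masked by fastforce
  then have "par (par c) = par c + unit_vec d"
    using e(1) add_unit_vec_opposite(2) by metis
  then have "par (par c) = c" using assms(3) by simp
  then show False using rank[OF domI[of st c s, OF assms(1)] assms(2)] rank[OF domI[of st "par c" s', OF assms(4)] ne] by simp
qed

lemma attachable:
  assumes D: "closed_dom D" and c: "st c = Some s" "c \<notin> D" and p: "par c \<in> D"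
  shows "can_attach (tile ` S) 1 (grown D) c (tile s)"
proof -
  have ne: "c \<noteq> root" using D c by (auto simp: closed_dom_def)
  obtain d s' where d: "c = par c + unit_vec d" "st (par c) = Some s'" "out s' d = Some s"
    using child[OF c(1) ne] by auto
  have bnd: "glues_bind (tile s (opposite d)) (tile s' (opposite (opposite d)))"
    unfolding glues_bind_tile using unmasked[OF c(1) ne d] d(3) by simp
  have "c + unit_vec (opposite d) = par c"
    using d(1) add_unit_vec_opposite(1) by metis
  then have "1 \<le> attach_strength (grown D) c (tile s)"
    unfolding attach_strength_ge_1_iff using bnd p d(2)
    by (intro exI[of _ "opposite d"] exI[of _ "tile s'"]) (simp add: grown_def)
  moreover have "s \<in> S" using ran_st ranI[of st c s] c(1) by blast
  moreover have "c \<notin> dom (grown D)" using c(2) by (auto simp: grown_def dom_def)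
  ultimately show ?thesis by (auto simp: can_attach_def)
qed

text \<open>No stray tile can attach. A bond from an output of the newcomer needs a neighbour whose
  input side faces \<open>p\<close>; then \<open>p\<close> is the parent of that neighbour and
  already occupied. A bond from an output of the neighbour is governed by \<open>emit\<close>: its
  target lies in \<open>G\<close> and is occupied, or it is a child waiting for just this
  tile.\<close>

lemma attach_cases:
  fixes t :: "'a tile"
  assumes D: "closed_dom D" and att: "can_attach (tile ` S) 1 (grown D) p t"
  obtains s where "st p = Some s" "t = tile s" "p \<notin> D" "par p \<in> D"
proof -
  obtain s where s: "s \<in> S" "t = tile s" and pD: "p \<notin> dom (grown D :: 'a assembly)"
    and str: "1 \<le> attach_strength (grown D) p t"
    using att unfolding can_attach_def by blast
  have D': "D \<subseteq> dom st" using D by (auto simp: closed_dom_def)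
  have pD: "p \<notin> D" using pD by (simp add: dom_grown[OF D'])
  obtain d u where du: "grown D (p + unit_vec d) = Some u" "glues_bind (t d) (u (opposite d))"
    using str unfolding attach_strength_ge_1_iff by auto
  define c where "c = p + unit_vec d"
  have cD: "c \<in> D" using du(1) by (auto simp: c_def grown_def split: if_splits)
  then obtain s' where s': "st c = Some s'" "u = tile s'"
    using du(1) by (auto simp: c_def grown_def)
  have pc: "p = c + unit_vec (opposite d)"
    unfolding c_def by simp
  have Gc: "G c \<subseteq> D" using D cD by (auto simp: closed_dom_def)
  have "(out s d = Some s' \<and> ind s \<noteq> Some (opposite d)) \<or>
        (out s' (opposite d) = Some s \<and> ind s' \<noteq> Some d)"
    using du(2) unfolding s(2) s'(2) glues_bind_tile .
  then show ?thesis
  proof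
    assume "out s d = Some s' \<and> ind s \<noteq> Some (opposite d)"
    then have ind: "ind s' = Some d" using out_ind by blast
    then have ne: "c \<noteq> root" using s'(1) root by auto
    obtain e s'' where e: "c = par c + unit_vec e" "out s'' e = Some s'"
      using child[OF s'(1) ne] by auto
    then have "e = d" using out_ind ind by fastforce
    then have "p = par c" using e(1) c_def by simp
    moreover have "par c \<in> D" using G[of c] s'(1) ne Gc by auto
    ultimately show thesis using pD by simp
  next
    assume o: "out s' (opposite d) = Some s \<and> ind s' \<noteq> Some d"
    have "p \<in> G c \<or> (p \<noteq> root \<and> st p = Some s \<and> par p = c)"
      using emit[OF s'(1), of "opposite d" s] o pc by simp
    then show thesis using that[of s] pD Gc cD s(2) by auto
  qed
qed

lemma producible_grown:
  assumes "producible (tile ` S) [root \<mapsto> tile r] 1 \<alpha>"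
  shows "\<exists>D. closed_dom D \<and> \<alpha> = grown D"
  using assms
proof (induction rule: producible.induct)
  case seed
  have "closed_dom {root}" using root(1,3) by (auto simp: closed_dom_def)
  moreover have "[root \<mapsto> tile r] = grown {root}" using root(1) by (auto simp: grown_def fun_eq_iff)
  ultimately show ?case by blast
next
  case (attach \<beta> p t)
  then obtain D where D: "closed_dom D" "\<beta> = grown D" by auto
  obtain s where s: "st p = Some s" "t = tile s" "p \<notin> D" "par p \<in> D"
    using attach_cases[OF D(1)] attach(2) D(2) by blast
  have "closed_dom (insert p D)" using closed_dom_insert[OF D(1)] s by blast
  then show ?case using grown_insert[OF s(1), of D] s(2) D(2) by metis
qed

text \<open>A missing cell of least \<open>rank\<close> has its parent present.\<close>

lemma extendable:
  assumes D: "closed_dom D" and ne: "D \<noteq> dom st"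
  obtains c s where "st c = Some s" "c \<notin> D" "par c \<in> D"
proof -
  define B where "B = dom st - D"
  have "B \<noteq> {}" using D ne by (auto simp: closed_dom_def B_def)
  then obtain c where c: "c \<in> B" "\<And>c'. c' \<in> B \<Longrightarrow> rank c \<le> rank c'"
    using arg_min_nat_lemma[of "\<lambda>c. c \<in> B" _ rank] by (metis ex_in_conv)
  have cr: "c \<noteq> root" using c(1) D by (auto simp: B_def closed_dom_def)
  obtain s where s: "st c = Some s" using c(1) by (auto simp: B_def)
  have "par c \<in> dom st" using par_in_dom[OF s cr] .
  moreover have "par c \<notin> B" using c(2)[of "par c"] rank[OF domI[of st c s, OF s] cr] by linarith
  ultimately show thesis using that[OF s] c(1) by (auto simp: B_def)
qed

lemma producible_full:
  shows "producible (tile ` S :: 'a tile set) [root \<mapsto> tile r] 1 (grown (dom st))"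
proof -
  have "closed_dom D \<Longrightarrow> producible (tile ` S :: 'a tile set) [root \<mapsto> tile r] 1 (grown D) \<Longrightarrow> ?thesis" for D
  proof (induction "card (dom st - D)" arbitrary: D rule: less_induct)
    case less
    show ?case
    proof (cases "D = dom st")
      case False
      obtain c s where c: "st c = Some s" "c \<notin> D" "par c \<in> D"
        using extendable[OF less(2) False] .
      have "producible (tile ` S :: 'a tile set) [root \<mapsto> tile r] 1 ((grown D)(c \<mapsto> tile s))"
        using producible.attach[OF less(3) attachable[OF less(2) c]] .
      then have pr: "producible (tile ` S :: 'a tile set) [root \<mapsto> tile r] 1 (grown (insert c D))"
        by (simp add: grown_insert[OF c(1)])
      have "card (dom st - insert c D) < card (dom st - D)"
        using c(1,2) finite_st by (intro psubset_card_mono) auto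
      then show ?thesis using less(1) closed_dom_insert[OF less(2)] c pr by blast
    qed (use less in simp)
  qed
  moreover have "closed_dom {root}" "[root \<mapsto> tile r] = grown {root}"
    using root(1,3) by (auto simp: closed_dom_def grown_def fun_eq_iff)
  ultimately show ?thesis using producible.seed by metis
qed

theorem uniquely_produces_tree:
  shows "uniquely_produces (tile ` S :: 'a tile set) [root \<mapsto> tile r] 1 (dom st)"
proof -
  have full: "closed_dom (dom st)"
  proof -
    have "c \<in> dom st \<Longrightarrow> G c \<subseteq> dom st" for c
    proof (induction "rank c" arbitrary: c rule: less_induct)
      case less
      show ?case
      proof (cases "c = root")
        case False
        obtain s where "st c = Some s" using less(2) by blast
        then have "par c \<in> dom st" using par_in_dom False by blast
        then show ?thesis using less(1)[OF rank[OF less(2) False]] G[OF less(2) False] by blast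
      qed (use root in auto)
    qed
    then show ?thesis using domI[of st root, OF root(1)] by (simp add: closed_dom_def)
  qed
  have "terminal_assemblies (tile ` S :: 'a tile set) [root \<mapsto> tile r] 1 = {grown (dom st)}"
  proof (intro equalityI subsetI)
    fix \<alpha> assume "\<alpha> \<in> terminal_assemblies (tile ` S :: 'a tile set) [root \<mapsto> tile r] 1"
    then have \<alpha>: "producible (tile ` S) [root \<mapsto> tile r] 1 \<alpha>" "terminal (tile ` S) 1 \<alpha>"
      by (simp_all add: terminal_assemblies_def)
    obtain D where D: "closed_dom D" "\<alpha> = grown D" using producible_grown[OF \<alpha>(1)] by blast
    have "D = dom st"
    proof (rule ccontr)
      assume "D \<noteq> dom st"
      then obtain c s where c: "st c = Some s" "c \<notin> D" "par c \<in> D" using extendable[OF D(1)] by blast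
      show False using attachable[OF D(1) c] \<alpha>(2) D(2) unfolding terminal_def by blast
    qed
    then show "\<alpha> \<in> {grown (dom st)}" using D by simp
  next
    fix \<alpha> :: "'a assembly" assume "\<alpha> \<in> {grown (dom st)}"
    moreover have "terminal (tile ` S :: 'a tile set) 1 (grown (dom st))"
      unfolding terminal_def
    proof (intro notI, elim exE)
      fix p and t :: "'a tile" assume "can_attach (tile ` S) 1 (grown (dom st)) p t"
      then obtain s where "st p = Some s" "p \<notin> dom st" using attach_cases[OF full] by metis
      then show False by (simp add: domIff)
    qed
    ultimately show "\<alpha> \<in> terminal_assemblies (tile ` S) [root \<mapsto> tile r] 1"
      using producible_full by (simp add: terminal_assemblies_def)
  qed
  moreover have "dom (grown (dom st) :: 'a assembly) = dom st" by (simp add: dom_grown)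
  ultimately show ?thesis unfolding uniquely_produces_def directed_def by simp
qed

lemma tile_assembly_system_tree:
  shows "tile_assembly_system (tile ` S :: 'a tile set) [root \<mapsto> tile r] 1"
proof -
  have "dom [root \<mapsto> tile r :: 'a tile] = {root}" by simp
  \<comment> \<open>A single cell has no nonempty proper part, so there is no cut to check.\<close>
  then have "stable 1 [root \<mapsto> tile r :: 'a tile]"
    unfolding stable_def by (metis psubsetD psubset_imp_subset subset_singletonD order_less_irrefl)
  moreover have "r \<in> S" using ran_st ranI[of st root r] root(1) by blast
  ultimately show ?thesis
    unfolding tile_assembly_system_def using finite_S by (simp add: snd_tile_of_le[simplified])
qed

end

section \<open>Self-avoiding turtles and rows of bits\<close>

type_synonym 'q prog = "'q \<Rightarrow> (dir \<times> dir list \<times> 'q) list"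
type_synonym 'q cfg = "pos set \<times> (pos \<times> 'q) set \<times> pos \<times> dir list \<times> 'q"

text \<open>
  A configuration \<open>(U, M, p, ds, q)\<close> of a self-avoiding turtle consists of the visited cells, the
  log of marked states, the current cell, the pending moves and the control state.  A branch is
  taken only when all other alternatives are blocked, so that a run is deterministic.
\<close>

inductive step :: "'q prog \<Rightarrow> ('q \<Rightarrow> bool) \<Rightarrow> 'q cfg \<Rightarrow> 'q cfg \<Rightarrow> bool" for P E where
  move: "p + unit_vec d \<notin> U \<Longrightarrow>
    step P E (U, M, p, d # ds, q) (insert (p + unit_vec d) U, M, p + unit_vec d, ds, q)"
| branch: "\<lbrakk>(d, ds, q') \<in> set (P q); p + unit_vec d \<notin> U;
      \<forall>e es r. (e, es, r) \<in> set (P q) \<longrightarrow> e \<noteq> d \<longrightarrow> p + unit_vec e \<in> U\<rbrakk> \<Longrightarrow>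
    step P E (U, M, p, [], q)
      (insert (p + unit_vec d) U, if E q then insert (p, q) M else M, p + unit_vec d, ds, q')"

abbreviation run :: "'q prog \<Rightarrow> ('q \<Rightarrow> bool) \<Rightarrow> 'q cfg \<Rightarrow> 'q cfg \<Rightarrow> bool" where
  "run P E \<equiv> (step P E)\<^sup>*\<^sup>*"

lemma step_visited: "step P E c c' \<Longrightarrow> fst c \<subseteq> fst c'"
  by (induction rule: step.induct) auto

lemma run_visited: "run P E c c' \<Longrightarrow> fst c \<subseteq> fst c'"
  by (induction rule: rtranclp_induct) (auto dest: step_visited)

section \<open>Invariance of runs under a larger environment\<close>

fun frame :: "pos set \<Rightarrow> (pos \<times> 'q) set \<Rightarrow> 'q cfg \<Rightarrow> 'q cfg" where
  "frame X Y (U, M, r) = (U \<union> X, M \<union> Y, r)"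

text \<open>More occupied cells can only help a branch, which asks for the other alternatives to be
  blocked; they must merely avoid the cell entered. So runs are local: they are computed in a small
  environment and then transferred.\<close>

lemma step_frame:
  assumes "step P E c c'" "X \<inter> (fst c' - fst c) = {}"
  shows "step P E (frame X Y c) (frame X Y c')"
  using assms
proof (cases rule: step.cases)
  case (move p d U M ds q)
  then have "p + unit_vec d \<notin> U \<union> X" using assms(2) by auto
  from step.move[OF this, of P E "M \<union> Y" ds q] show ?thesis using move by simp
next
  case (branch d ds q' q p U M)
  then have "p + unit_vec d \<notin> U \<union> X" using assms(2) by auto
  from step.branch[of d ds q' P q, OF branch(3) this, of E "M \<union> Y"] show ?thesis
    using branch by (auto split: if_splits)
qed

lemma run_frame_cfg:
  assumes "run P E c c'" "X \<inter> (fst c' - fst c) = {}"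
  shows "run P E (frame X Y c) (frame X Y c')"
  using assms
proof (induction rule: rtranclp_induct)
  case (step c1 c2)
  have "fst c \<subseteq> fst c1" "fst c1 \<subseteq> fst c2"
    using step run_visited step_visited by blast+
  then have "X \<inter> (fst c1 - fst c) = {}" "X \<inter> (fst c2 - fst c1) = {}" using step.prems by auto
  then show ?case using step.IH step_frame[OF step.hyps(2)] by (meson rtranclp.rtrancl_into_rtrancl)
qed simp

lemma run_frame:
  assumes "run P E (U, M, r) (U', M', r')" "X \<inter> (U' - U) = {}"
  shows "run P E (U \<union> X, M \<union> Y, r) (U' \<union> X, M' \<union> Y, r')"
  using run_frame_cfg[OF assms(1), of X Y] assms(2) by simp

section \<open>Invariance of runs under rigid motions and renaming of states\<close>

definition motion :: "(pos \<Rightarrow> pos) \<Rightarrow> (dir \<Rightarrow> dir) \<Rightarrow> bool" where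
  "motion \<phi> \<delta> \<longleftrightarrow> inj \<phi> \<and> (\<forall>p d. \<phi> (p + unit_vec d) = \<phi> p + unit_vec (\<delta> d))"

lemma motion_inj: "motion \<phi> \<delta> \<Longrightarrow> \<phi> p = \<phi> p' \<longleftrightarrow> p = p'"
  by (auto simp: motion_def inj_eq)

lemma motion_unit_vec: "motion \<phi> \<delta> \<Longrightarrow> \<phi> p + unit_vec (\<delta> d) = \<phi> (p + unit_vec d)"
  by (metis motion_def)

lemma motion_mem: "motion \<phi> \<delta> \<Longrightarrow> \<phi> p \<in> \<phi> ` U \<longleftrightarrow> p \<in> U"
  by (auto simp: motion_inj)

definition turn :: "(dir \<Rightarrow> dir) \<Rightarrow> ('q \<Rightarrow> 'r) \<Rightarrow> (dir \<times> dir list \<times> 'q) list \<Rightarrow> (dir \<times> dir list \<times> 'r) list" where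
  "turn \<delta> h = map (\<lambda>(d, ds, q). (\<delta> d, map \<delta> ds, h q))"

fun map_cfg :: "(pos \<Rightarrow> pos) \<Rightarrow> (dir \<Rightarrow> dir) \<Rightarrow> ('q \<Rightarrow> 'r) \<Rightarrow> 'q cfg \<Rightarrow> 'r cfg" where
  "map_cfg \<phi> \<delta> h (U, M, p, ds, q) = (\<phi> ` U, map_prod \<phi> h ` M, \<phi> p, map \<delta> ds, h q)"

text \<open>The programs have to agree only where \<open>P\<close> goes on. Where
  \<open>P q = []\<close>, the program \<open>P'\<close> may continue, which later lets one strip
  hand over to the next.\<close>

lemma step_map_cfg:
  assumes \<phi>: "motion \<phi> \<delta>"
    and P': "\<And>q. P q \<noteq> [] \<Longrightarrow> P' (h q) = turn \<delta> h (P q)"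
    and E': "\<And>q. E' (h q) = E q"
    and st: "step P E c c'"
  shows "step P' E' (map_cfg \<phi> \<delta> h c) (map_cfg \<phi> \<delta> h c')"
  using st
proof (cases rule: step.cases)
  case (move p d U M ds q)
  have "\<phi> p + unit_vec (\<delta> d) \<notin> \<phi> ` U"
    using move(3) \<phi> by (simp add: motion_unit_vec motion_mem)
  from step.move[OF this, of P' E' "map_prod \<phi> h ` M" "map \<delta> ds" "h q"]
  show ?thesis using move \<phi> by (simp add: motion_unit_vec)
next
  case (branch d ds q' q p U M)
  have P'q: "P' (h q) = turn \<delta> h (P q)" using P' branch(3) by (metis empty_iff list.set(1))
  have 1: "(\<delta> d, map \<delta> ds, h q') \<in> set (P' (h q))"
    unfolding P'q turn_def using branch(3) by force
  have 2: "\<phi> p + unit_vec (\<delta> d) \<notin> \<phi> ` U"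
    using branch(4) \<phi> by (simp add: motion_unit_vec motion_mem)
  have 3: "\<phi> p + unit_vec e \<in> \<phi> ` U" if "(e, es, r) \<in> set (P' (h q))" "e \<noteq> \<delta> d" for e es r
  proof -
    obtain e' es' r' where e': "(e', es', r') \<in> set (P q)" "e = \<delta> e'"
      using \<open>(e, es, r) \<in> set (P' (h q))\<close> unfolding P'q turn_def by auto
    then show ?thesis using branch(5) that(2) \<phi> by (auto simp: motion_unit_vec motion_mem)
  qed
  have "step P' E' (\<phi> ` U, map_prod \<phi> h ` M, \<phi> p, [], h q)
     (insert (\<phi> p + unit_vec (\<delta> d)) (\<phi> ` U),
      if E' (h q) then insert (\<phi> p, h q) (map_prod \<phi> h ` M) else map_prod \<phi> h ` M,
      \<phi> p + unit_vec (\<delta> d), map \<delta> ds, h q')"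
    using step.branch[of "\<delta> d" "map \<delta> ds" "h q'" P' "h q" "\<phi> p" "\<phi> ` U" E'] 1 2 3 by blast
  then show ?thesis using branch(1,2) \<phi> by (cases "E q") (simp_all add: motion_unit_vec E')
qed

lemma run_map_cfg:
  assumes "motion \<phi> \<delta>" "\<And>q. P q \<noteq> [] \<Longrightarrow> P' (h q) = turn \<delta> h (P q)" "\<And>q. E' (h q) = E q"
    and "run P E c c'"
  shows "run P' E' (map_cfg \<phi> \<delta> h c) (map_cfg \<phi> \<delta> h c')"
  using assms(4)
proof (induction rule: rtranclp_induct)
  case (step c1 c2)
  then show ?case
    using step_map_cfg[of \<phi> \<delta> P P' h E' E, OF assms(1,2,3)] by (meson rtranclp.rtrancl_into_rtrancl)
qed simp

fun trace :: "pos \<Rightarrow> dir list \<Rightarrow> pos list" where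
  "trace p [] = []"
| "trace p (d # ds) = (p + unit_vec d) # trace (p + unit_vec d) ds"

fun end_pos :: "pos \<Rightarrow> dir list \<Rightarrow> pos" where
  "end_pos p [] = p"
| "end_pos p (d # ds) = end_pos (p + unit_vec d) ds"

lemma trace_motion: "motion \<phi> \<delta> \<Longrightarrow> trace (\<phi> p) (map \<delta> ds) = map \<phi> (trace p ds)"
  by (induction ds arbitrary: p) (auto simp: motion_unit_vec)

lemma end_pos_motion: "motion \<phi> \<delta> \<Longrightarrow> end_pos (\<phi> p) (map \<delta> ds) = \<phi> (end_pos p ds)"
  by (induction ds arbitrary: p) (auto simp: motion_unit_vec)

lemma run_moves:
  "\<lbrakk>distinct (trace p ds); set (trace p ds) \<inter> U = {}\<rbrakk> \<Longrightarrow>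
    run P E (U, M, p, ds, q) (U \<union> set (trace p ds), M, end_pos p ds, [], q)"
proof (induction ds arbitrary: p U)
  case (Cons d ds)
  let ?p = "p + unit_vec d"
  have "step P E (U, M, p, d # ds, q) (insert ?p U, M, ?p, ds, q)"
    using Cons.prems by (intro step.move) auto
  moreover have "run P E (insert ?p U, M, ?p, ds, q)
      (insert ?p U \<union> set (trace ?p ds), M, end_pos ?p ds, [], q)"
    using Cons.prems by (intro Cons.IH) auto
  ultimately show ?case by (simp add: converse_rtranclp_into_rtranclp)
qed simp

lemma run_branch:
  assumes "(d, ds, q') \<in> set (P q)"
    and "\<forall>e es r. (e, es, r) \<in> set (P q) \<longrightarrow> e \<noteq> d \<longrightarrow> p + unit_vec e \<in> U"
    and "distinct (trace p (d # ds))" "set (trace p (d # ds)) \<inter> U = {}"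
  shows "run P E (U, M, p, [], q)
    (U \<union> set (trace p (d # ds)), if E q then insert (p, q) M else M, end_pos p (d # ds), [], q')"
proof -
  let ?p = "p + unit_vec d" and ?M = "if E q then insert (p, q) M else M"
  have "step P E (U, M, p, [], q) (insert ?p U, ?M, ?p, ds, q')"
    using assms by (intro step.branch) auto
  moreover have "run P E (insert ?p U, ?M, ?p, ds, q')
      (insert ?p U \<union> set (trace ?p ds), ?M, end_pos ?p ds, [], q')"
    using assms by (intro run_moves) auto
  ultimately show ?thesis by (simp add: converse_rtranclp_into_rtranclp)
qed

section \<open>The geometry of a single bit\<close>

datatype 'q action = Read "bool \<Rightarrow> bool option \<times> 'q" | Write "bool option" 'q | Move dir "dir list" 'q | Stop

text \<open>
  A bit is stored as a bump in the row of the reader: it blocks either the forward cell or the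
  cell above.  A reader at \<open>(0, 0, 0)\<close> leaves through the other one and reaches \<open>(3, 0, 0)\<close>,
  remembering the exit.  Then the writer bumps into the next row, at \<open>y = 1\<close>, where the
  next reader passes in the opposite direction, and stops at \<open>(8, 0, 0)\<close>.
\<close>

fun read_moves :: "bool option \<Rightarrow> dir list" where
  "read_moves (Some False) = [PosZ, PosX, PosX, PosX, NegZ]"
| "read_moves _ = [PosX, PosX, PosX]"

fun write_moves :: "bool option \<Rightarrow> dir list" where
  "write_moves None = [PosX, PosX, PosX, PosX, PosX]"
| "write_moves (Some False) = [PosX, PosX, PosY, PosX, NegY, PosX, PosX]"
| "write_moves (Some True) = [PosX, PosX, PosX, PosZ, PosY, PosX, NegY, NegZ, PosX]"

definition alternative :: "dir list \<Rightarrow> 'q \<Rightarrow> dir \<times> dir list \<times> 'q" where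
  "alternative ds q = (hd ds, List.tl ds, q)"

fun act_prog :: "'q action \<Rightarrow> (dir \<times> dir list \<times> 'q) list" where
  "act_prog (Read f) =
     map (\<lambda>b. alternative (read_moves (Some b) @ write_moves (fst (f b))) (snd (f b))) [False, True]"
| "act_prog (Write y q) = [alternative (read_moves None @ write_moves y) q]"
| "act_prog (Move d ds q) = [(d, ds, q)]"
| "act_prog Stop = []"

fun bump :: "bool option \<Rightarrow> pos set" where
  "bump None = {}"
| "bump (Some False) = {(1, 0, 0), (2, 0, 0)}"
| "bump (Some True) = {(0, 0, 1), (1, 0, 1)}"

fun bump_out :: "bool option \<Rightarrow> pos set" where
  "bump_out None = {}"
| "bump_out (Some False) = {(5, 1, 0), (6, 1, 0)}"
| "bump_out (Some True) = {(6, 1, 1), (7, 1, 1)}"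

definition block :: "bool option \<Rightarrow> bool option \<Rightarrow> pos set" where
  "block x y = set (trace (0, 0, 0) (read_moves x @ write_moves y))"

lemma option_bool_cases: "x = None \<or> x = Some False \<or> x = Some True"
  by (cases x) auto

text \<open>The starting cell \<open>(0, 0, 0)\<close> is absent, since it is entered before the
  block begins, while \<open>(8, 0, 0)\<close> is present and is the starting cell of the next
  block. This makes consecutive blocks disjoint.\<close>

lemma block_bounds:
  "p \<in> block x y \<Longrightarrow> \<exists>a b c. p = (a, b, c) \<and> 0 \<le> a \<and> a \<le> 8 \<and> (b = 0 \<or> b = 1) \<and> (c = 0 \<or> c = 1)
    \<and> (a = 0 \<longrightarrow> c = 1) \<and> (a = 8 \<longrightarrow> b = 0 \<and> c = 0)"
  using option_bool_cases[of x] option_bool_cases[of y] by (elim disjE) (auto simp: block_def)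

lemma bump_bounds:
  "p \<in> bump x \<Longrightarrow> \<exists>a c. p = (a, 0, c) \<and> 0 \<le> a \<and> a \<le> 2 \<and> (c = 0 \<or> c = 1) \<and> (a = 0 \<longrightarrow> c = 1)"
  using option_bool_cases[of x] by (elim disjE) auto

lemma block_upper: "(a, 1, c) \<in> block x y \<longleftrightarrow> (a, 1, c) \<in> bump_out y"
  using option_bool_cases[of x] option_bool_cases[of y] by (elim disjE) (auto simp: block_def)

text \<open>The ground cells skipped by the detour over a stored \<open>False\<close> are exactly
  those of its bump. Hence no gap remains in the plane \<open>z = 0\<close>, whatever is read or
  written.\<close>

lemma block_lower: "(a, 0, 0) \<in> bump x \<union> block x y \<longleftrightarrow> 1 \<le> a \<and> a \<le> 8"
proof -
  have "1 \<le> a \<and> a \<le> 8 \<longleftrightarrow> a \<in> {1, 2, 3, 4, 5, 6, 7, 8 :: int}" by auto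
  then show ?thesis
    using option_bool_cases[of x] option_bool_cases[of y] by (elim disjE) (auto simp: block_def)
qed

lemma moves_ok:
  "distinct (trace (0, 0, 0) (read_moves x @ write_moves y))"
  "block x y \<inter> bump x = {}"
  "end_pos (0, 0, 0) (read_moves x @ write_moves y) = (8, 0, 0)"
  using option_bool_cases[of x] option_bool_cases[of y] by (elim disjE; simp add: block_def)+

lemma read_write_moves_Cons: "\<exists>d ds. read_moves x @ write_moves y = d # ds"
  using option_bool_cases[of x] by (elim disjE) auto

text \<open>The environment is the bump alone, and it has to block each alternative except the one
  for the stored bit. All other occupied cells are added later by \<open>run_frame\<close>.\<close>

lemma run_block_aux:
  assumes \<phi>: "motion \<phi> \<delta>" and P: "P q = turn \<delta> id (act_prog (A q))" and E: "\<not> E q"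
    and alt: "alternative (read_moves x @ write_moves y) q' \<in> set (act_prog (A q))"
    and blocked: "\<And>e es r. (e, es, r) \<in> set (act_prog (A q)) \<Longrightarrow>
      e \<noteq> hd (read_moves x @ write_moves y) \<Longrightarrow> unit_vec e \<in> bump x"
  shows "run P E (\<phi> ` bump x, M, \<phi> (0, 0, 0), [], q)
     (\<phi> ` (bump x \<union> block x y), M, \<phi> (8, 0, 0), [], q')"
proof -
  obtain d ds where ds: "read_moves x @ write_moves y = d # ds"
    using read_write_moves_Cons by blast
  have mem: "(d, ds, q') \<in> set (act_prog (A q))"
    using alt by (simp add: ds alternative_def)
  have tr: "trace (\<phi> (0, 0, 0)) (\<delta> d # map \<delta> ds) = map \<phi> (trace (0, 0, 0) (d # ds))"
    using trace_motion[OF \<phi>, of "(0, 0, 0)" "d # ds"] by (simp only: list.map)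
  have en: "end_pos (\<phi> (0, 0, 0)) (\<delta> d # map \<delta> ds) = \<phi> (8, 0, 0)"
    using end_pos_motion[OF \<phi>, of "(0, 0, 0)" "d # ds"] moves_ok(3)[of x y] by (simp only: list.map ds)
  have inj: "inj_on \<phi> A" for A using \<phi> by (auto simp: motion_def intro: inj_on_subset)
  have "run P E (\<phi> ` bump x, M, \<phi> (0, 0, 0), [], q)
    (\<phi> ` bump x \<union> set (trace (\<phi> (0, 0, 0)) (\<delta> d # map \<delta> ds)), if E q then insert (\<phi> (0, 0, 0), q) M else M,
     end_pos (\<phi> (0, 0, 0)) (\<delta> d # map \<delta> ds), [], q')"
  proof (rule run_branch)
    show "(\<delta> d, map \<delta> ds, q') \<in> set (P q)"
      using mem by (force simp: P turn_def)
    show "\<forall>e es r. (e, es, r) \<in> set (P q) \<longrightarrow> e \<noteq> \<delta> d \<longrightarrow> \<phi> (0, 0, 0) + unit_vec e \<in> \<phi> ` bump x"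
    proof (intro allI impI)
      fix e es r assume "(e, es, r) \<in> set (P q)" "e \<noteq> \<delta> d"
      then obtain e' es' r' where e: "e = \<delta> e'" "(e', es', r') \<in> set (act_prog (A q))" "e' \<noteq> d"
        by (auto simp: P turn_def)
      then have "unit_vec e' \<in> bump x" using blocked[of e'] by (simp add: ds)
      then show "\<phi> (0, 0, 0) + unit_vec e \<in> \<phi> ` bump x"
        using motion_unit_vec[OF \<phi>, of "(0, 0, 0)" e'] by (simp add: e(1) zero_prod_def[symmetric])
    qed
    show "distinct (trace (\<phi> (0, 0, 0)) (\<delta> d # map \<delta> ds))"
      unfolding tr distinct_map using moves_ok(1)[of x y] inj unfolding ds by blast
    show "set (trace (\<phi> (0, 0, 0)) (\<delta> d # map \<delta> ds)) \<inter> \<phi> ` bump x = {}"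
    proof -
      have "set (trace (0, 0, 0) (d # ds)) \<inter> bump x = {}"
        using moves_ok(2)[of x y] by (simp add: block_def ds)
      then show ?thesis
        unfolding tr set_map using image_Int[of \<phi>] \<phi> by (metis image_empty motion_def)
    qed
  qed
  then show ?thesis
    using E unfolding tr en by (simp add: image_Un block_def ds)
qed

lemma run_block_read:
  assumes "motion \<phi> \<delta>" "P q = turn \<delta> id (act_prog (A q))" "\<not> E q" and A: "A q = Read f" "f b = (y, q')"
  shows "run P E (\<phi> ` bump (Some b), M, \<phi> (0, 0, 0), [], q)
     (\<phi> ` (bump (Some b) \<union> block (Some b) y), M, \<phi> (8, 0, 0), [], q')"
proof (rule run_block_aux[where A = A and \<delta> = \<delta>])
  show "alternative (read_moves (Some b) @ write_moves y) q' \<in> set (act_prog (A q))"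
    using A by (cases b) auto
  fix e es r assume "(e, es, r) \<in> set (act_prog (A q))"
    "e \<noteq> hd (read_moves (Some b) @ write_moves y)"
  then show "unit_vec e \<in> bump (Some b)"
    using A by (cases b) (auto simp: alternative_def)
qed (use assms in auto)

lemma run_block_write:
  assumes "motion \<phi> \<delta>" "P q = turn \<delta> id (act_prog (A q))" "\<not> E q" and A: "A q = Write y q'"
  shows "run P E ({}, M, \<phi> (0, 0, 0), [], q) (\<phi> ` block None y, M, \<phi> (8, 0, 0), [], q')"
  using run_block_aux[where A = A and P = P and E = E and q = q and x = None and y = y and q' = q' and M = M] assms
  by (simp add: alternative_def)

text \<open>One list element per block of eight cells; \<open>None\<close> in the input is a block
  without bump. \<open>R\<close> selects the states of one direction of travel, so that a single
  motion carries the whole row.\<close>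

inductive row :: "('q \<Rightarrow> 'q action) \<Rightarrow> ('q \<Rightarrow> bool) \<Rightarrow> 'q \<Rightarrow> bool option list \<Rightarrow> bool option list \<Rightarrow> 'q \<Rightarrow> bool"
  for A R where
  row_Nil: "row A R q [] [] q"
| row_Read: "\<lbrakk>R q; A q = Read f; f b = (y, q'); row A R q' xs ys q''\<rbrakk> \<Longrightarrow>
    row A R q (Some b # xs) (y # ys) q''"
| row_Write: "\<lbrakk>R q; A q = Write y q'; row A R q' xs ys q''\<rbrakk> \<Longrightarrow> row A R q (None # xs) (y # ys) q''"

lemma row_simps:
  "row A R q [] ys q'' \<longleftrightarrow> ys = [] \<and> q'' = q"
  "row A R q (Some b # xs) (y # ys) q'' \<longleftrightarrow>
     R q \<and> (\<exists>f. A q = Read f \<and> fst (f b) = y \<and> row A R (snd (f b)) xs ys q'')"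
  "row A R q (None # xs) (y # ys) q'' \<longleftrightarrow> R q \<and> (\<exists>q'. A q = Write y q' \<and> row A R q' xs ys q'')"
  by (subst row.simps; fastforce)+

lemma row_length: "row A R q xs ys q' \<Longrightarrow> length ys = length xs"
  by (induction rule: row.induct) auto

abbreviation shift :: "pos \<Rightarrow> pos" where "shift p \<equiv> p + (8, 0, 0)"

fun row_in :: "bool option list \<Rightarrow> pos set" where
  "row_in [] = {}"
| "row_in (x # xs) = bump x \<union> shift ` row_in xs"

fun row_out :: "bool option list \<Rightarrow> pos set" where
  "row_out [] = {}"
| "row_out (y # ys) = bump_out y \<union> shift ` row_out ys"

fun row_new :: "bool option list \<Rightarrow> bool option list \<Rightarrow> pos set" where
  "row_new (x # xs) (y # ys) = block x y \<union> shift ` row_new xs ys"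
| "row_new _ _ = {}"

lemma mem_translate:
  "(a, b, c) \<in> (\<lambda>p. p + (u, v, w)) ` X \<longleftrightarrow> (a - u, b - v, c - w) \<in> (X :: pos set)"
proof
  assume "(a - u, b - v, c - w) \<in> X"
  then show "(a, b, c) \<in> (\<lambda>p. p + (u, v, w)) ` X" by (rule rev_image_eqI) simp
next
  assume "(a, b, c) \<in> (\<lambda>p. p + (u, v, w)) ` X"
  then obtain p where "p \<in> X" "(a, b, c) = p + (u, v, w)" by blast
  then show "(a - u, b - v, c - w) \<in> X" by (cases p) simp
qed

lemma mem_shift: "(a, b, c) \<in> shift ` X \<longleftrightarrow> (a - 8, b, c) \<in> X"
  by (simp add: mem_translate)

lemma row_in_bounds:
  "(a, b, c) \<in> row_in xs \<Longrightarrow> 0 \<le> a \<and> a \<le> 8 * int (length xs) \<and> b = 0 \<and> (c = 0 \<or> c = 1) \<and> (a = 0 \<longrightarrow> c = 1)"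
proof (induction xs arbitrary: a)
  case (Cons x xs)
  from Cons.prems have "(a, b, c) \<in> bump x \<or> (a - 8, b, c) \<in> row_in xs"
    by (simp add: mem_shift)
  then show ?case
  proof
    assume "(a, b, c) \<in> bump x"
    then show ?thesis using bump_bounds[of "(a, b, c)" x] by auto
  next
    assume "(a - 8, b, c) \<in> row_in xs"
    from Cons.IH[OF this] show ?thesis by auto
  qed
qed simp

lemma row_new_bounds:
  "(a, b, c) \<in> row_new xs ys \<Longrightarrow> 0 \<le> a \<and> a \<le> 8 * int (length xs) \<and> (b = 0 \<or> b = 1) \<and> (c = 0 \<or> c = 1)
     \<and> (a = 0 \<longrightarrow> c = 1)"
proof (induction xs ys arbitrary: a rule: row_new.induct)
  case (1 x xs y ys)
  from 1(2) have "(a, b, c) \<in> block x y \<or> (a - 8, b, c) \<in> row_new xs ys"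
    by (simp add: mem_shift)
  then show ?case
  proof
    assume "(a, b, c) \<in> block x y"
    then show ?thesis using block_bounds[of "(a, b, c)" x y] by auto
  next
    assume "(a - 8, b, c) \<in> row_new xs ys"
    from 1(1)[OF this] show ?thesis by auto
  qed
qed simp_all

lemma row_new_upper:
  "length xs = length ys \<Longrightarrow> (a, 1, c) \<in> row_new xs ys \<longleftrightarrow> (a, 1, c) \<in> row_out ys"
proof (induction xs ys arbitrary: a rule: row_new.induct)
  case (1 x xs y ys)
  then show ?case using block_upper[of a c x y] by (simp add: mem_shift)
qed auto

lemma row_new_lower:
  "length xs = length ys \<Longrightarrow>
    (a, 0, 0) \<in> row_in xs \<union> row_new xs ys \<longleftrightarrow> 1 \<le> a \<and> a \<le> 8 * int (length xs)"
proof (induction xs ys arbitrary: a rule: row_new.induct)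
  case (1 x xs y ys)
  have "(a, 0, 0) \<in> row_in (x # xs) \<union> row_new (x # xs) (y # ys) \<longleftrightarrow>
      (a, 0, 0) \<in> bump x \<union> block x y \<or> (a - 8, 0, 0) \<in> row_in xs \<union> row_new xs ys"
    by (simp add: mem_shift) blast
  moreover have "(a - 8, 0, 0) \<in> row_in xs \<union> row_new xs ys \<longleftrightarrow> 1 \<le> a - 8 \<and> a - 8 \<le> 8 * int (length xs)"
    using 1(1)[of "a - 8"] 1(2) by simp
  ultimately show ?case using block_lower[of a x y] by auto
qed auto

lemma motion_shift:
  assumes "motion \<phi> \<delta>"
  shows "motion (\<lambda>p. \<phi> (shift p)) \<delta>"
  unfolding motion_def
proof
  show "inj (\<lambda>p. \<phi> (shift p))"
    using motion_inj[OF assms] by (simp add: inj_def)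
  have "shift (p + unit_vec d) = shift p + unit_vec d" for p d
    by (simp add: ac_simps)
  then show "\<forall>p d. \<phi> (shift (p + unit_vec d)) = \<phi> (shift p) + unit_vec (\<delta> d)"
    by (simp only: motion_unit_vec[OF assms]) simp
qed

lemma run_row:
  assumes "row A R q xs ys q'" "motion \<phi> \<delta>"
    and PR: "\<And>q. R q \<Longrightarrow> P q = turn \<delta> id (act_prog (A q)) \<and> \<not> E q"
  shows "run P E (\<phi> ` row_in xs, M, \<phi> (0, 0, 0), [], q)
     (\<phi> ` (row_in xs \<union> row_new xs ys), M, \<phi> (8 * int (length xs), 0, 0), [], q')"
  using assms(1,2)
proof (induction arbitrary: \<phi> rule: row.induct)
  case (row_Nil q)
  then show ?case by simp
next
  \<comment> \<open>The first block and the rest are joined by two uses of \<open>run_frame\<close>: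
    the bumps still ahead surround the run through the first block, then the cells of the first
    block surround the run through the rest.\<close>
  have glue: "run P E (\<phi> ` row_in (x # xs), M, \<phi> (0, 0, 0), [], q)
     (\<phi> ` (row_in (x # xs) \<union> row_new (x # xs) (y # ys)), M, \<phi> (8 * int (length (x # xs)), 0, 0), [], q'')"
    if \<phi>: "motion \<phi> \<delta>"
      and first: "run P E (\<phi> ` bump x, M, \<phi> (0, 0, 0), [], q)
        (\<phi> ` (bump x \<union> block x y), M, \<phi> (8, 0, 0), [], q')"
      and IH: "run P E ((\<lambda>p. \<phi> (shift p)) ` row_in xs, M, \<phi> (shift (0, 0, 0)), [], q')
     ((\<lambda>p. \<phi> (shift p)) ` (row_in xs \<union> row_new xs ys), M, \<phi> (shift (8 * int (length xs), 0, 0)), [], q'')"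
    for x y xs ys q q' q'' \<phi>
  proof -
    have dis: "X \<inter> Y = {} \<Longrightarrow> \<phi> ` X \<inter> \<phi> ` Y = {}" for X Y
      using \<phi> by (metis image_Int image_empty motion_def)
    have "shift ` row_in xs \<inter> block x y = {}"
    proof (rule ccontr)
      assume "\<not> ?thesis"
      then obtain a b c where "(a, b, c) \<in> shift ` row_in xs" "(a, b, c) \<in> block x y" by auto
      then show False
        using row_in_bounds[of "a - 8" b c xs] block_bounds[of "(a, b, c)" x y] by (auto simp: mem_shift)
    qed
    then have "\<phi> ` shift ` row_in xs \<inter> (\<phi> ` (bump x \<union> block x y) - \<phi> ` bump x) = {}"
      using dis by blast
    from run_frame[OF first this, of "{}"]
    have 1: "run P E (\<phi> ` row_in (x # xs), M, \<phi> (0, 0, 0), [], q)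
        (\<phi> ` (bump x \<union> block x y) \<union> \<phi> ` shift ` row_in xs, M, \<phi> (8, 0, 0), [], q')"
      by (simp add: image_Un)
    have "(bump x \<union> block x y) \<inter> shift ` row_new xs ys = {}"
    proof (rule ccontr)
      assume "\<not> ?thesis"
      then obtain a b c where "(a, b, c) \<in> shift ` row_new xs ys" "(a, b, c) \<in> bump x \<union> block x y" by auto
      then show False
        using row_new_bounds[of "a - 8" b c xs ys] block_bounds[of "(a, b, c)" x y] bump_bounds[of "(a, b, c)" x]
        by (auto simp: mem_shift)
    qed
    then have "\<phi> ` (bump x \<union> block x y) \<inter> \<phi> ` shift ` row_new xs ys = {}"
      by (rule dis)
    then have "\<phi> ` (bump x \<union> block x y) \<inter>
       ((\<lambda>p. \<phi> (shift p)) ` (row_in xs \<union> row_new xs ys) - (\<lambda>p. \<phi> (shift p)) ` row_in xs) = {}"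
      by (auto simp: image_Un image_image)
    from run_frame[OF IH this, of "{}"]
    have 2: "run P E (\<phi> ` (bump x \<union> block x y) \<union> \<phi> ` shift ` row_in xs, M, \<phi> (8, 0, 0), [], q')
       (\<phi> ` (row_in (x # xs) \<union> row_new (x # xs) (y # ys)), M, \<phi> (8 * int (length (x # xs)), 0, 0), [], q'')"
      by (simp add: image_Un image_image Un_ac algebra_simps)
    show ?thesis using rtranclp_trans[OF 1 2] .
  qed
  {
    case (row_Read q f b y q' xs ys q'')
    have "run P E (\<phi> ` bump (Some b), M, \<phi> (0, 0, 0), [], q)
        (\<phi> ` (bump (Some b) \<union> block (Some b) y), M, \<phi> (8, 0, 0), [], q')"
      by (rule run_block_read[where A = A and f = f and b = b]) (use row_Read PR[OF row_Read(1)] in auto)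
    from glue[OF row_Read.prems this row_Read.IH[OF motion_shift[OF row_Read.prems]]]
    show ?case .
  next
    case (row_Write q y q' xs ys q'')
    have "run P E (\<phi> ` bump None, M, \<phi> (0, 0, 0), [], q)
        (\<phi> ` (bump None \<union> block None y), M, \<phi> (8, 0, 0), [], q')"
      using run_block_write[where A = A and P = P and q = q] row_Write PR[OF row_Write(1)] by simp
    from glue[OF row_Write.prems this row_Write.IH[OF motion_shift[OF row_Write.prems]]]
    show ?case .
  }
qed

lemma row_in_append: "row_in (xs @ ys) = row_in xs \<union> (\<lambda>p. p + (8 * int (length xs), 0, 0)) ` row_in ys"
proof (induction xs)
  case Nil
  then show ?case by (simp add: zero_prod_def[symmetric])
next
  case (Cons x xs)
  then show ?case by (simp add: image_Un image_image Un_assoc add.assoc algebra_simps)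
qed

text \<open>Blank blocks hold no bumps, so a tape may be continued by any number of them. This is
  how a row can become longer than the one before.\<close>

lemma row_in_None [simp]: "row_in (xs @ replicate n None) = row_in xs"
proof -
  have "row_in (replicate n None) = {}" by (induction n) auto
  then show ?thesis by (simp add: row_in_append)
qed

text \<open>Running backwards over a row, the next reader finds the bits in reversed order.\<close>

lemma row_out_mirror:
  "(a, 1, c) \<in> row_out ys \<longleftrightarrow> (8 * int (length ys) - 1 - a, 0, c) \<in> row_in (rev ys)"
proof (induction ys arbitrary: a)
  case (Cons y ys)
  \<comment> \<open>Within a block of eight cells the reversal is \<open>7 - a\<close>. The shapes
    of \<open>write_moves\<close> are chosen for this symmetry; it makes the next row start at
    \<open>8 * length - 1\<close>, one cell before the end of this one.\<close>
  have "(a, 1, c) \<in> bump_out y \<longleftrightarrow> (7 - a, 0, c) \<in> bump y"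
    using option_bool_cases[of y] by (elim disjE) auto
  then show ?case
    using Cons.IH[of "a - 8"]
    by (simp add: mem_shift mem_translate row_in_append algebra_simps disj_commute)
qed simp

section \<open>The counter program\<close>

datatype ctrl = Start | Pre | Init0 | Init1 | Init2 | Pass | Addr nat | AddrF nat
  | QueF "bool list" | QueX "bool list" | FlushX "bool list" | FlushF "bool list"
  | DecF | DecX | CopyF | CopyX | Up bool | Up2 bool
  | Left0 bool | LeftX bool | LeftF bool | Down bool | Last0 | LastX | LastF | End

text \<open>
  A pass of the machine over the tape, from left to right, takes \<open>0\<^sup>j 1 u\<close> for \<open>j < m\<close> to
  \<open>0\<^sup>j\<^sup>+\<^sup>1 1 d u\<close>, where \<open>d\<close> is the digit number \<open>j\<close>: the states \<open>Addr\<close> recover \<open>j\<close>, and the shift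
  is done by a queue of bits kept in the state.  For \<open>j = m\<close> it decrements \<open>u\<close>, the least
  significant bit coming first.  The way back copies the tape.  When \<open>u\<close> was zero, one more pass
  reads the tape without writing, in order to leave no bump above the last row.
\<close>

fun act :: "nat \<Rightarrow> (nat \<Rightarrow> bool list) \<Rightarrow> bool \<Rightarrow> ctrl \<Rightarrow> ctrl action" where
  "act m dig two Start = (if two then Move PosY [] Pre else Move PosY [PosX] Init0)"
| "act m dig two Pre = Move PosY [PosX] Init0"
| "act m dig two Init0 = Write (Some True) Init1"
| "act m dig two Init1 = Write (Some True) Init2"
| "act m dig two Init2 = Write (Some True) (Up False)"
| "act m dig two Pass = Read (\<lambda>_. (Some True, Addr 0))"
| "act m dig two (Addr j) = Read (\<lambda>x.
     if \<not> x then (Some False, AddrF j)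
     else if j = m then (Some True, DecF) else (Some False, QueF (True # dig j)))"
| "act m dig two (AddrF j) = Read (\<lambda>_. (Some False, Addr (if j < m then Suc j else j)))"
| "act m dig two (QueF q) = Read (\<lambda>e. (Some False, if e then FlushX q else QueX q))"
| "act m dig two (QueX q) = Read (\<lambda>x. (Some (hd q), QueF (tl q @ [x])))"
| "act m dig two (FlushX q) = Write (Some (hd q)) (FlushF (tl q))"
| "act m dig two (FlushF q) = Write (Some (q = [])) (if q = [] then Up False else FlushX q)"
| "act m dig two DecF = Read (\<lambda>e. (Some e, if e then Up True else DecX))"
| "act m dig two DecX = Read (\<lambda>x. (Some (\<not> x), if x then CopyF else DecF))"
| "act m dig two CopyF = Read (\<lambda>e. (Some e, if e then Up False else CopyX))"
| "act m dig two CopyX = Read (\<lambda>x. (Some x, CopyF))"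
| "act m dig two (Up b) = Move PosY [] (Up2 b)"
| "act m dig two (Up2 b) = Move NegX [] (Left0 b)"
| "act m dig two (Left0 b) = Read (\<lambda>e. (Some e, LeftX b))"
| "act m dig two (LeftX b) = Read (\<lambda>x. (Some x, LeftF b))"
| "act m dig two (LeftF b) = Read (\<lambda>e. (Some e, if e then Down b else LeftX b))"
| "act m dig two (Down b) = Move PosY [PosX] (if b then Last0 else Pass)"
| "act m dig two Last0 = Read (\<lambda>_. (None, LastX))"
| "act m dig two LastX = Read (\<lambda>_. (None, LastF))"
| "act m dig two LastF = Read (\<lambda>e. (None, if e then End else LastX))"
| "act m dig two End = Stop"

fun leftward :: "ctrl \<Rightarrow> bool" where
  "leftward (Left0 b) = True" | "leftward (LeftX b) = True" | "leftward (LeftF b) = True"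
| "leftward _ = False"

fun mirror :: "dir \<Rightarrow> dir" where
  "mirror PosX = NegX" | "mirror NegX = PosX" | "mirror d = d"

definition prog :: "nat \<Rightarrow> (nat \<Rightarrow> bool list) \<Rightarrow> bool \<Rightarrow> ctrl prog" where
  "prog m dig two q = turn (if leftward q then mirror else id) id (act_prog (act m dig two q))"

text \<open>These states are taken in the rightmost cell of a row: \<open>Start\<close> and
  \<open>Pre\<close> in rows of one cell, \<open>Up\<close> and \<open>Up2\<close> at the right
  turn. The log collects these cells because rays start there in the third strip.\<close>

fun marked :: "ctrl \<Rightarrow> bool" where
  "marked Start = True" | "marked Pre = True" | "marked (Up b) = True" | "marked (Up2 b) = True"
| "marked _ = False"

abbreviation row_right :: "nat \<Rightarrow> (nat \<Rightarrow> bool list) \<Rightarrow> bool \<Rightarrow> ctrl \<Rightarrow> _" where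
  "row_right m dig two \<equiv> row (act m dig two) (\<lambda>q. \<not> leftward q \<and> \<not> marked q)"

abbreviation row_left :: "nat \<Rightarrow> (nat \<Rightarrow> bool list) \<Rightarrow> bool \<Rightarrow> ctrl \<Rightarrow> _" where
  "row_left m dig two \<equiv> row (act m dig two) leftward"

text \<open>
  A tape with symbols \<open>x\<^sub>1, \<dots>, x\<^sub>n\<close> is laid out as \<open>f\<^sub>0, x\<^sub>1, f\<^sub>1, \<dots>, x\<^sub>n, f\<^sub>n\<close>, where the flag
  \<open>f\<^sub>i\<close> is set at both ends only, so that both ends are recognised from either side.
\<close>

fun flagged :: "bool list \<Rightarrow> bool list" where
  "flagged [] = [True]"
| "flagged (x # xs) = False # x # flagged xs"

definition tape :: "bool list \<Rightarrow> bool list" where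
  "tape xs = True # tl (flagged xs)"

lemma length_flagged [simp]: "length (flagged xs) = 2 * length xs + 1"
  by (induction xs) auto

lemma length_tape [simp]: "length (tape xs) = 2 * length xs + 1"
  by (simp add: tape_def)

lemma tape_rev:
  assumes "xs \<noteq> []"
  shows "rev (tape xs) = tape (rev xs)"
proof -
  define core :: "bool list \<Rightarrow> bool list" where "core = (\<lambda>xs. concat (map (\<lambda>x. [False, x]) xs))"
  have flagged: "flagged xs = core xs @ [True]" for xs
    by (induction xs) (auto simp: core_def)
  have "False # rev (core xs) = core (rev xs) @ [False]" for xs
    by (induction xs) (auto simp: core_def)
  moreover obtain u where "core xs = False # u"
    using assms by (cases xs) (auto simp: core_def)
  ultimately have "core (rev xs) = False # rev u" "core xs = False # u"
    by (metis append_Cons append_same_eq rev.simps(2))+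
  then show ?thesis by (simp add: tape_def flagged)
qed

section \<open>The effect of one row on the tape\<close>

lemma row_flush:
  "row_right m dig two (FlushF q) (replicate (2 * length q + 1) None) (map Some (flagged q)) (Up False)"
  by (induction q) (simp_all add: row_simps)

text \<open>The queue delays the tape by \<open>length q\<close> symbols. At the end mark this many
  symbols are left over, and they are flushed into blank blocks, a symbol and a flag each.\<close>

lemma row_queue:
  "q \<noteq> [] \<Longrightarrow> row_right m dig two (QueF q) (map Some (flagged u) @ replicate (2 * length q) None)
     (map Some (flagged (q @ u))) (Up False)"
proof (induction u arbitrary: q)
  case Nil
  then obtain a q' where "q = a # q'" by (cases q) auto
  then show ?case using row_flush[of m dig two q'] by (simp add: row_simps)
next
  case (Cons x u)
  then obtain a q' where "q = a # q'" by (cases q) auto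
  then show ?case using Cons.IH[of "q' @ [x]"] by (simp add: row_simps)
qed

fun dec :: "bool list \<Rightarrow> bool list" where
  "dec [] = []"
| "dec (True # v) = False # v"
| "dec (False # v) = True # dec v"

fun val :: "bool list \<Rightarrow> nat" where
  "val [] = 0"
| "val (x # v) = of_bool x + 2 * val v"

lemma length_dec [simp]: "length (dec v) = length v"
  by (induction v rule: dec.induct) auto

lemma val_pos_iff: "val v > 0 \<longleftrightarrow> True \<in> set v"
  by (induction v) auto

lemma val_dec: "True \<in> set v \<Longrightarrow> val (dec v) = val v - 1"
proof (induction v rule: dec.induct)
  case (3 v)
  then have "val v > 0" by (simp add: val_pos_iff)
  then show ?case using 3 by simp
qed auto

lemma ex_val: "u < 2 ^ n \<Longrightarrow> \<exists>v. length v = n \<and> val v = u"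
proof (induction n arbitrary: u)
  case (Suc n)
  then obtain v where v: "length v = n" "val v = u div 2" by (metis less_mult_imp_div_less power_Suc2)
  have "of_bool (odd u) + 2 * (u div 2) = u" by (auto elim!: oddE evenE)
  then show ?case using v by (intro exI[of _ "odd u # v"]) simp
qed simp

lemma row_copy:
  "row_right m dig two CopyF (map Some (flagged v)) (map Some (flagged v)) (Up False)"
  by (induction v) (simp_all add: row_simps)

text \<open>The end flag is met while still borrowing exactly if no bit is set. So the test for zero
  is part of the decrement, which leaves all ones in that case.\<close>

lemma row_dec:
  "row_right m dig two DecF (map Some (flagged v)) (map Some (flagged (dec v))) (Up (True \<notin> set v))"
  by (induction v rule: dec.induct) (use row_copy[of m dig two] in \<open>simp_all add: row_simps\<close>)

text \<open>Nonempty rests mean that the flag behind the skipped zero is no end mark, neither where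
  it is read nor where it is written.\<close>

lemma row_addr_skip:
  assumes "u \<noteq> []" "i < m" "u' \<noteq> []"
    and "row_right m dig two (Addr (Suc i)) (map Some (tl (flagged u)) @ xs) (map Some (tl (flagged u'))) q"
  shows "row_right m dig two (Addr i) (map Some (tl (flagged (False # u))) @ xs)
    (map Some (tl (flagged (False # u')))) q"
  using assms by (cases u; cases u') (simp_all add: row_simps)

lemma row_addr_unpack:
  "i + r < m \<Longrightarrow> row_right m dig two (Addr i)
     (map Some (tl (flagged (replicate r False @ True # u))) @ replicate (2 * (1 + length (dig (i + r)))) None)
     (map Some (tl (flagged (replicate r False @ False # True # dig (i + r) @ u)))) (Up False)"
proof (induction r arbitrary: i)
  case 0
  then show ?case using row_queue[of "True # dig i" m dig two u] by (simp add: row_simps)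
next
  case (Suc r)
  then show ?case
    using row_addr_skip[of "replicate r False @ True # u" i m
        "replicate r False @ False # True # dig (i + Suc r) @ u" dig two] Suc.IH[of "Suc i"] by simp
qed

lemma row_addr_dec:
  "i + r = m \<Longrightarrow> row_right m dig two (Addr i)
     (map Some (tl (flagged (replicate r False @ True # u))))
     (map Some (tl (flagged (replicate r False @ True # dec u)))) (Up (True \<notin> set u))"
proof (induction r arbitrary: i)
  case 0
  then show ?case using row_dec[of m dig two u] by (simp add: row_simps)
next
  case (Suc r)
  then show ?case
    using row_addr_skip[of "replicate r False @ True # u" i m
        "replicate r False @ True # dec u" dig two "[]"] Suc.IH[of "Suc i"] by simp
qed

text \<open>The old mark is overwritten by a zero and reappears at the head of the queue, in front
  of the digit. So the pass that inserts digit \<open>j\<close> also advances the unary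
  counter.\<close>

lemma row_unpack:
  assumes "j < m"
  shows "row_right m dig two Pass
     (map Some (tape (replicate j False @ True # u)) @ replicate (2 * (1 + length (dig j))) None)
     (map Some (tape (replicate (Suc j) False @ True # dig j @ u))) (Up False)"
proof -
  have *: "replicate (Suc j) False @ w = replicate j False @ False # w" for w
    by (simp add: replicate_app_Cons_same)
  show ?thesis
    unfolding * using row_addr_unpack[of 0 j m dig two u] assms by (simp add: tape_def row_simps)
qed

lemma row_count:
  "row_right m dig two Pass (map Some (tape (replicate m False @ True # u)))
     (map Some (tape (replicate m False @ True # dec u))) (Up (True \<notin> set u))"
  using row_addr_dec[of 0 m m dig two u] by (simp add: tape_def row_simps)

lemma row_leftward:
  assumes "u \<noteq> []"
  shows "row_left m dig two (Left0 b) (map Some (rev (tape u))) (map Some (rev (tape u))) (Down b)"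
proof -
  have "row_left m dig two (LeftF b) (map Some (flagged v)) (map Some (flagged v)) (Down b)" for v
    by (induction v) (simp_all add: row_simps)
  moreover obtain x v where "rev u = x # v" using assms by (cases "rev u") auto
  ultimately show ?thesis unfolding tape_rev[OF assms] by (simp add: tape_def row_simps)
qed

lemma row_last:
  assumes "u \<noteq> []"
  shows "row_right m dig two Last0 (map Some (tape u)) (replicate (length (tape u)) None) End"
proof -
  have "row_right m dig two LastF (map Some (flagged v)) (replicate (length (flagged v)) None) End" for v
    by (induction v) (simp_all add: row_simps)
  moreover obtain x v where "u = x # v" using assms by (cases u) auto
  ultimately show ?thesis by (simp add: tape_def row_simps)
qed

section \<open>Strips of prescribed height\<close>

lemma motion_translate: "motion (\<lambda>p. p + v) id"
  unfolding motion_def by (auto simp: ac_simps inj_def)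

definition mirror_at :: "int \<Rightarrow> int \<Rightarrow> pos \<Rightarrow> pos" where
  "mirror_at k y = (\<lambda>(a, b, c). (k - a, y + b, c))"

lemma motion_mirror_at: "motion (mirror_at k y) mirror"
proof -
  have "mirror_at k y (p + unit_vec d) = mirror_at k y p + unit_vec (mirror d)" for p d
    by (cases p; cases d) (simp_all add: mirror_at_def)
  moreover have "inj (mirror_at k y)" by (auto simp: inj_def mirror_at_def)
  ultimately show ?thesis unfolding motion_def by blast
qed

lemma mem_mirror_at: "(a, b, c) \<in> mirror_at k y ` X \<longleftrightarrow> (k - a, b - y, c) \<in> X"
proof
  assume "(k - a, b - y, c) \<in> X"
  then show "(a, b, c) \<in> mirror_at k y ` X" by (rule rev_image_eqI) (simp add: mirror_at_def)
next
  assume "(a, b, c) \<in> mirror_at k y ` X"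
  then obtain p where "p \<in> X" "(a, b, c) = mirror_at k y p" by blast
  then show "(k - a, b - y, c) \<in> X" by (cases p) (simp add: mirror_at_def)
qed

lemma row_out_bounds:
  "(a, b, c) \<in> row_out ys \<Longrightarrow> 5 \<le> a \<and> a \<le> 8 * int (length ys) - 1 \<and> (c = 0 \<longrightarrow> a \<le> 8 * int (length ys) - 2)"
proof (induction ys arbitrary: a)
  case (Cons y ys)
  from Cons.prems have "(a, b, c) \<in> bump_out y \<or> (a - 8, b, c) \<in> row_out ys"
    by (simp add: mem_shift)
  then show ?case
  proof
    assume "(a, b, c) \<in> bump_out y"
    then show ?thesis using option_bool_cases[of y] by (elim disjE) auto
  next
    assume "(a - 8, b, c) \<in> row_out ys"
    from Cons.IH[OF this] show ?thesis by auto
  qed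
qed simp

lemma row_out_None [simp]: "row_out (replicate n None) = {}"
  by (induction n) auto

lemma run_row_in:
  assumes row: "row A R q xs ys q'" and \<phi>: "motion \<phi> \<delta>"
    and PR: "\<And>q. R q \<Longrightarrow> P q = turn \<delta> id (act_prog (A q)) \<and> \<not> E q"
    and U: "\<phi> ` row_in xs \<subseteq> U" "\<And>p. p \<in> row_new xs ys \<Longrightarrow> \<phi> p \<in> U \<Longrightarrow> p \<in> row_in xs"
  shows "run P E (U, M, \<phi> (0, 0, 0), [], q)
     (U \<union> \<phi> ` row_new xs ys, M, \<phi> (8 * int (length xs), 0, 0), [], q')"
proof -
  let ?X = "U - \<phi> ` row_in xs"
  have "?X \<inter> (\<phi> ` (row_in xs \<union> row_new xs ys) - \<phi> ` row_in xs) = {}"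
    using U(2) by blast
  from run_frame[OF run_row[where A = A and R = R, OF row \<phi> PR] this, of "{}"]
  have "run P E (\<phi> ` row_in xs \<union> ?X, M, \<phi> (0, 0, 0), [], q)
     (\<phi> ` (row_in xs \<union> row_new xs ys) \<union> ?X, M, \<phi> (8 * int (length xs), 0, 0), [], q')"
    by simp
  moreover have "\<phi> ` row_in xs \<union> ?X = U" "\<phi> ` (row_in xs \<union> row_new xs ys) \<union> ?X = U \<union> \<phi> ` row_new xs ys"
    using U(1) by blast+
  ultimately show ?thesis by simp
qed

lemma run_move:
  assumes "P q = [(d, ds, q')]" "distinct (trace p (d # ds))" "set (trace p (d # ds)) \<inter> U = {}"
  shows "run P E (U, M, p, [], q)
    (U \<union> set (trace p (d # ds)), if E q then insert (p, q) M else M, end_pos p (d # ds), [], q')"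
  using assms by (intro run_branch) auto

lemma prog_right: "\<not> leftward q \<and> \<not> marked q \<Longrightarrow>
    prog m dig two q = turn id id (act_prog (act m dig two q)) \<and> \<not> marked q"
  by (simp add: prog_def)

lemma prog_left: "leftward q \<Longrightarrow>
    prog m dig two q = turn mirror id (act_prog (act m dig two q)) \<and> \<not> marked q"
  by (cases q) (simp_all add: prog_def)

text \<open>
  The rows up to \<open>Y\<close> are complete, the last one having written \<open>zs\<close>.  In the plane \<open>z = 0\<close> row \<open>y\<close>
  is the interval from \<open>0\<close> to \<open>X y\<close>, and its last cell is in the log if \<open>y < Y\<close>.
\<close>

definition strip :: "pos set \<Rightarrow> (pos \<times> ctrl) set \<Rightarrow> (int \<Rightarrow> int) \<Rightarrow> int \<Rightarrow> bool option list \<Rightarrow> bool" where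
  "strip U M X Y zs \<longleftrightarrow> 0 < Y \<and> X Y = 8 * int (length zs) + 1 \<and>
     (\<forall>b. 0 \<le> b \<and> b \<le> Y \<longrightarrow> 0 \<le> X b \<and> X b \<le> X Y) \<and>
     (\<forall>a b c. (a, b, c) \<in> U \<longrightarrow> 0 \<le> a \<and> a \<le> X Y \<and> 0 \<le> b \<and> b \<le> Y + 1 \<and> (c = 0 \<or> c = 1)) \<and>
     (\<forall>a b. 0 \<le> b \<and> b \<le> Y \<longrightarrow> ((a, b, 0) \<in> U \<longleftrightarrow> 0 \<le> a \<and> a \<le> X b)) \<and>
     (\<forall>a c. (a, Y + 1, c) \<in> U \<longleftrightarrow> (a - 1, 1, c) \<in> row_out zs) \<and>
     (\<forall>p q. (p, q) \<in> M \<longrightarrow> (\<exists>b. 0 \<le> b \<and> b < Y \<and> p = (X b, b, 0) \<and> (q = Start \<longleftrightarrow> b = 0))) \<and>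
     (\<forall>b. 0 \<le> b \<and> b < Y \<longrightarrow> (\<exists>q. ((X b, b, 0), q) \<in> M))"

lemma stripD:
  assumes "strip U M X Y zs"
  shows "0 < Y" "X Y = 8 * int (length zs) + 1"
    "0 \<le> b \<Longrightarrow> b \<le> Y \<Longrightarrow> 0 \<le> X b \<and> X b \<le> X Y"
    "(a, b, c) \<in> U \<Longrightarrow> 0 \<le> a \<and> a \<le> X Y \<and> 0 \<le> b \<and> b \<le> Y + 1 \<and> (c = 0 \<or> c = 1)"
    "0 \<le> b \<Longrightarrow> b \<le> Y \<Longrightarrow> (a, b, 0) \<in> U \<longleftrightarrow> 0 \<le> a \<and> a \<le> X b"
    "(a, Y + 1, c) \<in> U \<longleftrightarrow> (a - 1, 1, c) \<in> row_out zs"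
    "(p, q) \<in> M \<Longrightarrow> \<exists>b. 0 \<le> b \<and> b < Y \<and> p = (X b, b, 0) \<and> (q = Start \<longleftrightarrow> b = 0)"
    "0 \<le> b \<Longrightarrow> b < Y \<Longrightarrow> \<exists>q. ((X b, b, 0), q) \<in> M"
  using assms unfolding strip_def by blast+

text \<open>Rightward rows start at \<open>x = 1\<close>; leftward rows start at
  \<open>x = n\<close>, with \<open>n\<close> eight times the length of the tape, and end at
  \<open>x = 0\<close>. These offsets, supplied by the cells of the turns, align each reader with
  the bumps of the row below. The \<open>e\<close> blank blocks leave room for a longer
  tape.\<close>

lemma strip_pair:
  assumes S: "strip U M X Y (map Some ws)"
    and L: "row_left m dig two (Left0 b) (map Some (rev ws)) (map Some (rev ws)) (Down b)"
    and R: "row_right m dig two (if b then Last0 else Pass) (map Some ws @ replicate e None) zs q1"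
  shows "\<exists>U' M'. run (prog m dig two) marked (U, M, (X Y, Y, 0), [], Up b)
       (U', M', (8 * int (length zs) + 1, Y + 2, 0), [], q1) \<and>
     strip U' M' (X(Y + 1 := X Y, Y + 2 := 8 * int (length zs) + 1)) (Y + 2) zs"
proof -
  let ?P = "prog m dig two" and ?E = marked
  define n where "n = 8 * int (length ws)"
  define rs where "rs = map Some (rev ws)"
  define xs where "xs = map Some ws @ replicate e (None :: bool option)"
  have XY: "X Y = n + 1" using stripD(2)[OF S] by (simp add: n_def)
  have Y: "0 < Y" using stripD(1)[OF S] .
  have n0: "0 \<le> n" by (simp add: n_def)
  have len_rs: "8 * int (length rs) = n" by (simp add: rs_def n_def)
  have len_zs: "length zs = length xs" using row_length[OF R] by (simp add: xs_def)
  have n_zs: "n \<le> 8 * int (length zs)" unfolding len_zs by (simp add: xs_def n_def)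
  \<comment> \<open>Above the last complete row only the bumps just written are occupied; seen from
    the right, they are the input of the leftward row.\<close>
  have U1: "(a, Y + 1, c) \<in> U \<longleftrightarrow> (n - a, 0, c) \<in> row_in rs" for a c
    using stripD(6)[OF S, of a c] row_out_mirror[of "a - 1" c "map Some ws"]
    by (simp add: rs_def n_def rev_map)
  have U2: "(a, b, c) \<notin> U" if "b > Y + 1" for a b c
    using stripD(4)[OF S, of a b c] that by auto
  have free1: "(n + 1, Y + 1, 0) \<notin> U" "(n, Y + 1, 0) \<notin> U"
    unfolding U1 using row_in_bounds[of "-1" 0 0 rs] row_in_bounds[of 0 0 0 rs] by auto
  define M2 where "M2 = insert ((n + 1, Y + 1, 0), Up2 b) (insert ((X Y, Y, 0), Up b) M)"
  define V where "V = U \<union> {(n + 1, Y + 1, 0), (n, Y + 1, 0)}"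
  have "run ?P ?E (U, M, (X Y, Y, 0), [], Up b)
     (U \<union> {(n + 1, Y + 1, 0)}, insert ((X Y, Y, 0), Up b) M, (n + 1, Y + 1, 0), [], Up2 b)"
    using run_move[of ?P "Up b" PosY "[]" "Up2 b" "(X Y, Y, 0)" U ?E M] free1
    by (simp add: prog_def turn_def XY)
  also have "run ?P ?E \<dots> (V, M2, (n, Y + 1, 0), [], Left0 b)"
    using run_move[of ?P "Up2 b" NegX "[]" "Left0 b" "(n + 1, Y + 1, 0)" "U \<union> {(n + 1, Y + 1, 0)}" ?E
        "insert ((X Y, Y, 0), Up b) M"] free1
    by (simp add: prog_def turn_def V_def M2_def insert_commute)
  finally have run1: "run ?P ?E (U, M, (X Y, Y, 0), [], Up b) (V, M2, (n, Y + 1, 0), [], Left0 b)" .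
  let ?l = "mirror_at n (Y + 1)"
  have "run ?P ?E (V, M2, ?l (0, 0, 0), [], Left0 b)
      (V \<union> ?l ` row_new rs rs, M2, ?l (8 * int (length rs), 0, 0), [], Down b)"
  proof (rule run_row_in[where A = "act m dig two" and R = leftward and \<delta> = mirror])
    show "row_left m dig two (Left0 b) rs rs (Down b)" using L by (simp add: rs_def)
    show "?l ` row_in rs \<subseteq> V"
    proof
      fix p assume p: "p \<in> ?l ` row_in rs"
      obtain a b' c where abc: "p = (a, b', c)" by (cases p)
      have m: "(n - a, b' - (Y + 1), c) \<in> row_in rs" using p by (simp add: abc mem_mirror_at)
      then have "b' = Y + 1" using row_in_bounds[OF m] by simp
      then show "p \<in> V" using m U1 by (simp add: abc V_def)
    qed
    fix p assume p: "p \<in> row_new rs rs" "?l p \<in> V"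
    obtain a b' c where abc: "p = (a, b', c)" by (cases p)
    have bd: "0 \<le> a" "a \<le> n" "b' = 0 \<or> b' = 1" "a = 0 \<longrightarrow> c = 1"
      using row_new_bounds[of a b' c rs rs] p(1) len_rs by (auto simp: abc)
    have pV: "(n - a, Y + 1 + b', c) \<in> V" using p(2) by (simp add: abc mirror_at_def)
    have "(n - a, Y + 1 + b', c) \<noteq> (n + 1, Y + 1, 0)" using bd(1) by simp
    moreover have "(n - a, Y + 1 + b', c) \<noteq> (n, Y + 1, 0)" using bd(4) by (cases "a = 0") simp_all
    ultimately have "(n - a, Y + 1 + b', c) \<in> U" using pV unfolding V_def by blast
    then show "p \<in> row_in rs"
      using U1[of "n - a" c] U2[of "Y + 1 + b'" "n - a" c] bd(3) by (auto simp: abc)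
  qed (simp_all add: prog_left motion_mirror_at)
  then have run2: "run ?P ?E (V, M2, (n, Y + 1, 0), [], Left0 b)
      (V \<union> ?l ` row_new rs rs, M2, (0, Y + 1, 0), [], Down b)"
    by (simp add: mirror_at_def len_rs)
  define W where "W = V \<union> ?l ` row_new rs rs"
  have memW: "(a, b', c) \<in> W \<longleftrightarrow> (a, b', c) \<in> U \<or> (a, b', c) = (n + 1, Y + 1, 0) \<or> (a, b', c) = (n, Y + 1, 0)
      \<or> (n - a, b' - (Y + 1), c) \<in> row_new rs rs" for a b' c
    by (auto simp: W_def V_def mem_mirror_at)
  \<comment> \<open>Mirrored twice, the bumps have the orientation of a rightward reader
    again.\<close>
  have W2: "(a, Y + 2, c) \<in> W \<longleftrightarrow> (a - 1, 0, c) \<in> row_in xs" for a c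
  proof -
    have "(a, Y + 2, c) \<in> W \<longleftrightarrow> (n - a, 1, c) \<in> row_out rs"
      using U2[of "Y + 2"] row_new_upper[of rs rs "n - a" c] by (simp add: memW)
    also have "\<dots> \<longleftrightarrow> (a - 1, 0, c) \<in> row_in (rev rs)"
      using row_out_mirror[of "n - a" c rs] len_rs by (simp add: algebra_simps)
    finally show ?thesis by (simp add: xs_def rs_def rev_map)
  qed
  have W3: "(a, b', c) \<notin> W" if "b' > Y + 2" for a b' c
    using U2[of b' a c] row_new_bounds[of "n - a" "b' - (Y + 1)" c rs rs] that by (auto simp: memW)
  define q0 where "q0 = (if b then Last0 else Pass)"
  have free2: "(0, Y + 2, 0) \<notin> W" "(1, Y + 2, 0) \<notin> W"
    unfolding W2 using row_in_bounds[of "-1" 0 0 xs] row_in_bounds[of 0 0 0 xs] by auto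
  define T where "T = W \<union> {(0, Y + 2, 0), (1, Y + 2, 0)}"
  have run3: "run ?P ?E (W, M2, (0, Y + 1, 0), [], Down b) (T, M2, (1, Y + 2, 0), [], q0)"
  proof -
    have "?P (Down b) = [(PosY, [PosX], q0)]" by (simp add: prog_def turn_def q0_def)
    from run_move[of ?P "Down b", OF this, of "(0, Y + 1, 0)" W ?E M2] show ?thesis
      using free2 by (simp add: T_def insert_commute add.commute[of 2])
  qed
  let ?r = "\<lambda>p. p + (1, Y + 2, 0)"
  have "run ?P ?E (T, M2, ?r (0, 0, 0), [], q0)
      (T \<union> ?r ` row_new xs zs, M2, ?r (8 * int (length xs), 0, 0), [], q1)"
  proof (rule run_row_in[where A = "act m dig two" and R = "\<lambda>q. \<not> leftward q \<and> \<not> marked q" and \<delta> = id])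
    show "row_right m dig two q0 xs zs q1" using R by (simp add: xs_def q0_def)
    show "?r ` row_in xs \<subseteq> T"
    proof
      fix p assume p: "p \<in> ?r ` row_in xs"
      obtain a b' c where abc: "p = (a, b', c)" by (cases p)
      have m: "(a - 1, b' - (Y + 2), c) \<in> row_in xs"
        using p unfolding abc mem_translate by simp
      then have "b' = Y + 2" using row_in_bounds[OF m] by simp
      then show "p \<in> T" using m W2 by (simp add: abc T_def)
    qed
    fix p assume p: "p \<in> row_new xs zs" "?r p \<in> T"
    obtain a b' c where abc: "p = (a, b', c)" by (cases p)
    have bd: "0 \<le> a" "b' = 0 \<or> b' = 1" "a = 0 \<longrightarrow> c = 1"
      using row_new_bounds[of a b' c xs zs] p(1) by (auto simp: abc)
    have pT: "(a + 1, Y + 2 + b', c) \<in> T" using p(2) by (simp add: abc algebra_simps)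
    have "(a + 1, Y + 2 + b', c) \<noteq> (0, Y + 2, 0)" using bd(1) by simp
    moreover have "(a + 1, Y + 2 + b', c) \<noteq> (1, Y + 2, 0)" using bd(3) by (cases "a = 0") simp_all
    ultimately have "(a + 1, Y + 2 + b', c) \<in> W" using pT unfolding T_def by blast
    then show "p \<in> row_in xs"
      using W2[of "a + 1" c] W3[of "Y + 2 + b'" "a + 1" c] bd(2) by (auto simp: abc)
  qed (simp_all add: prog_right motion_translate)
  then have run4: "run ?P ?E (T, M2, (1, Y + 2, 0), [], q0)
      (T \<union> ?r ` row_new xs zs, M2, (8 * int (length zs) + 1, Y + 2, 0), [], q1)"
    by (simp add: len_zs)
  define U' where "U' = T \<union> ?r ` row_new xs zs"
  have memU': "(a, b', c) \<in> U' \<longleftrightarrow> (a, b', c) \<in> W \<or> (a, b', c) = (0, Y + 2, 0) \<or> (a, b', c) = (1, Y + 2, 0)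
      \<or> (a - 1, b' - (Y + 2), c) \<in> row_new xs zs" for a b' c
    unfolding U'_def T_def Un_iff mem_translate by auto
  have run: "run ?P ?E (U, M, (X Y, Y, 0), [], Up b) (U', M2, (8 * int (length zs) + 1, Y + 2, 0), [], q1)"
    using run1 run2 run3 run4 unfolding W_def[symmetric] U'_def[symmetric] by (meson rtranclp_trans)
  let ?X = "X(Y + 1 := X Y, Y + 2 := 8 * int (length zs) + 1)"
  have new_r: "(u, v, c) \<in> row_new xs zs \<Longrightarrow> 0 \<le> u \<and> u \<le> 8 * int (length zs) \<and> (v = 0 \<or> v = 1) \<and> (c = 0 \<or> c = 1)"
    for u v c using row_new_bounds[of u v c xs zs] len_zs by simp
  have new_l: "(u, v, c) \<in> row_new rs rs \<Longrightarrow> 0 \<le> u \<and> u \<le> n \<and> (v = 0 \<or> v = 1) \<and> (c = 0 \<or> c = 1)"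
    for u v c using row_new_bounds[of u v c rs rs] len_rs by simp
  have 1: "0 \<le> ?X b' \<and> ?X b' \<le> ?X (Y + 2)" if "0 \<le> b'" "b' \<le> Y + 2" for b'
  proof -
    have "b' \<le> Y \<or> b' = Y + 1 \<or> b' = Y + 2" using that by linarith
    then show ?thesis using stripD(3)[OF S, of b'] that XY n0 n_zs by (elim disjE) auto
  qed
  have 2: "0 \<le> a \<and> a \<le> ?X (Y + 2) \<and> 0 \<le> b' \<and> b' \<le> Y + 2 + 1 \<and> (c = 0 \<or> c = 1)"
    if mem: "(a, b', c) \<in> U'" for a b' c
    using mem unfolding memU' memW
    using stripD(4)[OF S, of a b' c] new_r[of "a - 1" "b' - (Y + 2)" c] new_l[of "n - a" "b' - (Y + 1)" c]
      XY Y n0 n_zs by auto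
  have 3: "(a, b', 0) \<in> U' \<longleftrightarrow> 0 \<le> a \<and> a \<le> ?X b'" if b': "0 \<le> b'" "b' \<le> Y + 2" for a b'
  proof -
    have "b' \<le> Y \<or> b' = Y + 1 \<or> b' = Y + 2" using b' by linarith
    then show ?thesis
    proof (elim disjE)
      assume "b' \<le> Y"
      then show ?thesis
        using stripD(5)[OF S, of b' a] b'(1) new_r[of "a - 1" "b' - (Y + 2)" 0] new_l[of "n - a" "b' - (Y + 1)" 0]
        by (auto simp: memU' memW)
    next
      assume b: "b' = Y + 1"
      have "(a, b', 0) \<in> U' \<longleftrightarrow> (a, Y + 1, 0) \<in> U \<or> a = n + 1 \<or> a = n \<or> (n - a, 0, 0) \<in> row_new rs rs"
        using new_r[of "a - 1" "-1" 0] by (auto simp: memU' memW b)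
      also have "\<dots> \<longleftrightarrow> a = n + 1 \<or> a = n \<or> (1 \<le> n - a \<and> n - a \<le> n)"
        using U1[of a 0] row_new_lower[of rs rs "n - a"] len_rs by auto
      also have "\<dots> \<longleftrightarrow> 0 \<le> a \<and> a \<le> ?X b'" using n0 by (auto simp: b XY)
      finally show ?thesis .
    next
      assume b: "b' = Y + 2"
      have "(a, b', 0) \<in> U' \<longleftrightarrow> (a, Y + 2, 0) \<in> W \<or> a = 0 \<or> a = 1 \<or> (a - 1, 0, 0) \<in> row_new xs zs"
        by (auto simp: memU' b)
      also have "\<dots> \<longleftrightarrow> a = 0 \<or> a = 1 \<or> (1 \<le> a - 1 \<and> a - 1 \<le> 8 * int (length zs))"
        using W2[of a 0] row_new_lower[of xs zs "a - 1"] len_zs by auto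
      also have "\<dots> \<longleftrightarrow> 0 \<le> a \<and> a \<le> ?X b'" by (auto simp: b)
      finally show ?thesis .
    qed
  qed
  have 4: "(a, Y + 2 + 1, c) \<in> U' \<longleftrightarrow> (a - 1, 1, c) \<in> row_out zs" for a c
    using W3[of "Y + 2 + 1" a c] row_new_upper[of xs zs "a - 1" c] len_zs by (auto simp: memU')
  have 5: "\<exists>b'. 0 \<le> b' \<and> b' < Y + 2 \<and> p = (?X b', b', 0) \<and> (q = Start \<longleftrightarrow> b' = 0)"
    if mem: "(p, q) \<in> M2" for p q
  proof -
    consider "(p, q) \<in> M" | "p = (X Y, Y, 0)" "q = Up b" | "p = (n + 1, Y + 1, 0)" "q = Up2 b"
      using mem by (auto simp: M2_def)
    then show ?thesis
    proof cases
      case 1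
      then obtain b' where "0 \<le> b'" "b' < Y" "p = (X b', b', 0)" "q = Start \<longleftrightarrow> b' = 0"
        using stripD(7)[OF S] by blast
      then show ?thesis by (intro exI[of _ b']) auto
    next
      case 2
      then show ?thesis using Y by (intro exI[of _ Y]) auto
    next
      case 3
      then show ?thesis using Y XY by (intro exI[of _ "Y + 1"]) auto
    qed
  qed
  have 6: "\<exists>q. ((?X b', b', 0), q) \<in> M2" if b0: "0 \<le> b'" and b1: "b' < Y + 2" for b'
  proof -
    have "b' < Y \<or> b' = Y \<or> b' = Y + 1" using b1 by linarith
    then show ?thesis
    proof (elim disjE)
      assume "b' < Y"
      then obtain q where "((X b', b', 0), q) \<in> M" using stripD(8)[OF S b0] by blast
      then show ?thesis using \<open>b' < Y\<close> by (intro exI[of _ q]) (simp add: M2_def)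
    next
      assume "b' = Y"
      then show ?thesis by (intro exI[of _ "Up b"]) (simp add: M2_def)
    next
      assume "b' = Y + 1"
      then show ?thesis using XY by (intro exI[of _ "Up2 b"]) (simp add: M2_def)
    qed
  qed
  have "strip U' M2 ?X (Y + 2) zs"
    unfolding strip_def using Y 1 2 3 4 5 6 by (intro conjI allI impI) (simp_all | blast)+
  then show ?thesis using run by blast
qed


text \<open>The rows below \<open>Y\<close> are single cells in column 0. Row \<open>Y\<close>
  writes the tape \<open>[True]\<close>, which is a mark with no zeros before it and an empty number
  behind it. It takes three blocks, hence the right end \<open>25 = 3 * 8 + 1\<close>.\<close>

lemma strip_init:
  assumes Y: "0 < Y" and M: "\<And>p q. (p, q) \<in> M \<longleftrightarrow> (q = Start \<and> p = (0, 0, 0)) \<or> (q = Pre \<and> (\<exists>b. 0 < b \<and> b < Y \<and> p = (0, b, 0)))"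
    and U: "U = insert (1, Y, 0) ((\<lambda>b. (0, b, 0)) ` {0..Y})"
  shows "\<exists>U'. run (prog m dig two) marked (U, M, (1, Y, 0), [], Init0) (U', M, (25, Y, 0), [], Up False) \<and>
     strip U' M ((\<lambda>_. 0)(Y := 25)) Y (map Some (tape [True]))"
proof -
  let ?r = "\<lambda>p. p + (1, Y, 0)"
  define xs where "xs = [None, None, None :: bool option]"
  define ys where "ys = map Some (tape [True])"
  have len: "length xs = 3" "length ys = 3" by (simp_all add: xs_def ys_def tape_def)
  have bd: "(a, b, c) \<in> row_new xs ys \<Longrightarrow>
      0 \<le> a \<and> a \<le> 24 \<and> (b = 0 \<or> b = 1) \<and> (c = 0 \<or> c = 1) \<and> (a = 0 \<longrightarrow> c = 1)" for a b c
    using row_new_bounds[of a b c xs ys] len by simp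
  define U' where "U' = U \<union> ?r ` row_new xs ys"
  have "run (prog m dig two) marked (U, M, ?r (0, 0, 0), [], Init0)
     (U', M, ?r (8 * int (length xs), 0, 0), [], Up False)"
    unfolding U'_def
  proof (rule run_row_in[where A = "act m dig two" and R = "\<lambda>q. \<not> leftward q \<and> \<not> marked q" and \<delta> = id])
    show "row_right m dig two Init0 xs ys (Up False)" by (simp add: row_simps xs_def ys_def tape_def)
    fix p assume p: "p \<in> row_new xs ys" "?r p \<in> U"
    obtain a b c where abc: "p = (a, b, c)" by (cases p)
    have "(a + 1, b + Y, c) \<in> U" using p(2) by (simp add: abc)
    then have "a + 1 = 1 \<and> c = 0 \<or> a + 1 = 0" unfolding U by auto
    then show "p \<in> row_in xs" using bd[of a b c] p(1) by (auto simp: abc)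
  qed (simp_all add: prog_right motion_translate xs_def)
  then have run: "run (prog m dig two) marked (U, M, (1, Y, 0), [], Init0) (U', M, (25, Y, 0), [], Up False)"
    by (simp add: len)
  have mem: "(a, b, c) \<in> U' \<longleftrightarrow> (a, b, c) = (1, Y, 0) \<or> (a = 0 \<and> 0 \<le> b \<and> b \<le> Y \<and> c = 0)
      \<or> (a - 1, b - Y, c) \<in> row_new xs ys" for a b c
    unfolding U'_def Un_iff mem_translate U by auto
  let ?X = "(\<lambda>_. 0)(Y := 25) :: int \<Rightarrow> int"
  have 1: "0 \<le> a \<and> a \<le> 25 \<and> 0 \<le> b \<and> b \<le> Y + 1 \<and> (c = 0 \<or> c = 1)" if "(a, b, c) \<in> U'" for a b c
    using that bd[of "a - 1" "b - Y" c] Y unfolding mem by auto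
  have 2: "(a, b, 0) \<in> U' \<longleftrightarrow> 0 \<le> a \<and> a \<le> ?X b" if "0 \<le> b" "b \<le> Y" for a b
  proof (cases "b = Y")
    case True
    have "(a, b, 0) \<in> U' \<longleftrightarrow> a = 1 \<or> a = 0 \<or> (a - 1, 0, 0) \<in> row_new xs ys"
      using Y by (auto simp: mem True)
    also have "\<dots> \<longleftrightarrow> a = 1 \<or> a = 0 \<or> (1 \<le> a - 1 \<and> a - 1 \<le> 24)"
      using row_new_lower[of xs ys "a - 1"] len by (simp add: xs_def)
    also have "\<dots> \<longleftrightarrow> 0 \<le> a \<and> a \<le> ?X b" by (auto simp: True)
    finally show ?thesis .
  next
    case False
    then show ?thesis using bd[of "a - 1" "b - Y" 0] that by (auto simp: mem)
  qed
  have 3: "(a, Y + 1, c) \<in> U' \<longleftrightarrow> (a - 1, 1, c) \<in> row_out ys" for a c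
    using row_new_upper[of xs ys "a - 1" c] len by (auto simp: mem)
  have 4: "\<exists>b. 0 \<le> b \<and> b < Y \<and> p = (?X b, b, 0) \<and> (q = Start \<longleftrightarrow> b = 0)" if "(p, q) \<in> M" for p q
    using that Y unfolding M by auto
  have 5: "\<exists>q. ((?X b, b, 0), q) \<in> M" if "0 \<le> b" "b < Y" for b
    using that unfolding M by (intro exI[of _ "if b = 0 then Start else Pre"]) auto
  have "strip U' M ?X Y ys"
    unfolding strip_def using len Y 1 2 3 4 5 by (intro conjI allI impI) (simp_all | blast)+
  then show ?thesis using run unfolding ys_def by blast
qed

text \<open>All later rows come in pairs, so the choice between one and two initial cells adjusts
  the parity of the height.\<close>

lemma run_start:
  fixes two :: bool
  defines "Y \<equiv> if two then 2 else 1 :: int"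
  shows "\<exists>U M. run (prog m dig two) marked ({(0, 0, 0)}, {}, (0, 0, 0), [], Start)
      (U, M, (25, Y, 0), [], Up False) \<and> strip U M ((\<lambda>_. 0)(Y := 25)) Y (map Some (tape [True]))"
proof -
  let ?P = "prog m dig two"
  define M where "M = (if two then {((0, 1, 0), Pre), ((0, 0, 0), Start)} else {((0 :: int, 0 :: int, 0 :: int), Start)})"
  have run: "run ?P marked ({(0, 0, 0)}, {}, (0, 0, 0), [], Start)
      (insert (1, Y, 0) ((\<lambda>b. (0, b, 0)) ` {0..Y}), M, (1, Y, 0), [], Init0)"
  proof (cases two)
    case True
    have "{0..2 :: int} = {0, 1, 2}" by auto
    moreover have "run ?P marked ({(0, 0, 0)}, {}, (0, 0, 0), [], Start)
        ({(0, 1, 0), (0, 0, 0)}, {((0, 0, 0), Start)}, (0, 1, 0), [], Pre)"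
      using run_move[of ?P Start PosY "[]" Pre "(0, 0, 0)" "{(0, 0, 0)}" marked "{}"] True
      by (simp add: prog_def turn_def insert_commute)
    moreover have "run ?P marked ({(0, 1, 0), (0, 0, 0)}, {((0, 0, 0), Start)}, (0, 1, 0), [], Pre)
        ({(1, 2, 0), (0, 2, 0), (0, 1, 0), (0, 0, 0)}, M, (1, 2, 0), [], Init0)"
      using run_move[of ?P Pre PosY "[PosX]" Init0 "(0, 1, 0)" "{(0, 1, 0), (0, 0, 0)}" marked "{((0, 0, 0), Start)}"] True
      by (simp add: prog_def turn_def insert_commute M_def)
    ultimately show ?thesis
      using True by (simp add: Y_def insert_commute)
  next
    case False
    have "{0..1 :: int} = {0, 1}" by auto
    then show ?thesis
      using run_move[of ?P Start PosY "[PosX]" Init0 "(0, 0, 0)" "{(0, 0, 0)}" marked "{}"] False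
      by (simp add: prog_def turn_def insert_commute M_def Y_def)
  qed
  have M: "(p, q) \<in> M \<longleftrightarrow> (q = Start \<and> p = (0, 0, 0)) \<or> (q = Pre \<and> (\<exists>b. 0 < b \<and> b < Y \<and> p = (0, b, 0)))" for p q
    by (cases two) (auto simp: M_def Y_def intro!: exI[of _ 1])
  have "0 < Y" by (simp add: Y_def)
  from strip_init[OF this M refl, of m dig two] run show ?thesis
    by (meson rtranclp_trans)
qed

text \<open>A pass takes two rows, and \<open>val u + 1\<close> passes are made: one for each
  decrement of a positive number and one that discovers zero. The width is constant because
  \<open>dec\<close> keeps the length.\<close>

lemma strip_count:
  assumes "strip U M X Y (map Some (tape (replicate m False @ True # u)))"
  shows "\<exists>U' M' X' u'. run (prog m dig two) marked (U, M, (X Y, Y, 0), [], Up False)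
      (U', M', (X' (Y + 2 * int (val u) + 2), Y + 2 * int (val u) + 2, 0), [], Up True) \<and>
     strip U' M' X' (Y + 2 * int (val u) + 2) (map Some (tape (replicate m False @ True # u'))) \<and>
     length u' = length u \<and> (\<forall>b \<le> Y. X' b = X b) \<and> (\<forall>b. Y \<le> b \<and> b \<le> Y + 2 * int (val u) + 2 \<longrightarrow> X' b = X Y)"
  using assms
proof (induction "val u" arbitrary: U M X Y u rule: less_induct)
  case less
  let ?t = "\<lambda>u. replicate m False @ True # u"
  define b where "b \<longleftrightarrow> True \<notin> set u"
  have XY: "X Y = 8 * int (length (tape (?t (dec u)))) + 1"
    using stripD(2)[OF less.prems] by simp
  have "row_right m dig two (if False then Last0 else Pass) (map Some (tape (?t u)) @ replicate 0 None)
      (map Some (tape (?t (dec u)))) (Up b)"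
    using row_count[of m dig two u] by (simp add: b_def)
  from strip_pair[OF less.prems row_leftward this]
  obtain U1 M1 where 1: "run (prog m dig two) marked (U, M, (X Y, Y, 0), [], Up False)
        (U1, M1, (X Y, Y + 2, 0), [], Up b)"
      "strip U1 M1 (X(Y + 1 := X Y, Y + 2 := X Y)) (Y + 2) (map Some (tape (?t (dec u))))"
    using XY by auto
  have const: "(X(Y + 1 := X Y, Y + 2 := X Y)) b' = X Y" if "Y \<le> b'" "b' \<le> Y + 2" for b'
  proof -
    have "b' = Y \<or> b' = Y + 1 \<or> b' = Y + 2" using that by linarith
    then show ?thesis by auto
  qed
  show ?case
  proof (cases b)
    case True
    then have "val u = 0" using val_pos_iff[of u] by (simp add: b_def)
    then show ?thesis
      using 1 True const
      by (intro exI[of _ U1] exI[of _ M1] exI[of _ "X(Y + 1 := X Y, Y + 2 := X Y)"] exI[of _ "dec u"]) simp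
  next
    case False
    then have v: "val (dec u) < val u" "int (val (dec u)) = int (val u) - 1"
      using val_pos_iff[of u] val_dec[of u] by (auto simp: b_def)
    let ?X = "X(Y + 1 := X Y, Y + 2 := X Y)"
    have e: "Y + 2 + 2 * int (val (dec u)) + 2 = Y + 2 * int (val u) + 2" using v(2) by simp
    obtain U' M' X' u' where 2: "run (prog m dig two) marked (U1, M1, (?X (Y + 2), Y + 2, 0), [], Up False)
      (U', M', (X' (Y + 2 * int (val u) + 2), Y + 2 * int (val u) + 2, 0), [], Up True)"
      "strip U' M' X' (Y + 2 * int (val u) + 2) (map Some (tape (?t u')))"
      "length u' = length (dec u)" "\<forall>b \<le> Y + 2. X' b = ?X b"
      "\<forall>b. Y + 2 \<le> b \<and> b \<le> Y + 2 * int (val u) + 2 \<longrightarrow> X' b = ?X (Y + 2)"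
      using less.hyps[OF v(1) 1(2)] unfolding e by blast
    have "run (prog m dig two) marked (U, M, (X Y, Y, 0), [], Up False)
      (U', M', (X' (Y + 2 * int (val u) + 2), Y + 2 * int (val u) + 2, 0), [], Up True)"
      using rtranclp_trans[OF 1(1)] 2(1) False by simp
    moreover have "X' b' = X b'" if "b' \<le> Y" for b' using 2(4) that by simp
    moreover have "X' b' = X Y" if "Y \<le> b'" "b' \<le> Y + 2 * int (val u) + 2" for b'
      using 2(4,5) const[of b'] const[of "Y + 2"] that by (cases "b' \<le> Y + 2") auto
    ultimately show ?thesis using 2(2,3) length_dec[of u] by metis
  qed
qed

text \<open>Each digit is inserted in front of the earlier ones, so digit 0 has to be the last block
  of \<open>v\<close>.\<close>

definition digit :: "nat \<Rightarrow> nat \<Rightarrow> bool list \<Rightarrow> nat \<Rightarrow> bool list" where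
  "digit m k v j = take k (drop ((m - 1 - j) * k) v)"

lemma strip_unpack:
  fixes two :: bool
  defines "s \<equiv> if two then 2 else 1 :: int"
  assumes v: "length v = m * k" and j: "j \<le> m"
  shows "\<exists>U M X. run (prog m (digit m k v) two) marked ({(0, 0, 0)}, {}, (0, 0, 0), [], Start)
      (U, M, (X (s + 2 * int j), s + 2 * int j, 0), [], Up False) \<and>
     strip U M X (s + 2 * int j) (map Some (tape (replicate j False @ True # drop ((m - j) * k) v))) \<and> X 0 = 0"
  using j
proof (induction j)
  case 0
  obtain U M where "run (prog m (digit m k v) two) marked ({(0, 0, 0)}, {}, (0, 0, 0), [], Start)
      (U, M, (25, s, 0), [], Up False)" "strip U M ((\<lambda>_. 0)(s := 25)) s (map Some (tape [True]))"
    using run_start[of m "digit m k v" two] unfolding s_def by blast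
  moreover define X :: "int \<Rightarrow> int" where "X = (\<lambda>_. 0)(s := 25)"
  moreover have "X 0 = 0" "X s = 25" by (simp_all add: s_def X_def)
  ultimately show ?case
    using v unfolding X_def[symmetric] by (intro exI[of _ U] exI[of _ M] exI[of _ X]) simp
next
  case (Suc j)
  let ?Y = "s + 2 * int j" and ?P = "prog m (digit m k v) two"
  obtain U M X where IH: "run ?P marked ({(0, 0, 0)}, {}, (0, 0, 0), [], Start) (U, M, (X ?Y, ?Y, 0), [], Up False)"
     "strip U M X ?Y (map Some (tape (replicate j False @ True # drop ((m - j) * k) v)))" "X 0 = 0"
    using Suc by auto
  have "m - j = Suc (m - 1 - j)" using Suc.prems by simp
  then have "drop ((m - j) * k) v = drop k (drop ((m - 1 - j) * k) v)"
    by (simp add: add.commute)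
  then have digits: "digit m k v j @ drop ((m - j) * k) v = drop ((m - Suc j) * k) v"
    unfolding digit_def by (metis append_take_drop_id diff_Suc_eq_diff_pred)
  have "row_right m (digit m k v) two (if False then Last0 else Pass)
     (map Some (tape (replicate j False @ True # drop ((m - j) * k) v)) @ replicate (2 * (1 + length (digit m k v j))) None)
     (map Some (tape (replicate (Suc j) False @ True # drop ((m - Suc j) * k) v))) (Up False)"
    using row_unpack[of j m "digit m k v" two "drop ((m - j) * k) v"] Suc.prems unfolding digits by simp
  from strip_pair[OF IH(2) row_leftward this]
  obtain U' M' X' where 1: "run ?P marked (U, M, (X ?Y, ?Y, 0), [], Up False) (U', M', (X' (?Y + 2), ?Y + 2, 0), [], Up False)"
      "strip U' M' X' (?Y + 2) (map Some (tape (replicate (Suc j) False @ True # drop ((m - Suc j) * k) v)))"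
      "X' = X(?Y + 1 := X ?Y, ?Y + 2 :=
        8 * int (length (map Some (tape (replicate (Suc j) False @ True # drop ((m - Suc j) * k) v)))) + 1)"
    by auto
  have "X' 0 = 0" using IH(3) unfolding 1(3) by (simp add: s_def)
  moreover have "?Y + 2 = s + 2 * int (Suc j)" by simp
  ultimately show ?case using rtranclp_trans[OF IH(1) 1(1)] 1(2) by metis
qed

text \<open>
  The outcome of a complete strip of width \<open>w\<close> and height \<open>h\<close>: after \<open>m\<close> pairs of rows that unpack
  the digits, its rows have full width.
\<close>

definition gadget :: "nat \<Rightarrow> int \<Rightarrow> int \<Rightarrow> pos set \<Rightarrow> (pos \<times> ctrl) set \<Rightarrow> (int \<Rightarrow> int) \<Rightarrow> bool" where
  "gadget m w h U M X \<longleftrightarrow>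
     (\<forall>a b c. (a, b, c) \<in> U \<longrightarrow> 0 \<le> a \<and> a < w \<and> 0 \<le> b \<and> b < h \<and> (c = 0 \<or> c = 1)) \<and>
     (\<forall>b. 0 \<le> b \<and> b < h \<longrightarrow> 0 \<le> X b \<and> X b < w) \<and>
     (\<forall>a b. 0 \<le> b \<and> b < h \<longrightarrow> ((a, b, 0) \<in> U \<longleftrightarrow> 0 \<le> a \<and> a \<le> X b)) \<and>
     (\<forall>b. 2 + 2 * int m \<le> b \<and> b < h \<longrightarrow> X b = w - 1) \<and> X 0 = 0 \<and>
     (\<forall>p q. (p, q) \<in> M \<longrightarrow> (\<exists>b. 0 \<le> b \<and> b < h - 1 \<and> p = (X b, b, 0) \<and> (q = Start \<longleftrightarrow> b = 0))) \<and>
     (\<forall>b. 0 \<le> b \<and> b < h - 1 \<longrightarrow> (\<exists>q. ((X b, b, 0), q) \<in> M))"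

text \<open>The full tape has \<open>m * (k + 1) + 1\<close> symbols, hence
  \<open>2 * m * (k + 1) + 3\<close> blocks of eight cells, and there are two more columns: this is
  \<open>w\<close>. The height adds up \<open>s\<close> initial cells, one row writing
  \<open>[True]\<close>, \<open>2 * m\<close> rows of unpacking, \<open>2 * val v + 2\<close> rows
  of counting and a last pair that removes the bumps.\<close>

lemma run_gadget:
  fixes two :: bool
  defines "s \<equiv> if two then 2 else 1 :: int"
  assumes v: "length v = m * k"
    and w: "w = 16 * int m * (int k + 1) + 26" and h: "h = s + 2 * int m + 2 * int (val v) + 5"
  shows "\<exists>U M X. run (prog m (digit m k v) two) marked ({(0, 0, 0)}, {}, (0, 0, 0), [], Start)
      (U, M, (w - 1, h - 1, 0), [], End) \<and> gadget m w h U M X"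
proof -
  let ?P = "prog m (digit m k v) two"
  define Y where "Y = s + 2 * int m"
  define Z where "Z = Y + 2 * int (val v) + 2"
  obtain U M X where 1: "run ?P marked ({(0, 0, 0)}, {}, (0, 0, 0), [], Start) (U, M, (X Y, Y, 0), [], Up False)"
     "strip U M X Y (map Some (tape (replicate m False @ True # v)))" "X 0 = 0"
    using strip_unpack[OF v order_refl, of two] unfolding s_def Y_def by auto
  obtain U' M' X' v' where 2: "run ?P marked (U, M, (X Y, Y, 0), [], Up False) (U', M', (X' Z, Z, 0), [], Up True)"
     "strip U' M' X' Z (map Some (tape (replicate m False @ True # v')))"
     "length v' = length v" "\<forall>b \<le> Y. X' b = X b" "\<forall>b. Y \<le> b \<and> b \<le> Z \<longrightarrow> X' b = X Y"
    using strip_count[OF 1(2), of "digit m k v" two] unfolding Z_def by blast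
  let ?t = "tape (replicate m False @ True # v')"
  have len: "8 * int (length ?t) + 1 = w - 1" using 2(3) v by (simp add: w algebra_simps)
  have Y: "0 < Y" "Y \<le> Z" "Z + 2 = h - 1" "Y \<le> 2 + 2 * int m"
    by (auto simp: Y_def Z_def h s_def)
  have XY: "X Y = w - 1"
    using stripD(2)[OF 2(2)] 2(5) Y len by simp
  have "row_right m (digit m k v) two (if True then Last0 else Pass)
     (map Some ?t @ replicate 0 None) (replicate (length ?t) None) End"
    using row_last[of "replicate m False @ True # v'" m "digit m k v" two]
    by (simp only: if_True replicate.simps append_Nil2) blast
  from strip_pair[OF 2(2) row_leftward this]
  obtain U3 M3 where 3: "run ?P marked (U', M', (X' Z, Z, 0), [], Up True) (U3, M3, (w - 1, h - 1, 0), [], End)"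
      "strip U3 M3 (X'(Z + 1 := X' Z, Z + 2 := w - 1)) (Z + 2) (replicate (length ?t) None)"
    using len Y(3) by auto
  define V where "V = X'(Z + 1 := X' Z, Z + 2 := w - 1)"
  have st: "strip U3 M3 V (h - 1) (replicate (length ?t) None)" using 3(2)[folded V_def] unfolding Y(3) .
  have Vh: "V (h - 1) = w - 1" using Y(3) by (simp add: V_def)
  have full: "V b = w - 1" if "Y \<le> b" "b < h" for b
  proof -
    have "b \<le> Z \<or> b = Z + 1 \<or> b = Z + 2" using that Y by linarith
    then show ?thesis using 2(5) that Y XY by (auto simp: V_def)
  qed
  have V0: "V 0 = 0" using 2(4) 1(3) Y by (simp add: V_def)
  have g1: "0 \<le> a \<and> a < w \<and> 0 \<le> b \<and> b < h \<and> (c = 0 \<or> c = 1)" if "(a, b, c) \<in> U3" for a b c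
  proof -
    have "b \<noteq> h" using stripD(6)[OF st, of a c] that by auto
    then show ?thesis using stripD(4)[OF st that] Vh by auto
  qed
  have "gadget m w h U3 M3 V"
    unfolding gadget_def
  proof (intro conjI allI impI)
    fix b assume "0 \<le> b \<and> b < h"
    then show "0 \<le> V b" "V b < w" using stripD(3)[OF st, of b] Vh by auto
  next
    fix a b assume "0 \<le> b \<and> b < h"
    then show "(a, b, 0) \<in> U3 \<longleftrightarrow> 0 \<le> a \<and> a \<le> V b" using stripD(5)[OF st, of b a] by simp
  next
    fix b assume "2 + 2 * int m \<le> b \<and> b < h"
    then show "V b = w - 1" using full Y(4) by simp
  next
    fix p q assume "(p, q) \<in> M3"
    from stripD(7)[OF st this] show "\<exists>b. 0 \<le> b \<and> b < h - 1 \<and> p = (V b, b, 0) \<and> (q = Start \<longleftrightarrow> b = 0)" .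
  next
    fix b assume "0 \<le> b \<and> b < h - 1"
    then show "\<exists>q. ((V b, b, 0), q) \<in> M3" using stripD(8)[OF st, of b] by simp
  qed (use g1 V0 in blast)+
  moreover have "run ?P marked ({(0, 0, 0)}, {}, (0, 0, 0), [], Start) (U3, M3, (w - 1, h - 1, 0), [], End)"
    using 1(1) 2(1) 3(1) by (meson rtranclp_trans)
  ultimately show ?thesis by blast
qed

section \<open>The path through three strips\<close>

instance dir :: countable by countable_datatype
instance ctrl :: countable by countable_datatype

text \<open>Turns a run into an indexed path. The time \<open>n1\<close> is kept because rays rely
  on what is complete when the third strip begins. Blocked alternatives point to cells visited at
  times below \<open>i\<close>, which will be \<open>G\<close> on the path.\<close>

lemma walk_of_run:
  assumes "run P E ({p0}, {}, p0, [], q0) (U1, M1, p1, ds1, q1)" "run P E (U1, M1, p1, ds1, q1) (U, M, pe, [], qe)"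
  obtains p ds q dd n1 n where "n1 \<le> n" "p 0 = p0" "ds 0 = []" "q 0 = q0"
     "p n = pe" "ds n = []" "q n = qe" "U1 = p ` {..n1}" "p n1 = p1"
     "U = p ` {..n}" "inj_on p {..n}" "M = {(p i, q i) |i. i < n \<and> ds i = [] \<and> E (q i)}"
     "\<forall>i<n. p (Suc i) = p i + unit_vec (dd i) \<and>
        (ds i = dd i # ds (Suc i) \<and> q (Suc i) = q i \<or>
         ds i = [] \<and> (dd i, ds (Suc i), q (Suc i)) \<in> set (P (q i)) \<and>
           (\<forall>e es r. (e, es, r) \<in> set (P (q i)) \<longrightarrow> e \<noteq> dd i \<longrightarrow> p i + unit_vec e \<in> p ` {..<i}))"
proof -
  obtain f1 n1 where f1: "f1 0 = ({p0}, {}, p0, [], q0)" "f1 n1 = (U1, M1, p1, ds1, q1)" "\<And>i. i < n1 \<Longrightarrow> step P E (f1 i) (f1 (Suc i))"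
    using assms(1) unfolding rtranclp_power relpowp_fun_conv by blast
  obtain f2 n2 where f2: "f2 0 = (U1, M1, p1, ds1, q1)" "f2 n2 = (U, M, pe, [], qe)" "\<And>i. i < n2 \<Longrightarrow> step P E (f2 i) (f2 (Suc i))"
    using assms(2) unfolding rtranclp_power relpowp_fun_conv by blast
  define n where "n = n1 + n2"
  define f where "f i = (if i \<le> n1 then f1 i else f2 (i - n1))" for i
  have f0: "f 0 = ({p0}, {}, p0, [], q0)" and fn1: "f n1 = (U1, M1, p1, ds1, q1)" and fn: "f n = (U, M, pe, [], qe)"
    using f1 f2 by (auto simp: f_def n_def)
  have stp: "step P E (f i) (f (Suc i))" if "i < n" for i
  proof (cases "i < n1")
    case True
    then show ?thesis using f1(3) by (simp add: f_def)
  next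
    case False
    then have "step P E (f2 (i - n1)) (f2 (Suc (i - n1)))" using f2(3) that by (simp add: n_def)
    moreover have "f i = f2 (i - n1)" using False f1(2) f2(1) by (cases "i = n1") (auto simp: f_def)
    moreover have "f (Suc i) = f2 (Suc (i - n1))" using False by (simp add: f_def Suc_diff_le)
    ultimately show ?thesis by simp
  qed
  define p where "p i = fst (snd (snd (f i)))" for i
  define ds where "ds i = fst (snd (snd (snd (f i))))" for i
  define q where "q i = snd (snd (snd (snd (f i))))" for i
  have f: "f i = (fst (f i), fst (snd (f i)), p i, ds i, q i)" for i
    by (simp add: p_def ds_def q_def)
  define ok where "ok i d \<longleftrightarrow> p (Suc i) = p i + unit_vec d \<and> p (Suc i) \<notin> fst (f i) \<and>
     fst (f (Suc i)) = insert (p (Suc i)) (fst (f i)) \<and>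
     fst (snd (f (Suc i))) = (if ds i = [] \<and> E (q i) then insert (p i, q i) (fst (snd (f i))) else fst (snd (f i))) \<and>
     (ds i = d # ds (Suc i) \<and> q (Suc i) = q i \<or>
      ds i = [] \<and> (d, ds (Suc i), q (Suc i)) \<in> set (P (q i)) \<and>
        (\<forall>e es r. (e, es, r) \<in> set (P (q i)) \<longrightarrow> e \<noteq> d \<longrightarrow> p i + unit_vec e \<in> fst (f i)))" for i d
  have "\<exists>d. ok i d" if "i < n" for i
    using stp[OF that]
  proof (cases rule: step.cases)
    case (move p' d U' M' ds' q')
    then show ?thesis by (intro exI[of _ d]) (simp add: ok_def p_def ds_def q_def)
  next
    case (branch d ds' q'' q' p' U' M')
    have "ok i d"
      unfolding ok_def p_def ds_def q_def branch(1,2) fst_conv snd_conv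
      using branch(3,4,5) by simp
    then show ?thesis by blast
  qed
  then obtain dd where dd: "\<And>i. i < n \<Longrightarrow> ok i (dd i)" by metis
  have vis: "fst (f i) = p ` {..i}" if "i \<le> n" for i
    using that
  proof (induction i)
    case 0
    then show ?case by (simp add: f0 p_def)
  next
    case (Suc i)
    then show ?case using dd[of i] by (simp add: ok_def atMost_Suc)
  qed
  have inj: "inj_on p {..i}" if "i \<le> n" for i
    using that
  proof (induction i)
    case (Suc i)
    then have "p (Suc i) \<notin> p ` {..i}" using dd[of i] vis[of i] by (metis Suc_leD Suc_le_lessD ok_def)
    then show ?case using Suc by (simp add: atMost_Suc)
  qed simp
  have log: "fst (snd (f i)) = {(p j, q j) |j. j < i \<and> ds j = [] \<and> E (q j)}" if "i \<le> n" for i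
    using that
  proof (induction i)
    case 0
    then show ?case by (simp add: f0)
  next
    case (Suc i)
    then show ?case using dd[of i] by (auto simp: ok_def less_Suc_eq)
  qed
  have blocked: "c \<in> p ` {..<i}" if "c \<in> p ` {..i}" "c \<noteq> p i" for c i
    using that by (metis image_insert insertE lessThan_Suc lessThan_Suc_atMost)
  have ne: "p i + unit_vec e \<noteq> p i" for i e
    by (metis add.right_neutral add_left_cancel unit_vec_nonzero)
  have nn: "n1 \<le> n" by (simp add: n_def)
  have ends: "p 0 = p0" "ds 0 = []" "q 0 = q0" "p n = pe" "ds n = []" "q n = qe"
    by (simp_all add: p_def ds_def q_def f0 fn)
  have mid: "U1 = p ` {..n1}" "p n1 = p1"
    using vis[OF nn] by (simp_all add: fn1 p_def)
  have fin: "U = p ` {..n}" "M = {(p i, q i) |i. i < n \<and> ds i = [] \<and> E (q i)}"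
    using vis[of n] log[of n] by (simp_all add: fn)
  have steps: "\<forall>i<n. p (Suc i) = p i + unit_vec (dd i) \<and>
        (ds i = dd i # ds (Suc i) \<and> q (Suc i) = q i \<or>
         ds i = [] \<and> (dd i, ds (Suc i), q (Suc i)) \<in> set (P (q i)) \<and>
           (\<forall>e es r. (e, es, r) \<in> set (P (q i)) \<longrightarrow> e \<noteq> dd i \<longrightarrow> p i + unit_vec e \<in> p ` {..<i}))"
    using dd vis blocked ne unfolding ok_def by (metis less_imp_le)
  show thesis
    by (rule that[of n1 n p ds q dd]; fact nn ends mid fin inj[OF order_refl] steps)
qed

text \<open>\<open>Walk\<close> stores the direction of entry, which determines the input side, and
  the moves still pending. Each stage of a move sequence is a tile type of its own, so these
  sequences must have bounded length.\<close>

datatype tile_state = Walk "dir option" "dir list" "nat \<times> ctrl" | Ray | Spine | Tooth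

instance tile_state :: countable by countable_datatype

fun rot :: "nat \<Rightarrow> dir \<Rightarrow> dir" where
  "rot (Suc 0) d = (case d of PosX \<Rightarrow> NegY | NegX \<Rightarrow> PosY | PosY \<Rightarrow> PosX | NegY \<Rightarrow> NegX | PosZ \<Rightarrow> PosZ | NegZ \<Rightarrow> NegZ)"
| "rot (Suc (Suc 0)) d = (case d of PosX \<Rightarrow> NegX | NegX \<Rightarrow> PosX | PosY \<Rightarrow> NegY | NegY \<Rightarrow> PosY | PosZ \<Rightarrow> PosZ | NegZ \<Rightarrow> NegZ)"
| "rot _ d = d"

text \<open>
  Three strips bound the square: the first one along the left side, the second one along the rest of
  the top, the third one along the rest of the right side, growing downwards.
\<close>

fun place :: "int \<Rightarrow> int \<Rightarrow> nat \<Rightarrow> pos \<Rightarrow> pos" where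
  "place N w (Suc 0) (a, b, c) = (w + b, N - 1 - a, c)"
| "place N w (Suc (Suc 0)) (a, b, c) = (N - 1 - a, N - 1 - w - b, c)"
| "place N w _ (a, b, c) = (a, b, c)"

lemma motion_place: "g < 3 \<Longrightarrow> motion (place N w g) (rot g)"
proof -
  assume "g < 3"
  then have g: "g = 0 \<or> g = Suc 0 \<or> g = Suc (Suc 0)" by linarith
  have "place N w g (p + unit_vec d) = place N w g p + unit_vec (rot g d)" for p d
    using g by (cases p; cases d; elim disjE) simp_all
  moreover have "inj (place N w g)" using g by (elim disjE) (auto simp: inj_def)
  ultimately show ?thesis unfolding motion_def by blast
qed

lemma mem_place:
  "(x, y, z) \<in> place N w 0 ` U \<longleftrightarrow> (x, y, z) \<in> U"
  "(x, y, z) \<in> place N w 1 ` U \<longleftrightarrow> (N - 1 - y, x - w, z) \<in> U"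
  "(x, y, z) \<in> place N w 2 ` U \<longleftrightarrow> (N - 1 - x, N - 1 - w - y, z) \<in> U"
proof -
  have "motion (place N w 0) (rot 0)" "motion (place N w 1) (rot 1)" "motion (place N w 2) (rot 2)"
    by (simp_all add: motion_place)
  note mem = this[THEN motion_mem]
  show "(x, y, z) \<in> place N w 0 ` U \<longleftrightarrow> (x, y, z) \<in> U"
    using mem(1)[of "(x, y, z)" U] by simp
  show "(x, y, z) \<in> place N w 1 ` U \<longleftrightarrow> (N - 1 - y, x - w, z) \<in> U"
    using mem(2)[of "(N - 1 - y, x - w, z)" U] by simp
  show "(x, y, z) \<in> place N w 2 ` U \<longleftrightarrow> (N - 1 - x, N - 1 - w - y, z) \<in> U"
    using mem(3)[of "(N - 1 - x, N - 1 - w - y, z)" U] by (simp add: numeral_2_eq_2)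
qed

text \<open>The strips are placed such that the cell ahead of the last cell of one is the first cell
  of the next; therefore \<open>End\<close> hands over by a single forward move.\<close>

definition square_prog :: "nat \<Rightarrow> nat \<Rightarrow> (nat \<Rightarrow> bool list) \<Rightarrow> (nat \<Rightarrow> bool) \<Rightarrow> (nat \<times> ctrl) prog" where
  "square_prog m k v two = (\<lambda>(g, q).
     if q = End then (if g < 2 then [(rot g PosX, [], (Suc g, Start))] else [])
     else turn (rot g) (Pair g) (prog m (digit m k (v g)) (two g) q))"

definition square_marked :: "nat \<times> ctrl \<Rightarrow> bool" where
  "square_marked = (\<lambda>(g, q). marked q)"

text \<open>
  The ends of the rows of the third strip emit rays to the left, which fill the part of the
  square below the second strip.  The first of them sends further rays upwards, between the
  first two strips.
\<close>

definition emission :: "nat \<times> ctrl \<Rightarrow> dir \<Rightarrow> tile_state option" where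
  "emission = (\<lambda>(g, q) d. if g = 2 \<and> d = NegX \<and> (marked q \<or> q = End)
     then Some (if q = Start then Spine else Ray) else None)"

text \<open>\<open>map_of\<close> keeps one alternative per direction; by
  \<open>distinct_square_prog\<close> none gets lost.\<close>

fun out :: "(nat \<times> ctrl) prog \<Rightarrow> tile_state \<Rightarrow> dir \<Rightarrow> tile_state option" where
  "out P (Walk d0 (e # ds) q) d = (if d = e then Some (Walk (Some d) ds q) else None)"
| "out P (Walk d0 [] q) d = (case map_of (P q) d of
      Some (ds, q') \<Rightarrow> Some (Walk (Some d) ds q') | None \<Rightarrow> emission q d)"
| "out P Ray d = (if d = NegX then Some Ray else None)"
| "out P Spine d = (if d = NegX then Some Spine else if d = PosY then Some Tooth else None)"
| "out P Tooth d = (if d = PosY then Some Tooth else None)"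

fun ind :: "tile_state \<Rightarrow> dir option" where
  "ind (Walk d ds q) = d"
| "ind Ray = Some NegX"
| "ind Spine = Some NegX"
| "ind Tooth = Some PosY"

lemma out_ind: "out P s d = Some s' \<Longrightarrow> ind s' = Some d"
  by (cases "(P, s, d)" rule: out.cases) (auto simp: emission_def split: option.splits if_splits prod.splits)

lemma distinct_turn: "inj \<delta> \<Longrightarrow> distinct (map fst (turn \<delta> h xs)) \<longleftrightarrow> distinct (map fst xs)"
proof -
  assume "inj \<delta>"
  have "map fst (turn \<delta> h xs) = map \<delta> (map fst xs)" by (simp add: turn_def case_prod_unfold)
  then show ?thesis using \<open>inj \<delta>\<close> by (metis distinct_map inj_on_subset subset_UNIV)
qed

lemma distinct_act_prog: "distinct (map fst (act_prog a))"
  by (cases a) (simp_all add: alternative_def)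

lemma inj_mirror: "inj mirror"
  by (rule injI, case_tac x; case_tac y; simp)

lemma inj_rot: "inj (rot g)"
  by (rule injI, cases "(g, PosX)" rule: rot.cases) (simp_all split: dir.splits)

lemma distinct_square_prog: "distinct (map fst (square_prog m k v two q))"
  by (cases q) (simp add: square_prog_def distinct_turn inj_rot prog_def inj_mirror distinct_act_prog)

lemma run_place:
  assumes g: "g < 3"
    and r: "run (prog m (digit m k (v g)) (two g)) marked ({(0, 0, 0)}, {}, (0, 0, 0), [], Start) (U, M, p, [], End)"
  shows "run (square_prog m k v two) square_marked
     ({place N w g (0, 0, 0)}, {}, place N w g (0, 0, 0), [], (g, Start))
     (place N w g ` U, map_prod (place N w g) (Pair g) ` M, place N w g p, [], (g, End))"
proof -
  have "prog m dig b q \<noteq> [] \<Longrightarrow> q \<noteq> End" for dig b q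
    by (auto simp: prog_def turn_def)
  then have "run (square_prog m k v two) square_marked
     (map_cfg (place N w g) (rot g) (Pair g) ({(0, 0, 0)}, {}, (0, 0, 0), [], Start))
     (map_cfg (place N w g) (rot g) (Pair g) (U, M, p, [], End))"
    by (intro run_map_cfg[OF motion_place[OF g] _ _ r]) (auto simp: square_prog_def square_marked_def)
  then show ?thesis by simp
qed

lemma gadgetD:
  assumes "gadget m w h U M X"
  shows "(a, b, c) \<in> U \<Longrightarrow> 0 \<le> a \<and> a < w \<and> 0 \<le> b \<and> b < h \<and> (c = 0 \<or> c = 1)"
    "0 \<le> b \<Longrightarrow> b < h \<Longrightarrow> 0 \<le> X b \<and> X b < w"
    "0 \<le> b \<Longrightarrow> b < h \<Longrightarrow> (a, b, 0) \<in> U \<longleftrightarrow> 0 \<le> a \<and> a \<le> X b"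
    "2 + 2 * int m \<le> b \<Longrightarrow> b < h \<Longrightarrow> X b = w - 1"
    "X 0 = 0"
    "(p, q) \<in> M \<Longrightarrow> \<exists>b. 0 \<le> b \<and> b < h - 1 \<and> p = (X b, b, 0) \<and> (q = Start \<longleftrightarrow> b = 0)"
    "0 \<le> b \<Longrightarrow> b < h - 1 \<Longrightarrow> \<exists>q. ((X b, b, 0), q) \<in> M"
  using assms unfolding gadget_def by blast+

lemma run_square:
  assumes A: "run (prog m (digit m k (v 0)) (two 0)) marked ({(0, 0, 0)}, {}, (0, 0, 0), [], Start)
      (UA, MA, (w - 1, N - 1, 0), [], End)" "gadget m w N UA MA XA"
    and B: "run (prog m (digit m k (v 1)) (two 1)) marked ({(0, 0, 0)}, {}, (0, 0, 0), [], Start)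
      (UB, MB, (w - 1, N - w - 1, 0), [], End)" "gadget m w (N - w) UB MB XB"
    and C: "run (prog m (digit m k (v 2)) (two 2)) marked ({(0, 0, 0)}, {}, (0, 0, 0), [], Start)
      (UC, MC, (w - 1, N - w - 1, 0), [], End)" "gadget m w (N - w) UC MC XC"
    and w: "0 < w" "2 * w < N"
  defines "LA \<equiv> map_prod (place N w 0) (Pair 0) ` MA" and "LB \<equiv> map_prod (place N w 1) (Pair 1) ` MB"
    and "LC \<equiv> map_prod (place N w 2) (Pair 2) ` MC"
    and "A \<equiv> place N w 0 ` UA" and "B \<equiv> place N w 1 ` UB" and "C \<equiv> place N w 2 ` UC"
  shows "run (square_prog m k v two) square_marked ({(0, 0, 0)}, {}, (0, 0, 0), [], (0, Start))
      (insert (place N w 2 (0, 0, 0)) (A \<union> B), LA \<union> LB, place N w 2 (0, 0, 0), [], (2, Start))"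
    and "run (square_prog m k v two) square_marked
      (insert (place N w 2 (0, 0, 0)) (A \<union> B), LA \<union> LB, place N w 2 (0, 0, 0), [], (2, Start))
      (A \<union> B \<union> C, LA \<union> LB \<union> LC, place N w 2 (w - 1, N - w - 1, 0), [], (2, End))"
proof -
  let ?P = "square_prog m k v two" and ?E = square_marked
  have A_bounds: "(x, y, z) \<in> A \<Longrightarrow> x < w \<and> y < N" for x y z
    unfolding A_def mem_place using gadgetD(1)[OF A(2)] by blast
  have B_bounds: "(x, y, z) \<in> B \<Longrightarrow> w \<le> x \<and> x < N \<and> N - w \<le> y" for x y z
    unfolding B_def mem_place using gadgetD(1)[OF B(2), of "N - 1 - y" "x - w" z] by auto
  have C_bounds: "(x, y, z) \<in> C \<Longrightarrow> N - w \<le> x \<and> y < N - w" for x y z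
    unfolding C_def mem_place using gadgetD(1)[OF C(2), of "N - 1 - x" "N - 1 - w - y" z] by auto
  have sB: "place N w 1 (0, 0, 0) \<in> B"
    unfolding B_def by (rule imageI) (use run_visited[OF B(1)] in simp)
  have sC: "place N w 2 (0, 0, 0) \<in> C"
    unfolding C_def by (rule imageI) (use run_visited[OF C(1)] in simp)
  have "A \<inter> B = {}" using A_bounds B_bounds by fastforce
  have "(A \<union> B) \<inter> C = {}" using A_bounds B_bounds C_bounds w by fastforce
  have 1: "run ?P ?E ({(0, 0, 0)}, {}, (0, 0, 0), [], (0, Start)) (A, LA, (w - 1, N - 1, 0), [], (0, End))"
    using run_place[of 0 m k v two, OF _ A(1), of N w] by (simp add: A_def LA_def)
  have fB: "(w, N - 1, 0) \<notin> A" using A_bounds by blast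
  have 2: "run ?P ?E (A, LA, (w - 1, N - 1, 0), [], (0, End))
      (insert (place N w 1 (0, 0, 0)) A, LA, place N w 1 (0, 0, 0), [], (1, Start))"
    using run_move[of ?P "(0, End)" PosX "[]" "(1, Start)" "(w - 1, N - 1, 0)" A ?E LA] fB
    by (simp add: square_prog_def square_marked_def)
  have "A \<inter> (B - {place N w 1 (0, 0, 0)}) = {}" using \<open>A \<inter> B = {}\<close> by blast
  from run_frame[OF run_place[of 1 m k v two, OF _ B(1), of N w, folded B_def LB_def] this, of LA]
  have 3: "run ?P ?E (insert (place N w 1 (0, 0, 0)) A, LA, place N w 1 (0, 0, 0), [], (1, Start))
     (A \<union> B, LA \<union> LB, (N - 1, N - w, 0), [], (1, End))"
    by (simp add: Un_commute)
  have fC: "(N - 1, N - w - 1, 0) \<notin> A \<union> B" using A_bounds B_bounds w by force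
  have 4: "run ?P ?E (A \<union> B, LA \<union> LB, (N - 1, N - w, 0), [], (1, End))
      (insert (place N w 2 (0, 0, 0)) (A \<union> B), LA \<union> LB, place N w 2 (0, 0, 0), [], (2, Start))"
    using run_move[of ?P "(1, End)" NegY "[]" "(2, Start)" "(N - 1, N - w, 0)" "A \<union> B" ?E "LA \<union> LB"] fC
    by (simp add: square_prog_def square_marked_def numeral_2_eq_2 algebra_simps)
  show "run ?P ?E ({(0, 0, 0)}, {}, (0, 0, 0), [], (0, Start)) (insert (place N w 2 (0, 0, 0)) (A \<union> B), LA \<union> LB, place N w 2 (0, 0, 0), [], (2, Start))"
    using 1 2 3 4 by (meson rtranclp_trans)
  have "(A \<union> B) \<inter> (C - {place N w 2 (0, 0, 0)}) = {}" using \<open>(A \<union> B) \<inter> C = {}\<close> by blast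
  from run_frame[OF run_place[of 2 m k v two, OF _ C(1), of N w, folded C_def LC_def] this, of "LA \<union> LB"]
  show "run ?P ?E (insert (place N w 2 (0, 0, 0)) (A \<union> B), LA \<union> LB, place N w 2 (0, 0, 0), [], (2, Start)) (A \<union> B \<union> C, LA \<union> LB \<union> LC, place N w 2 (w - 1, N - w - 1, 0), [], (2, End))"
    by (simp add: Un_ac)
qed

section \<open>Filling the square\<close>

text \<open>The bound \<open>2 + 2 * int m \<le> N - 1 - w\<close> keeps the ragged rows, where
  digits are unpacked, away from the corners: the first strip has full width from the height of the
  spine upwards, and the last rows of the other two are full.\<close>

locale square_walk =
  fixes N w :: int and m :: nat and P :: "(nat \<times> ctrl) prog"
    and UA UB UC :: "pos set" and MA MB MC :: "(pos \<times> ctrl) set" and XA XB XC :: "int \<Rightarrow> int"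
    and p :: "nat \<Rightarrow> pos" and ds :: "nat \<Rightarrow> dir list" and q :: "nat \<Rightarrow> nat \<times> ctrl" and dd :: "nat \<Rightarrow> dir"
    and n1 n :: nat and S :: "tile_state set"
  assumes GA: "gadget m w N UA MA XA" and GB: "gadget m w (N - w) UB MB XB"
    and GC: "gadget m w (N - w) UC MC XC"
    and size: "0 < w" "2 * w < N" "2 + 2 * int m \<le> N - 1 - w"
    and P: "\<And>q. distinct (map fst (P q))" "P (2, End) = []"
      "\<And>r. marked r \<Longrightarrow> NegX \<notin> fst ` set (P (2, r))"
    and n1: "n1 \<le> n" and p0: "p 0 = (0, 0, 0)" "ds 0 = []" "q 0 = (0, Start)"
    and pn: "p n = place N w 2 (w - 1, N - w - 1, 0)" "ds n = []" "q n = (2, End)"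
    and pn1: "p n1 = place N w 2 (0, 0, 0)"
    and V1: "insert (place N w 2 (0, 0, 0)) (place N w 0 ` UA \<union> place N w 1 ` UB) = p ` {..n1}"
    and V: "place N w 0 ` UA \<union> place N w 1 ` UB \<union> place N w 2 ` UC = p ` {..n}"
    and inj: "inj_on p {..n}"
    and marks: "map_prod (place N w 0) (Pair 0) ` MA \<union> map_prod (place N w 1) (Pair 1) ` MB \<union>
       map_prod (place N w 2) (Pair 2) ` MC = {(p i, q i) |i. i < n \<and> ds i = [] \<and> square_marked (q i)}"
    and steps: "\<And>i. i < n \<Longrightarrow> p (Suc i) = p i + unit_vec (dd i) \<and>
        (ds i = dd i # ds (Suc i) \<and> q (Suc i) = q i \<or>
         ds i = [] \<and> (dd i, ds (Suc i), q (Suc i)) \<in> set (P (q i)) \<and>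
           (\<forall>e es r. (e, es, r) \<in> set (P (q i)) \<longrightarrow> e \<noteq> dd i \<longrightarrow> p i + unit_vec e \<in> p ` {..<i}))"
    and S: "finite S" "Ray \<in> S" "Spine \<in> S" "Tooth \<in> S"
      "\<And>i d. i \<le> n \<Longrightarrow> Walk d (ds i) (q i) \<in> S"
begin

abbreviation "A \<equiv> place N w 0 ` UA"
abbreviation "B \<equiv> place N w 1 ` UB"
abbreviation "C \<equiv> place N w 2 ` UC"
abbreviation "W \<equiv> p ` {..n}"

lemma A_bounds: "(x, y, z) \<in> A \<Longrightarrow> 0 \<le> x \<and> x < w \<and> 0 \<le> y \<and> y < N \<and> (z = 0 \<or> z = 1)"
  unfolding mem_place using gadgetD(1)[OF GA] by blast

lemma B_bounds: "(x, y, z) \<in> B \<Longrightarrow> w \<le> x \<and> x < N \<and> N - w \<le> y \<and> y < N \<and> (z = 0 \<or> z = 1)"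
  unfolding mem_place using gadgetD(1)[OF GB, of "N - 1 - y" "x - w" z] by auto

lemma C_bounds: "(x, y, z) \<in> C \<Longrightarrow> N - w \<le> x \<and> x < N \<and> 0 \<le> y \<and> y < N - w \<and> (z = 0 \<or> z = 1)"
  unfolding mem_place using gadgetD(1)[OF GC, of "N - 1 - x" "N - 1 - w - y" z] by auto

lemma mem_A: "0 \<le> y \<Longrightarrow> y < N \<Longrightarrow> (x, y, 0) \<in> A \<longleftrightarrow> 0 \<le> x \<and> x \<le> XA y"
  unfolding mem_place using gadgetD(3)[OF GA] by blast

lemma mem_B: "w \<le> x \<Longrightarrow> x < N \<Longrightarrow> (x, y, 0) \<in> B \<longleftrightarrow> y < N \<and> N - 1 - y \<le> XB (x - w)"
  unfolding mem_place using gadgetD(3)[OF GB, of "x - w" "N - 1 - y"] by auto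

lemma mem_C: "0 \<le> y \<Longrightarrow> y < N - w \<Longrightarrow> (x, y, 0) \<in> C \<longleftrightarrow> x < N \<and> N - 1 - x \<le> XC (N - 1 - w - y)"
  unfolding mem_place using gadgetD(3)[OF GC, of "N - 1 - w - y" "N - 1 - x"] by auto

lemma XA: "0 \<le> y \<Longrightarrow> y < N \<Longrightarrow> 0 \<le> XA y \<and> XA y < w" "N - 1 - w \<le> y \<Longrightarrow> y < N \<Longrightarrow> XA y = w - 1"
  using gadgetD(2,4)[OF GA, of y] size by auto

lemma XB: "0 \<le> y \<Longrightarrow> y < N - w \<Longrightarrow> 0 \<le> XB y \<and> XB y < w" "XB (N - 1 - w) = w - 1"
  using gadgetD(2)[OF GB, of y] gadgetD(4)[OF GB, of "N - 1 - w"] size by auto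

lemma XC: "0 \<le> y \<Longrightarrow> y < N - w \<Longrightarrow> 0 \<le> XC y \<and> XC y < w" "XC (N - 1 - w) = w - 1" "XC 0 = 0"
  using gadgetD(2)[OF GC, of y] gadgetD(4)[OF GC, of "N - 1 - w"] gadgetD(5)[OF GC] size by auto

lemma W_eq: "c \<in> W \<longleftrightarrow> c \<in> A \<or> c \<in> B \<or> c \<in> C"
  using V by blast

lemma early: "c \<in> A \<or> c \<in> B \<Longrightarrow> c \<in> p ` {..n1}"
  using V1 by blast

lemma late: "c \<in> p ` {..n1} \<longleftrightarrow> c \<in> A \<or> c \<in> B \<or> c = p n1"
  using V1 pn1 by auto

section \<open>The cells left free by the strips\<close>

definition hole :: "pos \<Rightarrow> bool" where
  "hole = (\<lambda>(x, y, z). 0 \<le> x \<and> x < N \<and> 0 \<le> y \<and> y < N \<and> z = 0 \<and> (x, y, z) \<notin> W)"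

definition row_end :: "int \<Rightarrow> pos" where
  "row_end y = (N - 1 - XC (N - 1 - w - y), y, 0)"

text \<open>At this height the first strip covers an interval on the left and the third one an
  interval on the right. However ragged their edges are, the holes of a row form one interval
  between them.\<close>

lemma hole_lower:
  assumes h: "hole (x, y, 0)" and y: "y \<le> N - 1 - w"
  shows "0 < x" "hole (x + 1, y, 0) \<or> (x + 1, y, 0) = row_end y"
    "hole (x - 1, y, 0) \<or> (x - 1, y, 0) \<in> p ` {..n1}"
proof -
  have b: "0 \<le> x" "x < N" "0 \<le> y" "y < N - w" and nW: "(x, y, 0) \<notin> A" "(x, y, 0) \<notin> C"
    using h y by (auto simp: hole_def W_eq)
  have nA: "XA y < x" using nW(1) mem_A[of y x] b size by auto
  have nC: "XC (N - 1 - w - y) < N - 1 - x" using nW(2) mem_C[of y x] b by auto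
  have XA0: "0 \<le> XA y" using XA(1)[of y] b size by auto
  have XC0: "0 \<le> XC (N - 1 - w - y)" using XC(1)[of "N - 1 - w - y"] b by auto
  show "0 < x" using nA XA0 by simp
  have nB: "(u, y, 0) \<notin> B" for u using B_bounds[of u y 0] b by auto
  show "hole (x + 1, y, 0) \<or> (x + 1, y, 0) = row_end y"
  proof (cases "(x + 1, y, 0) \<in> C")
    case True
    then have "N - 1 - (x + 1) \<le> XC (N - 1 - w - y)" using mem_C[of y "x + 1"] b by auto
    then have "x + 1 = N - 1 - XC (N - 1 - w - y)" using nC by simp
    then show ?thesis by (simp add: row_end_def)
  next
    case False
    then have "(x + 1, y, 0) \<notin> W" using nB nA mem_A[of y "x + 1"] b size by (auto simp: W_eq)
    moreover have "x + 1 < N" using nC XC0 by simp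
    ultimately show ?thesis using b size by (simp add: hole_def)
  qed
  show "hole (x - 1, y, 0) \<or> (x - 1, y, 0) \<in> p ` {..n1}"
  proof (cases "(x - 1, y, 0) \<in> W")
    case True
    have "(x - 1, y, 0) \<notin> C" using mem_C[of y "x - 1"] b nC by auto
    then have "(x - 1, y, 0) \<in> A \<or> (x - 1, y, 0) \<in> B" using True W_eq by blast
    then show ?thesis using early by blast
  next
    case False
    then show ?thesis using b \<open>0 < x\<close> size by (simp add: hole_def)
  qed
qed

lemma hole_row_end:
  assumes y: "0 \<le> y" "y \<le> N - 1 - w" and e: "(x, y, 0) = row_end y"
  shows "hole (x - 1, y, 0)"
proof -
  have x: "x = N - 1 - XC (N - 1 - w - y)" using e by (simp add: row_end_def)
  have b: "0 \<le> XC (N - 1 - w - y)" "XC (N - 1 - w - y) < w" using XC(1)[of "N - 1 - w - y"] y by auto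
  have "(x - 1, y, 0) \<notin> C" using mem_C[of y "x - 1"] y by (simp add: x)
  moreover have "(x - 1, y, 0) \<notin> A" using A_bounds[of "x - 1" y 0] b x size by auto
  moreover have "(x - 1, y, 0) \<notin> B" using B_bounds[of "x - 1" y 0] y by auto
  ultimately show ?thesis using b x y size by (simp add: hole_def W_eq)
qed

lemma hole_spine:
  assumes h: "hole (x, N - 1 - w, 0)"
  shows "hole (x, N - w, 0) \<or> (x, N - w, 0) \<in> p ` {..n1}"
proof (cases "(x, N - w, 0) \<in> W")
  case True
  have "(x, N - w, 0) \<notin> C" using C_bounds[of x "N - w" 0] by auto
  then have "(x, N - w, 0) \<in> A \<or> (x, N - w, 0) \<in> B" using True W_eq by blast
  then show ?thesis using early by blast
next
  case False
  then show ?thesis using h size by (simp add: hole_def)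
qed

text \<open>At this height the first strip has full width. So a hole lies in a column that the
  second strip covers from the top to some depth, with nothing but holes from there down to the
  spine.\<close>

lemma hole_upper:
  assumes h: "hole (x, y, 0)" and y: "N - w \<le> y"
  shows "hole (x, y - 1, 0)" "hole (x, y + 1, 0) \<or> (x, y + 1, 0) \<in> p ` {..n1}"
proof -
  have b: "0 \<le> x" "x < N" "0 \<le> y" "y < N" and nW: "(x, y, 0) \<notin> A" "(x, y, 0) \<notin> B"
    using h by (auto simp: hole_def W_eq)
  have wx: "w \<le> x" using nW(1) mem_A[of y x] XA(2)[of y] b y by auto
  have nB: "XB (x - w) < N - 1 - y" using nW(2) mem_B[of x y] wx b by auto
  have XB0: "0 \<le> XB (x - w)" using XB(1)[of "x - w"] wx b by auto
  have "(x, y - 1, 0) \<notin> A" using A_bounds[of x "y - 1" 0] wx by auto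
  moreover have "(x, y - 1, 0) \<notin> B" using mem_B[of x "y - 1"] nB wx b by auto
  \<comment> \<open>The third strip reaches its top height only in the last column, its first row
    being a single cell; there the second strip has full depth and leaves no hole.\<close>
  moreover have "(x, y - 1, 0) \<notin> C"
  proof
    assume c: "(x, y - 1, 0) \<in> C"
    then have y': "y = N - w" using C_bounds[of x "y - 1" 0] y by auto
    then have "x = N - 1" using c mem_C[of "y - 1" x] XC(3) b size by auto
    then have "x - w = N - 1 - w" by simp
    then have "XB (x - w) = w - 1" by (simp only: XB(2))
    then show False using nB y' by simp
  qed
  ultimately show "hole (x, y - 1, 0)" using b y size by (simp add: hole_def W_eq)
  show "hole (x, y + 1, 0) \<or> (x, y + 1, 0) \<in> p ` {..n1}"
  proof (cases "(x, y + 1, 0) \<in> W")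
    case True
    have "(x, y + 1, 0) \<notin> C" using C_bounds[of x "y + 1" 0] y by auto
    then have "(x, y + 1, 0) \<in> A \<or> (x, y + 1, 0) \<in> B" using True W_eq by blast
    then show ?thesis using early by blast
  next
    case False
    then show ?thesis using b nB XB0 by (simp add: hole_def)
  qed
qed

section \<open>The tree on the whole square\<close>

definition s :: "nat \<Rightarrow> tile_state" where
  "s i = Walk (if i = 0 then None else Some (dd (i - 1))) (ds i) (q i)"

definition idx :: "pos \<Rightarrow> nat" where
  "idx c = inv_into {..n} p c"

lemma idx_p [simp]: "i \<le> n \<Longrightarrow> idx (p i) = i"
  using inv_into_f_f[OF inj] by (simp add: idx_def)

lemma W_cases:
  assumes "c \<in> W" obtains i where "i \<le> n" "c = p i" "idx c = i"
  using assms by auto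

definition filler :: "pos \<Rightarrow> tile_state" where
  "filler = (\<lambda>(x, y, z). if y < N - 1 - w then Ray else if y = N - 1 - w then Spine else Tooth)"

definition st :: "pos \<Rightarrow> tile_state option" where
  "st c = (if c \<in> W then Some (s (idx c)) else if hole c then Some (filler c) else None)"

definition par :: "pos \<Rightarrow> pos" where
  "par c = (if c \<in> W then p (idx c - 1)
     else (\<lambda>(x, y, z). if y \<le> N - 1 - w then (x + 1, y, z) else (x, y - 1, z)) c)"

text \<open>The path comes first, then the rays from right to left, then the teeth; a tooth ranks
  above the spine since \<open>N - x \<le> N < N + y\<close>.\<close>

definition rank :: "pos \<Rightarrow> nat" where
  "rank c = (if c \<in> W then idx c
     else (\<lambda>(x, y, z). Suc n + nat (if y \<le> N - 1 - w then N - x else N + y)) c)"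

text \<open>When a filler tile attaches, the third strip may still be growing; only the path up to
  its first cell is sure to be complete.\<close>

definition G :: "pos \<Rightarrow> pos set" where
  "G c = (if c \<in> W then p ` {..<idx c} else insert (par c) (p ` {..n1}))"

lemma hole_not_W: "hole c \<Longrightarrow> c \<notin> W"
  by (cases c) (simp add: hole_def)

lemma hole_cases:
  assumes "hole c"
  obtains x y where "c = (x, y, 0)" "0 \<le> x" "x < N" "0 \<le> y" "y < N"
  using assms by (cases c) (auto simp: hole_def)

lemma row_end_emits:
  assumes y: "0 \<le> y" "y \<le> N - 1 - w"
  shows "\<exists>i. n1 \<le> i \<and> i \<le> n \<and> p i = row_end y \<and>
    out P (s i) NegX = Some (if y = N - 1 - w then Spine else Ray)"
proof -
  define b where "b = N - 1 - w - y"
  have e: "row_end y = place N w 2 (XC b, b, 0)" by (simp add: row_end_def b_def numeral_2_eq_2)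
  obtain i r where i: "i \<le> n" "p i = row_end y" "ds i = []" "q i = (2, r)" "marked r \<or> r = End"
      "r = Start \<longleftrightarrow> b = 0" "i < n \<or> r = End"
  proof (cases "b = N - w - 1")
    \<comment> \<open>The end of the last row is the end of the path. It has the state
      \<open>End\<close> and is not in the log.\<close>
    case True
    then have b: "b = N - 1 - w" "N - w - 1 = N - 1 - w" by simp_all
    have "p n = row_end y" unfolding e pn(1) b XC(2) by (rule refl)
    then show thesis using that[of n End] pn b size by auto
  next
    case False
    then obtain r where r: "((XC b, b, 0), r) \<in> MC" using gadgetD(7)[OF GC, of b] y by (auto simp: b_def)
    obtain b' where b': "(XC b, b, 0) = (XC b', b', 0 :: int)" "r = Start \<longleftrightarrow> b' = 0" using gadgetD(6)[OF GC r] by blast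
    have "(row_end y, (2, r)) \<in> map_prod (place N w 2) (Pair 2) ` MC" using r unfolding e by (force simp: map_prod_def)
    then have "(row_end y, (2, r)) \<in> {(p i, q i) |i. i < n \<and> ds i = [] \<and> square_marked (q i)}"
      unfolding marks[symmetric] by (rule UnI2)
    then obtain i where "i < n" "p i = row_end y" "q i = (2, r)" "ds i = []" "square_marked (2, r)"
      by auto
    then show thesis using that[of i r] b' by (auto simp: square_marked_def)
  qed
  have "row_end y \<notin> p ` {..<n1}"
  proof
    assume a: "row_end y \<in> p ` {..<n1}"
    define x where "x = N - 1 - XC (N - 1 - w - y)"
    have "(x, y, 0) \<in> C"
      unfolding x_def using mem_C[of y] XC(1)[of "N - 1 - w - y"] y by auto
    note bounds = C_bounds[OF this]
    have nA: "(x, y, 0) \<notin> A"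
    proof
      assume "(x, y, 0) \<in> A"
      from A_bounds[OF this] show False using bounds size by simp
    qed
    have nB: "(x, y, 0) \<notin> B"
    proof
      assume "(x, y, 0) \<in> B"
      from B_bounds[OF this] show False using bounds by simp
    qed
    have re: "row_end y = (x, y, 0)" by (simp add: row_end_def x_def)
    have "row_end y \<notin> A" unfolding re by (rule nA)
    moreover have "row_end y \<notin> B" unfolding re by (rule nB)
    moreover have "row_end y \<in> p ` {..n1}" using a by auto
    ultimately have "row_end y = p n1" using late by blast
    then obtain j where "j < n1" "p j = p n1" using a by auto
    then show False using inj_onD[OF inj, of j n1] n1 by simp
  qed
  then have "n1 \<le> i" using i(2) by (metis imageI lessThan_iff not_le)
  moreover have "out P (s i) NegX = Some (if y = N - 1 - w then Spine else Ray)"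
  proof -
    have "map_of (P (2, r)) NegX = None"
      using P(2,3) i(5) unfolding map_of_eq_None_iff by (cases "r = End") auto
    then show ?thesis using i by (auto simp: s_def emission_def b_def)
  qed
  ultimately show ?thesis using i by blast
qed

lemma out_walk:
  assumes "i < n"
  shows "out P (s i) (dd i) = Some (s (Suc i))"
  using steps[OF assms]
proof (elim conjE disjE)
  assume "ds i = dd i # ds (Suc i)" "q (Suc i) = q i"
  then show ?thesis by (simp add: s_def)
next
  assume "ds i = []" "(dd i, ds (Suc i), q (Suc i)) \<in> set (P (q i))"
  moreover from this have "map_of (P (q i)) (dd i) = Some (ds (Suc i), q (Suc i))"
    using P(1) by (intro map_of_is_SomeI)
  ultimately show ?thesis by (simp add: s_def)
qed

lemma st_W: "i \<le> n \<Longrightarrow> st (p i) = Some (s i)"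
  by (simp add: st_def)

lemma st_hole: "hole c \<Longrightarrow> st c = Some (filler c)"
  using hole_not_W by (simp add: st_def)

lemma par_W: "i < n \<Longrightarrow> par (p (Suc i)) = p i"
  by (simp add: par_def)

lemma par_hole: "hole (x, y, 0) \<Longrightarrow> par (x, y, 0) = (if y \<le> N - 1 - w then (x + 1, y, 0) else (x, y - 1, 0))"
  using hole_not_W by (auto simp: par_def)

lemma G_hole: "hole c \<Longrightarrow> G c = insert (par c) (p ` {..n1})"
  using hole_not_W by (simp add: G_def)

lemma G_W: "i \<le> n \<Longrightarrow> G (p i) = p ` {..<i}"
  by (simp add: G_def)

lemma st_cases:
  assumes "st c = Some t"
  obtains i where "i \<le> n" "c = p i" "t = s i" | "hole c" "t = filler c"
proof (cases "c \<in> W")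
  case True
  then obtain i where "i \<le> n" "c = p i" by auto
  then show thesis using that(1) assms st_W by simp
next
  case False
  then show thesis using that(2) assms by (auto simp: st_def split: if_splits)
qed

lemma hole_ne_root: "hole c \<Longrightarrow> c \<noteq> p 0"
  using hole_not_W[of c] by auto

lemma dom_st: "dom st = W \<union> Collect hole"
  by (auto simp: st_def split: if_splits)

lemma child_walk:
  assumes "i \<le> n" "i \<noteq> 0"
  shows "\<exists>d t. p i = par (p i) + unit_vec d \<and> st (par (p i)) = Some t \<and> out P t d = Some (s i)"
proof -
  obtain j where j: "i = Suc j" "j < n" using assms by (cases i) auto
  show ?thesis
    using steps[OF j(2)] out_walk[OF j(2)] st_W[of j] par_W[OF j(2)] j
    by (intro exI[of _ "dd j"] exI[of _ "s j"]) simp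
qed

lemma child_hole:
  assumes h: "hole (x, y, 0)"
  shows "\<exists>d t. (x, y, 0) = par (x, y, 0) + unit_vec d \<and> st (par (x, y, 0)) = Some t \<and>
     out P t d = Some (filler (x, y, 0))"
proof (cases "y \<le> N - 1 - w")
  case True
  have y0: "0 \<le> y" using h by (simp add: hole_def)
  have "hole (x + 1, y, 0) \<or> (x + 1, y, 0) = row_end y" using hole_lower(2)[OF h True] .
  then show ?thesis
  proof
    assume "hole (x + 1, y, 0)"
    from st_hole[OF this] show ?thesis
      using True par_hole[OF h] by (intro exI[of _ NegX]) (simp add: filler_def)
  next
    assume e: "(x + 1, y, 0) = row_end y"
    obtain i where i: "i \<le> n" "p i = row_end y" "out P (s i) NegX = Some (if y = N - 1 - w then Spine else Ray)"
      using row_end_emits[OF y0 True] by blast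
    have "st (x + 1, y, 0) = Some (s i)" using st_W[OF i(1)] i(2) e by simp
    then show ?thesis
      using True par_hole[OF h] i(3) by (intro exI[of _ NegX]) (simp add: filler_def)
  qed
next
  case False
  then have y: "N - w \<le> y" by simp
  from st_hole[OF hole_upper(1)[OF h y]] show ?thesis
    using False par_hole[OF h] by (intro exI[of _ PosY]) (simp add: filler_def)
qed

lemma par_hole_cases:
  assumes h: "hole (x, y, 0)"
  shows "hole (par (x, y, 0)) \<or> (\<exists>i. n1 \<le> i \<and> i \<le> n \<and> par (x, y, 0) = p i)"
proof (cases "y \<le> N - 1 - w")
  case True
  have "0 \<le> y" using h by (simp add: hole_def)
  then show ?thesis
    using hole_lower(2)[OF h True] row_end_emits[of y] True par_hole[OF h] by (metis (no_types, lifting))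
next
  case False
  then show ?thesis using hole_upper(1)[OF h] par_hole[OF h] by simp
qed

lemma rank_par_hole:
  assumes h: "hole (x, y, 0)"
  shows "rank (par (x, y, 0)) < rank (x, y, 0)"
proof -
  have r: "rank (x, y, 0) = Suc n + nat (if y \<le> N - 1 - w then N - x else N + y)"
    using hole_not_W[OF h] by (simp add: rank_def)
  from par_hole_cases[OF h] show ?thesis
  proof
    assume "hole (par (x, y, 0))"
    moreover have "0 \<le> x" "x < N" "0 \<le> y" "y < N" using h by (auto simp: hole_def)
    ultimately show ?thesis
      using hole_not_W[of "par (x, y, 0)"] size unfolding r par_hole[OF h]
      by (auto simp: rank_def nat_less_iff split: if_splits)
  next
    assume "\<exists>i. n1 \<le> i \<and> i \<le> n \<and> par (x, y, 0) = p i"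
    then obtain i where i: "i \<le> n" "par (x, y, 0) = p i" by blast
    show ?thesis unfolding i(2) r using i(1) by (simp add: rank_def)
  qed
qed

text \<open>An alternative not taken points to a cell visited earlier, by the branching rule of the
  turtle. A ray points to a hole, because the log contains only ends of rows.\<close>

lemma emit_walk:
  assumes i: "i \<le> n" and o: "out P (s i) d = Some t"
  shows "p i + unit_vec d \<in> p ` {..<i} \<or>
    (p i + unit_vec d \<noteq> p 0 \<and> st (p i + unit_vec d) = Some t \<and> par (p i + unit_vec d) = p i)"
proof -
  have next_ok: ?thesis if "i < n" "d = dd i"
  proof -
    have "t = s (Suc i)" using out_walk[OF that(1)] o that(2) by simp
    moreover have "p (Suc i) = p i + unit_vec d" using steps[OF that(1)] that(2) by simp
    moreover have "p (Suc i) \<noteq> p 0" using inj that(1) by (auto simp: inj_on_def)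
    ultimately show ?thesis using st_W[of "Suc i"] par_W[OF that(1)] that(1) by (metis Suc_leI)
  qed
  consider e es where "ds i = e # es" | es r where "ds i = []" "map_of (P (q i)) d = Some (es, r)"
    | "ds i = []" "emission (q i) d = Some t"
    using o by (cases "ds i") (auto simp: s_def split: option.splits)
  then show ?thesis
  proof cases
    case 1
    then have "i < n" using i pn(2) by (cases "i = n") auto
    moreover from this have "dd i = e" using steps[of i] 1 by auto
    moreover have "d = e" using o 1 by (simp add: s_def split: if_splits)
    ultimately show ?thesis using next_ok by blast
  next
    case 2
    have mem: "(d, es, r) \<in> set (P (q i))" using map_of_SomeD[OF 2(2)] .
    then have "i < n" using i pn(3) P(2) by (cases "i = n") auto
    show ?thesis
    proof (cases "d = dd i")
      case False
      then have "p i + unit_vec d \<in> p ` {..<i}"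
        using steps[OF \<open>i < n\<close>] mem 2(1) by (metis list.distinct(1))
      then show ?thesis ..
    qed (use next_ok \<open>i < n\<close> in blast)
  next
    case 3
    then obtain r where r: "q i = (2, r)" "d = NegX" "marked r \<or> r = End" "t = (if r = Start then Spine else Ray)"
      by (auto simp: emission_def split: prod.splits if_splits)
    obtain b where b: "0 \<le> b" "b \<le> N - 1 - w" "p i = place N w 2 (XC b, b, 0)" "r = Start \<longleftrightarrow> b = 0"
    proof (cases "r = End")
      case True
      have "i = n"
      proof (rule ccontr)
        assume "i \<noteq> n"
        then have "i < n" using i by simp
        from steps[OF this] show False using 3(1) r(1) True P(2) by auto
      qed
      moreover have "N - w - 1 = N - 1 - w" by simp
      ultimately have "p i = place N w 2 (XC (N - 1 - w), N - 1 - w, 0)"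
        using pn(1) XC(2) by metis
      then show thesis using that[of "N - 1 - w"] size True by auto
    next
      case False
      then have m: "marked r" using r(3) by simp
      then have "i < n" using i pn(3) r(1) False by (cases "i = n") auto
      then have "(p i, (2, r)) \<in> {(p i, q i) |i. i < n \<and> ds i = [] \<and> square_marked (q i)}"
        using 3(1) r(1) m by (auto simp: square_marked_def)
      then have "(p i, (2 :: nat, r)) \<in> map_prod (place N w 0) (Pair 0) ` MA \<union> map_prod (place N w 1) (Pair 1) ` MB \<union>
          map_prod (place N w 2) (Pair 2) ` MC"
        unfolding marks .
      then obtain c where c: "(c, r) \<in> MC" "p i = place N w 2 c" by auto
      obtain b where "0 \<le> b" "b < N - w - 1" "c = (XC b, b, 0)" "r = Start \<longleftrightarrow> b = 0"
        using gadgetD(6)[OF GC c(1)] by blast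
      then show thesis using that[of b] c(2) by simp
    qed
    define y where "y = N - 1 - w - b"
    have y: "0 \<le> y" "y \<le> N - 1 - w" "r = Start \<longleftrightarrow> y = N - 1 - w" using b by (auto simp: y_def)
    have pi: "p i = row_end y" using b(3) by (simp add: row_end_def y_def numeral_2_eq_2)
    then obtain x where x: "(x, y, 0) = row_end y" by (simp add: row_end_def)
    have h: "hole (x - 1, y, 0)" using hole_row_end[OF y(1,2) x] .
    have tgt: "p i + unit_vec d = (x - 1, y, 0)" unfolding pi x[symmetric] r(2) by simp
    have "st (x - 1, y, 0) = Some t" using st_hole[OF h] y r(4) by (auto simp: filler_def)
    moreover have "par (x - 1, y, 0) = p i" using par_hole[OF h] y(2) x pi by simp
    ultimately show ?thesis using hole_ne_root[OF h] unfolding tgt by blast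
  qed
qed

lemma emit_hole:
  assumes h: "hole (x, y, 0)" and o: "out P (filler (x, y, 0)) d = Some t"
  shows "(x, y, 0) + unit_vec d \<in> p ` {..n1} \<or>
    (hole ((x, y, 0) + unit_vec d) \<and> filler ((x, y, 0) + unit_vec d) = t \<and> par ((x, y, 0) + unit_vec d) = (x, y, 0))"
proof -
  consider "y \<le> N - 1 - w" "d = NegX" "t = filler (x, y, 0)" | "y = N - 1 - w" "d = PosY" "t = Tooth"
    | "N - w \<le> y" "d = PosY" "t = Tooth"
    using o by (auto simp: filler_def split: if_splits)
  then show ?thesis
  proof cases
    case 1
    then show ?thesis
      using hole_lower(3)[OF h 1(1)] par_hole[of "x - 1" y] by (auto simp: filler_def)
  next
    case 2
    have "hole (x, N - w, 0) \<or> (x, N - w, 0) \<in> p ` {..n1}" using hole_spine h 2(1) by simp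
    then show ?thesis
      using par_hole[of x "N - w"] 2 by (auto simp: filler_def)
  next
    case 3
    then show ?thesis
      using hole_upper(2)[OF h 3(1)] par_hole[of x "y + 1"] by (auto simp: filler_def)
  qed
qed

lemma growth: "growth_tree (out P) ind S st (p 0) (s 0) par rank G"
proof
  show "ind t = Some d" if "out P s' d = Some t" for s' d t using out_ind[OF that] .
  show "finite S" using S(1) .
  show "ran st \<subseteq> S"
  proof
    fix t assume "t \<in> ran st"
    then obtain c where "st c = Some t" by (auto simp: ran_def)
    then show "t \<in> S"
    proof (cases rule: st_cases)
      case (1 i)
      then show ?thesis using S(5) by (simp add: s_def)
    next
      case 2
      then show ?thesis using S by (auto simp: filler_def split: prod.splits)
    qed
  qed
  have "Collect hole \<subseteq> {0..N} \<times> {0..N} \<times> {0}" by (auto simp: hole_def)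
  then have "finite (Collect hole)" by (rule finite_subset) auto
  then show "finite (dom st)" unfolding dom_st by simp
  show "st (p 0) = Some (s 0)" using st_W by simp
  show "ind (s 0) = None" by (simp add: s_def)
  show "G (p 0) = {}" using G_W[of 0] by simp
  fix c
  show "\<exists>d s'. c = par c + unit_vec d \<and> st (par c) = Some s' \<and> out P s' d = Some t"
    if "st c = Some t" "c \<noteq> p 0" for t
    using that(1)
  proof (cases rule: st_cases)
    case (1 i)
    then have "i \<noteq> 0" using that(2) by metis
    from child_walk[OF 1(1) this] show ?thesis unfolding 1(2,3) .
  next
    case 2
    obtain x y where c: "c = (x, y, 0)" using hole_cases[OF 2(1)] by metis
    show ?thesis using child_hole 2 unfolding c by blast
  qed
  show "rank (par c) < rank c" if "c \<in> dom st" "c \<noteq> p 0"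
  proof (cases "hole c")
    case True
    then obtain x y where c: "c = (x, y, 0)" using hole_cases by metis
    show ?thesis using rank_par_hole True unfolding c by blast
  next
    case False
    then have "c \<in> W" using that(1) unfolding dom_st by simp
    then obtain i where i: "i \<le> n" "c = p i" by (rule W_cases)
    have "i \<noteq> 0" using that(2) i(2) by metis
    then obtain j where "i = Suc j" by (metis not0_implies_Suc)
    then show ?thesis using i par_W[of j] by (simp add: rank_def)
  qed
  show "par c \<in> G c \<and> G c \<subseteq> insert (par c) (G (par c))" if "c \<in> dom st" "c \<noteq> p 0"
  proof (cases "hole c")
    case True
    then obtain x y where c: "c = (x, y, 0)" using hole_cases by metis
    \<comment> \<open>The parent is another filler cell or a path cell of index at least
      \<open>n1\<close>; both already guarantee the path up to \<open>n1\<close>.\<close>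
    have "p ` {..n1} \<subseteq> insert (par c) (G (par c))"
    proof (cases "hole (par c)")
      case True
      then show ?thesis using G_hole by auto
    next
      case False
      then obtain i where i: "n1 \<le> i" "i \<le> n" "par c = p i"
        using par_hole_cases[of x y] \<open>hole c\<close> unfolding c by blast
      have "{..n1} \<subseteq> insert i {..<i}" using i by auto
      then have "p ` {..n1} \<subseteq> insert (p i) (p ` {..<i})" by blast
      then show ?thesis using G_W i by simp
    qed
    then show ?thesis using G_hole[OF True] by auto
  next
    case False
    then have "c \<in> W" using that(1) unfolding dom_st by simp
    then obtain i where i: "i \<le> n" "c = p i" by (rule W_cases)
    have "i \<noteq> 0" using that(2) i(2) by metis
    then obtain j where j: "i = Suc j" by (metis not0_implies_Suc)
    then show ?thesis
      using i par_W[of j] G_W[of i] G_W[of j] by (simp add: lessThan_Suc)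
  qed
  show "c + unit_vec d \<in> G c \<or> (c + unit_vec d \<noteq> p 0 \<and> st (c + unit_vec d) = Some t' \<and> par (c + unit_vec d) = c)"
    if "st c = Some t" "out P t d = Some t'" for t t' d
    using that(1)
  proof (cases rule: st_cases)
    case (1 i)
    then show ?thesis using emit_walk[OF 1(1)] that(2) G_W[OF 1(1)] by simp
  next
    case 2
    obtain x y where c: "c = (x, y, 0)" using hole_cases[OF 2(1)] by metis
    have "c + unit_vec d \<in> p ` {..n1} \<or>
       (hole (c + unit_vec d) \<and> filler (c + unit_vec d) = t' \<and> par (c + unit_vec d) = c)"
      using emit_hole[of x y d t'] 2 that(2) unfolding c by blast
    then show ?thesis
    proof
      assume "c + unit_vec d \<in> p ` {..n1}"
      then show ?thesis using G_hole[OF 2(1)] by simp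
    next
      assume *: "hole (c + unit_vec d) \<and> filler (c + unit_vec d) = t' \<and> par (c + unit_vec d) = c"
      then have "st (c + unit_vec d) = Some t'" using st_hole[of "c + unit_vec d"] by blast
      then show ?thesis using * hole_ne_root by blast
    qed
  qed
qed

lemma square: "square_3d (nat N) (dom st)"
proof -
  have "W \<subseteq> {0..<N} \<times> {0..<N} \<times> {0, 1}"
  proof
    fix c assume c: "c \<in> W"
    obtain x y z where xyz: "c = (x, y, z)" by (cases c)
    then have "(x, y, z) \<in> A \<or> (x, y, z) \<in> B \<or> (x, y, z) \<in> C" using c W_eq by blast
    then have "0 \<le> x \<and> x < N \<and> 0 \<le> y \<and> y < N \<and> (z = 0 \<or> z = 1)"
      using A_bounds[of x y z] B_bounds[of x y z] C_bounds[of x y z] size by linarith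
    then show "c \<in> {0..<N} \<times> {0..<N} \<times> {0, 1}" by (simp add: xyz)
  qed
  moreover have "{0..<N} \<times> {0..<N} \<times> {0} \<subseteq> W \<union> Collect hole"
    by (auto simp: hole_def)
  moreover have "Collect hole \<subseteq> {0..<N} \<times> {0..<N} \<times> {0, 1}"
    by (auto simp: hole_def)
  ultimately show ?thesis
    using size unfolding square_3d_def dom_st by simp
qed

end

section \<open>The number of tile types\<close>

text \<open>A queue holds at most a digit and the mark in front of it, hence \<open>Suc k\<close>.
  The queues are the source of \<open>2 ^ k\<close> in the bound, the addresses that of
  \<open>m\<close>.\<close>

definition ctrls :: "nat \<Rightarrow> nat \<Rightarrow> ctrl set" where
  "ctrls m k = {Start, Pre, Init0, Init1, Init2, Pass, DecF, DecX, CopyF, CopyX, Last0, LastX, LastF, End} \<union>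
     (Up ` UNIV \<union> Up2 ` UNIV \<union> Left0 ` UNIV \<union> LeftX ` UNIV \<union> LeftF ` UNIV \<union> Down ` UNIV) \<union>
     (Addr ` {..m} \<union> AddrF ` {..m}) \<union>
     (QueF ` {xs. length xs \<le> Suc k} \<union> QueX ` {xs. length xs \<le> Suc k} \<union>
      FlushX ` {xs. length xs \<le> Suc k} \<union> FlushF ` {xs. length xs \<le> Suc k})"

lemma bool_lists: "finite {xs :: bool list. length xs \<le> n}" "card {xs :: bool list. length xs \<le> n} \<le> 2 * 2 ^ n"
proof -
  have "card {xs :: bool list. length xs \<le> n} = (\<Sum>i\<le>n. 2 ^ i)"
    using card_lists_length_le[of "UNIV :: bool set" n] by simp
  also have "\<dots> \<le> 2 * 2 ^ n" by (induction n) auto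
  finally show "card {xs :: bool list. length xs \<le> n} \<le> 2 * 2 ^ n" .
  show "finite {xs :: bool list. length xs \<le> n}"
    using finite_lists_length_le[of "UNIV :: bool set" n] by simp
qed

lemma ctrls_bound: "finite (ctrls m k)" "card (ctrls m k) \<le> 48 * (m + 2 ^ k)"
proof -
  let ?L = "{xs :: bool list. length xs \<le> Suc k}"
  have L: "finite ?L" "card ?L \<le> 4 * 2 ^ k" using bool_lists[of "Suc k"] by simp_all
  show "finite (ctrls m k)" using L(1) unfolding ctrls_def by simp
  have B: "card (f ` (UNIV :: bool set)) \<le> 2" for f :: "bool \<Rightarrow> ctrl"
    using card_image_le[of "UNIV :: bool set" f] by simp
  have M: "card (f ` {..m}) \<le> m + 1" for f :: "nat \<Rightarrow> ctrl"
    using card_image_le[of "{..m}" f] by simp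
  have Q: "card (f ` ?L) \<le> 4 * 2 ^ k" for f :: "bool list \<Rightarrow> ctrl"
    using card_image_le[OF L(1), of f] L(2) by linarith
  have 1: "card {Start, Pre, Init0, Init1, Init2, Pass, DecF, DecX, CopyF, CopyX, Last0, LastX, LastF, End} = 14"
    by simp
  have 2: "card (Up ` UNIV \<union> Up2 ` UNIV \<union> Left0 ` UNIV \<union> LeftX ` UNIV \<union> LeftF ` UNIV \<union> Down ` UNIV) \<le> 2 + 2 + 2 + 2 + 2 + 2"
    by (intro card_Un_le[THEN order_trans] add_mono B)
  have 3: "card (Addr ` {..m} \<union> AddrF ` {..m}) \<le> (m + 1) + (m + 1)"
    by (intro card_Un_le[THEN order_trans] add_mono M)
  have 4: "card (QueF ` ?L \<union> QueX ` ?L \<union> FlushX ` ?L \<union> FlushF ` ?L) \<le> 4 * 2 ^ k + 4 * 2 ^ k + 4 * 2 ^ k + 4 * 2 ^ k"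
    by (intro card_Un_le[THEN order_trans] add_mono Q)
  have "card (ctrls m k) \<le> 14 + (2 + 2 + 2 + 2 + 2 + 2) + ((m + 1) + (m + 1)) +
      (4 * 2 ^ k + 4 * 2 ^ k + 4 * 2 ^ k + 4 * 2 ^ k)"
    unfolding ctrls_def by (intro card_Un_le[THEN order_trans] add_mono 2 3 4 eq_refl[OF 1])
  moreover define z where "z = (2 :: nat) ^ k"
  moreover have "1 \<le> z" by (simp add: z_def)
  ultimately show "card (ctrls m k) \<le> 48 * (m + 2 ^ k)" unfolding z_def[symmetric] by simp
qed

text \<open>The longest sequence is the detour over a stored \<open>False\<close> followed by the
  bump for \<open>True\<close>: \<open>13 = 5 + 9 - 1\<close>, without its first move.\<close>

lemma length_moves: "length (tl (read_moves x @ write_moves y)) \<le> 13"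
  using option_bool_cases[of x] option_bool_cases[of y] by (elim disjE) auto

lemma act_prog_closed:
  assumes "c \<in> ctrls m k" "(d, es, r) \<in> set (act_prog (act m (digit m k v) two c))"
  shows "length es \<le> 13 \<and> r \<in> ctrls m k"
proof -
  have len: "length (digit m k v j) \<le> k" for j by (simp add: digit_def)
  show ?thesis
    using assms length_moves[of "Some False"] length_moves[of "Some True"] length_moves[of None] len
    by (cases c) (auto simp: ctrls_def alternative_def le_diff_conv split: if_splits)
qed

definition states :: "nat \<Rightarrow> nat \<Rightarrow> tile_state set" where
  "states m k = {Ray, Spine, Tooth} \<union>
     (\<lambda>(d, es, g, c). Walk d es (g, c)) ` (UNIV \<times> {es. length es \<le> 13} \<times> {..2} \<times> ctrls m k)"

lemma states_bound:
  obtains K :: nat where "\<And>m k. finite (states m k)" "\<And>m k. card (states m k) \<le> K * (m + 2 ^ k)"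
proof -
  let ?D = "{es :: dir list. length es \<le> 13}"
  have fin: "finite ?D" using finite_lists_length_le[of "UNIV :: dir set" 13] by simp
  have finU: "finite (UNIV :: dir option set)"
    by (simp add: UNIV_option_conv)
  define K0 where "K0 = card (UNIV :: dir option set) * (card ?D * 3)"
  have f: "finite (states m k)" for m k
    unfolding states_def using fin finU ctrls_bound(1) by simp
  have "card (states m k) \<le> (3 + K0 * 48) * (m + 2 ^ k)" for m k
  proof -
    have "card ((\<lambda>(d, es, g, c). Walk d es (g, c)) ` (UNIV \<times> ?D \<times> {..2} \<times> ctrls m k))
        \<le> card ((UNIV :: dir option set) \<times> ?D \<times> {..2 :: nat} \<times> ctrls m k)"
      using fin finU ctrls_bound(1) by (intro card_image_le) simp
    also have "\<dots> = K0 * card (ctrls m k)"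
      by (simp add: K0_def card_cartesian_product)
    also have "\<dots> \<le> K0 * (48 * (m + 2 ^ k))"
      using ctrls_bound(2) by (intro mult_le_mono2)
    finally have "card (states m k) \<le> 3 + K0 * (48 * (m + 2 ^ k))"
      unfolding states_def by (intro card_Un_le[THEN order_trans] add_mono) auto
    moreover have "1 \<le> m + 2 ^ k" by (simp add: trans_le_add2)
    then have "3 \<le> 3 * (m + 2 ^ k)" using mult_le_mono2[of 1 "m + 2 ^ k" 3] by simp
    ultimately show ?thesis by (simp add: algebra_simps)
  qed
  then show thesis using that f by blast
qed

lemma square_prog_closed:
  assumes "g \<le> 2" "c \<in> ctrls m k" "(d, es, g', c') \<in> set (square_prog m k v two (g, c))"
  shows "length es \<le> 13 \<and> g' \<le> 2 \<and> c' \<in> ctrls m k"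
proof (cases "c = End")
  case True
  then show ?thesis using assms by (auto simp: square_prog_def ctrls_def split: if_splits)
next
  case False
  then obtain d' es' where "(d', es', c') \<in> set (act_prog (act m (digit m k (v g)) (two g) c))"
      "length es' = length es" "g' = g"
    using assms(3) by (auto simp: square_prog_def prog_def turn_def)
  then show ?thesis using act_prog_closed[OF assms(2)] assms(1) by metis
qed

text \<open>An odd height calls for the additional initial cell. What then remains is even, and half
  of it is the number to count down.\<close>

lemma strip_height:
  assumes "2 * int m + 7 \<le> h" "h \<le> 2 ^ (m * k)"
  obtains v two where "length v = m * k" "h = (if two then 2 else 1) + 2 * int m + 2 * int (val v) + 5"
proof -
  define two where "two = odd h"
  define u where "u = nat ((h - 5 - 2 * int m - (if two then 2 else 1)) div 2)"
  have "even (h - 5 - 2 * int m - (if two then 2 else 1))" by (simp add: two_def)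
  then have h: "h = (if two then 2 else 1) + 2 * int m + 2 * int u + 5"
    using assms(1) by (auto simp: u_def elim!: evenE)
  then have "int u < h" by (simp split: if_splits)
  then have "int u < 2 ^ (m * k)" using assms(2) by linarith
  then have "u < 2 ^ (m * k)" by (metis of_nat_less_iff of_nat_numeral of_nat_power)
  then obtain v where "length v = m * k" "val v = u" using ex_val by blast
  then show thesis using that h by metis
qed

lemma exists_square_system:
  fixes N w :: int
  assumes w: "w = 16 * int m * (int k + 1) + 26" "2 * w < N" "2 * int m + 7 \<le> w" and N: "N \<le> 2 ^ (m * k)"
  shows "\<exists>(T :: 'a tile set) \<sigma> D. tile_assembly_system T \<sigma> 1 \<and> card T \<le> card (states m k) \<and>
     square_3d (nat N) D \<and> uniquely_produces T \<sigma> 1 D"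
proof -
  have w0: "0 < w" using w(3) by simp
  obtain vA tA where A: "length vA = m * k" "N = (if tA then 2 else 1) + 2 * int m + 2 * int (val vA) + 5"
    using strip_height[of m N k] w N by auto
  obtain vB tB where B: "length vB = m * k" "N - w = (if tB then 2 else 1) + 2 * int m + 2 * int (val vB) + 5"
    using strip_height[of m "N - w" k] w N by auto
  \<comment> \<open>The second and the third strip have the same height \<open>N - w\<close>, so one
    number serves both.\<close>
  define v where "v g = (if g = 0 then vA else vB)" for g :: nat
  define two where "two g = (if g = 0 then tA else tB)" for g :: nat
  have vv: "v 0 = vA" "v 1 = vB" "v 2 = vB" "two 0 = tA" "two 1 = tB" "two 2 = tB"
    by (simp_all add: v_def two_def)
  obtain UA MA XA where GA: "run (prog m (digit m k (v 0)) (two 0)) marked ({(0, 0, 0)}, {}, (0, 0, 0), [], Start)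
      (UA, MA, (w - 1, N - 1, 0), [], End)" "gadget m w N UA MA XA"
    using run_gadget[OF A(1) w(1) A(2)] unfolding vv by blast
  obtain UB MB XB where GB: "run (prog m (digit m k vB) tB) marked ({(0, 0, 0)}, {}, (0, 0, 0), [], Start)
      (UB, MB, (w - 1, N - w - 1, 0), [], End)" "gadget m w (N - w) UB MB XB"
    using run_gadget[OF B(1) w(1) B(2)] by blast
  let ?P = "square_prog m k v two"
  have GB1: "run (prog m (digit m k (v 1)) (two 1)) marked ({(0, 0, 0)}, {}, (0, 0, 0), [], Start)
      (UB, MB, (w - 1, N - w - 1, 0), [], End)"
    and GB2: "run (prog m (digit m k (v 2)) (two 2)) marked ({(0, 0, 0)}, {}, (0, 0, 0), [], Start)
      (UB, MB, (w - 1, N - w - 1, 0), [], End)"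
    using GB(1) by (simp_all only: vv)
  have runs: "run ?P square_marked ({(0, 0, 0)}, {}, (0, 0, 0), [], (0, Start))
      (insert (place N w 2 (0, 0, 0)) (place N w 0 ` UA \<union> place N w 1 ` UB),
       map_prod (place N w 0) (Pair 0) ` MA \<union> map_prod (place N w 1) (Pair 1) ` MB,
       place N w 2 (0, 0, 0), [], (2, Start))"
    "run ?P square_marked
      (insert (place N w 2 (0, 0, 0)) (place N w 0 ` UA \<union> place N w 1 ` UB),
       map_prod (place N w 0) (Pair 0) ` MA \<union> map_prod (place N w 1) (Pair 1) ` MB,
       place N w 2 (0, 0, 0), [], (2, Start))
      (place N w 0 ` UA \<union> place N w 1 ` UB \<union> place N w 2 ` UB,
       map_prod (place N w 0) (Pair 0) ` MA \<union> map_prod (place N w 1) (Pair 1) ` MB \<union> map_prod (place N w 2) (Pair 2) ` MB,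
       place N w 2 (w - 1, N - w - 1, 0), [], (2, End))"
    by (rule run_square[where v = v and two = two and k = k, OF GA GB1 GB(2) GB2 GB(2) w0 w(2)])+
  obtain p ds q dd n1 n where walk:
    "n1 \<le> n" "p 0 = (0, 0, 0)" "ds 0 = []" "q 0 = (0, Start)"
    "p n = place N w 2 (w - 1, N - w - 1, 0)" "ds n = []" "q n = (2, End)"
    "insert (place N w 2 (0, 0, 0)) (place N w 0 ` UA \<union> place N w 1 ` UB) = p ` {..n1}"
    "p n1 = place N w 2 (0, 0, 0)"
    "place N w 0 ` UA \<union> place N w 1 ` UB \<union> place N w 2 ` UB = p ` {..n}" "inj_on p {..n}"
    "map_prod (place N w 0) (Pair 0) ` MA \<union> map_prod (place N w 1) (Pair 1) ` MB \<union> map_prod (place N w 2) (Pair 2) ` MB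
      = {(p i, q i) |i. i < n \<and> ds i = [] \<and> square_marked (q i)}"
    and steps: "\<forall>i<n. p (Suc i) = p i + unit_vec (dd i) \<and>
        (ds i = dd i # ds (Suc i) \<and> q (Suc i) = q i \<or>
         ds i = [] \<and> (dd i, ds (Suc i), q (Suc i)) \<in> set (?P (q i)) \<and>
           (\<forall>e es r. (e, es, r) \<in> set (?P (q i)) \<longrightarrow> e \<noteq> dd i \<longrightarrow> p i + unit_vec e \<in> p ` {..<i}))"
    by (rule walk_of_run[OF runs])
  have inv: "length (ds i) \<le> 13 \<and> fst (q i) \<le> 2 \<and> snd (q i) \<in> ctrls m k" if "i \<le> n" for i
    using that
  proof (induction i)
    case 0
    then show ?case using walk(3,4) by (simp add: ctrls_def)
  next
    case (Suc i)
    then have IH: "length (ds i) \<le> 13" "fst (q i) \<le> 2" "snd (q i) \<in> ctrls m k" by auto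
    have "ds i = dd i # ds (Suc i) \<and> q (Suc i) = q i \<or> (dd i, ds (Suc i), q (Suc i)) \<in> set (?P (q i))"
      using steps Suc.prems by (meson Suc_le_lessD)
    then show ?case
    proof
      assume "ds i = dd i # ds (Suc i) \<and> q (Suc i) = q i"
      then show ?thesis using IH by auto
    next
      assume "(dd i, ds (Suc i), q (Suc i)) \<in> set (?P (q i))"
      then show ?thesis
        using square_prog_closed[of "fst (q i)" "snd (q i)" m k "dd i" "ds (Suc i)" "fst (q (Suc i))" "snd (q (Suc i))" v two]
          IH by simp
    qed
  qed
  interpret square_walk N w m ?P UA UB UB MA MB MB XA XB XB p ds q dd n1 n "states m k"
  proof
    show "gadget m w N UA MA XA" "gadget m w (N - w) UB MB XB"
      using GA(2) GB(2) by simp_all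
    show "0 < w" "2 * w < N" "2 + 2 * int m \<le> N - 1 - w" using w w0 by simp_all
    show "distinct (map fst (?P q))" for q by (rule distinct_square_prog)
    show "?P (2, End) = []" by (simp add: square_prog_def)
    \<comment> \<open>After the half turn, the marked states move down or to the right, so no move
      of the path competes with a ray.\<close>
    show "NegX \<notin> fst ` set (?P (2, r))" if "marked r" for r
      using that by (cases r) (auto simp: square_prog_def prog_def turn_def numeral_2_eq_2)
    show "finite (states m k)" using states_bound by metis
    show "Ray \<in> states m k" "Spine \<in> states m k" "Tooth \<in> states m k" by (simp_all add: states_def)
    show "Walk d (ds i) (q i) \<in> states m k" if "i \<le> n" for i d
      using inv[OF that] unfolding states_def
      by (intro UnI2 image_eqI[of _ _ "(d, ds i, fst (q i), snd (q i))"]) (auto simp: mem_Times_iff)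
  qed (use walk steps in \<open>simp_all\<close>)
  interpret growth_tree "out ?P" ind "states m k" st "p 0" "s 0" par rank G
    by (rule growth)
  have "card (tile ` states m k :: 'a tile set) \<le> card (states m k)"
    using finite_S by (rule card_image_le)
  then show ?thesis
    using tile_assembly_system_tree uniquely_produces_tree square by blast
qed

lemma tile_complexity_le:
  assumes "\<exists>(T :: 'a tile set) \<sigma> D. tile_assembly_system T \<sigma> \<tau> \<and> card T \<le> b \<and>
     square_3d N D \<and> uniquely_produces T \<sigma> \<tau> D"
  shows "tile_complexity TYPE('a) \<tau> N \<le> b"
proof -
  obtain T :: "'a tile set" and \<sigma> D where T: "tile_assembly_system T \<sigma> \<tau>" "card T \<le> b"
     "square_3d N D" "uniquely_produces T \<sigma> \<tau> D"
    using assms by blast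
  have "tile_complexity TYPE('a) \<tau> N \<le> card T"
    unfolding tile_complexity_def using T by (intro Least_le) blast
  then show ?thesis using T(2) by simp
qed

text \<open>
  Digits of about \<open>log log N / 2\<close> bits balance the \<open>m\<close> states that address the digits and
  the \<open>2\<^sup>k\<close> states that spell them out.
\<close>

lemma parameters:
  "\<forall>\<^sub>F N :: nat in sequentially. \<exists>m k :: nat.
     2 * (16 * int m * (int k + 1) + 26) < int N \<and> int N \<le> 2 ^ (m * k) \<and>
     real (m + 2 ^ k) \<le> 6 * (ln (real N) / ln (ln (real N)))"
proof -
  have ev: "\<forall>\<^sub>F N :: nat in sequentially. 1 < ln (real N)"
    "\<forall>\<^sub>F N :: nat in sequentially. 2 \<le> log 2 (log 2 (real N))"
    "\<forall>\<^sub>F N :: nat in sequentially. 64 * log 2 (real N) + 32 * log 2 (log 2 (real N)) + 52 < real N"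
    "\<forall>\<^sub>F N :: nat in sequentially. sqrt (log 2 (real N)) \<le> log 2 (real N) / log 2 (log 2 (real N))"
    "\<forall>\<^sub>F N :: nat in sequentially. 1 \<le> log 2 (real N) / log 2 (log 2 (real N))"
    by real_asymp+
  show ?thesis
    using ev
  proof eventually_elim
    case (elim N)
    define L where "L = log 2 (real N)"
    define t where "t = log 2 L"
    \<comment> \<open>This choice makes \<open>2 ^ k\<close> at most \<open>sqrt L\<close>, which is
      negligible against \<open>L / t\<close>; \<open>m\<close> is then the least number of digits
      that provides \<open>L\<close> bits.\<close>
    define k where "k = nat \<lfloor>t / 2\<rfloor>"
    define m where "m = nat \<lceil>L / real k\<rceil>"
    have t: "2 \<le> t" using elim(2) by (simp add: t_def L_def)
    have "N \<noteq> 0" "N \<noteq> 1" using elim(1) by (intro notI; simp)+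
    then have N: "1 < real N" by linarith
    have L0: "0 < L" using N by (simp add: L_def)
    have k1: "1 \<le> k" using t by (simp add: k_def le_nat_iff)
    have k2: "real k \<le> t / 2" using t of_int_floor_le[of "t / 2"] by (simp add: k_def)
    \<comment> \<open>Because of \<open>1 \<le> k\<close>, rounding down loses at most a factor of
      two.\<close>
    have k3: "t / 4 \<le> real k"
    proof -
      have "t / 2 < real k + 1" using t by (simp add: k_def)
      then show ?thesis using k1 by linarith
    qed
    have m1: "L / real k \<le> real m" using L0 by (simp add: m_def)
    have m2: "real m \<le> L / real k + 1" using L0 by (simp add: m_def)
    have mk1: "L \<le> real (m * k)" using m1 k1 by (simp add: field_simps)
    have mk2: "real (m * k) \<le> L + real k" using m2 k1 by (simp add: field_simps)
    \<comment> \<open>With \<open>k + 1 \<le> 2 * k\<close>, twice the width is at most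
      \<open>64 * m * k + 52\<close>; then \<open>m * k \<le> L + k\<close> and
      \<open>k \<le> t / 2\<close> give the constants 64 and 32.\<close>
    have "real m * (real k + 1) \<le> 2 * (real m * real k)"
      using mult_left_mono[of 1 "real k" "real m"] k1 by (simp add: algebra_simps)
    then have "2 * (16 * (real m * (real k + 1)) + 26) \<le> 64 * L + 32 * t + 52"
      using mk2 k2 by (simp add: algebra_simps)
    also have "\<dots> < real N" using elim(3) by (simp add: L_def t_def)
    finally have "real_of_int (2 * (16 * int m * (int k + 1) + 26)) < real_of_int (int N)"
      by (simp add: algebra_simps)
    then have 1: "2 * (16 * int m * (int k + 1) + 26) < int N" by (simp only: of_int_less_iff)
    have "real N = 2 powr L" using N by (simp add: L_def)
    also have "\<dots> \<le> 2 powr real (m * k)" using mk1 by simp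
    also have "\<dots> = 2 ^ (m * k)" by (rule powr_realpow) simp
    finally have "real N \<le> real (2 ^ (m * k))" by simp
    then have "N \<le> 2 ^ (m * k)" by (simp only: of_nat_le_iff)
    then have 2: "int N \<le> 2 ^ (m * k)" by (metis of_nat_le_iff of_nat_numeral of_nat_power)
    have "L / real k \<le> L / (t / 4)" using k3 t L0 by (intro divide_left_mono) auto
    also have "L / (t / 4) = 4 * (L / t)" by simp
    finally have "real m \<le> 4 * (L / t) + 1" using m2 by linarith
    moreover have "2 ^ k \<le> sqrt L"
    proof -
      have "(2 :: real) ^ k = 2 powr real k" by (simp add: powr_realpow)
      also have "\<dots> \<le> 2 powr (t / 2)" using k2 by simp
      also have "\<dots> = (2 powr t) powr (1 / 2)" by (simp add: powr_powr)
      also have "2 powr t = L" using L0 by (simp add: t_def)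
      also have "L powr (1 / 2) = sqrt L" using L0 by (simp add: powr_half_sqrt)
      finally show ?thesis .
    qed
    \<comment> \<open>The constant is 4 from \<open>L / k\<close>, 1 from rounding \<open>m\<close>
      up, and 1 from \<open>2 ^ k\<close>.\<close>
    ultimately have "real (m + 2 ^ k) \<le> 6 * (L / t)"
      using elim(4,5) unfolding L_def[symmetric] t_def[symmetric] by simp
    \<comment> \<open>The factors \<open>ln 2\<close> cancel in the quotient. What is left of the
      change of base is \<open>ln L\<close> in place of \<open>ln (ln N)\<close>, a larger
      denominator.\<close>
    also have "L / t \<le> ln (real N) / ln (ln (real N))"
    proof -
      have e: "L * ln 2 = ln (real N)" "t * ln 2 = ln L" by (simp_all add: L_def t_def log_def)
      have "L / t = (L * ln 2) / (t * ln 2)" by simp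
      also have "\<dots> = ln (real N) / ln L" unfolding e ..
      also have "\<dots> \<le> ln (real N) / ln (ln (real N))"
      proof (rule divide_left_mono)
        have "L * ln 2 \<le> L * 1" using L0 ln_2_less_1 by (intro mult_left_mono) auto
        then have "ln (real N) \<le> L" using e(1) by simp
        then show le: "ln (ln (real N)) \<le> ln L" using elim(1) by simp
        have "0 < ln (ln (real N))" using elim(1) by simp
        then show "0 < ln L * ln (ln (real N))" using le by simp
        show "0 \<le> ln (real N)" using elim(1) by simp
      qed
      finally show ?thesis .
    qed
    finally show ?case using 1 2 by (intro exI[of _ m] exI[of _ k]) simp
  qed
qed

theorem theorem4p1:
  shows "(\<lambda>N::nat. real (tile_complexity TYPE('a) 1 N)) \<in> O(\<lambda>N. ln (real N) / ln (ln (real N)))"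
proof -
  obtain K where K: "\<And>m k. card (states m k) \<le> K * (m + 2 ^ k)"
    using states_bound by metis
  have "\<forall>\<^sub>F N :: nat in sequentially. norm (real (tile_complexity TYPE('a) 1 N)) \<le>
      6 * real K * norm (ln (real N) / ln (ln (real N)))"
    using parameters
  proof eventually_elim
    case (elim N)
    then obtain m k :: nat where mk: "2 * (16 * int m * (int k + 1) + 26) < int N" "int N \<le> 2 ^ (m * k)"
      "real (m + 2 ^ k) \<le> 6 * (ln (real N) / ln (ln (real N)))" by blast
    have "2 * int m + 7 \<le> 16 * int m * (int k + 1) + 26"
      by (simp add: algebra_simps)
    from exists_square_system[OF refl mk(1) this mk(2)]
    have "tile_complexity TYPE('a) 1 N \<le> card (states m k)"
      by (intro tile_complexity_le) simp
    then have "tile_complexity TYPE('a) 1 N \<le> K * (m + 2 ^ k)" using K order_trans by blast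
    then have "real (tile_complexity TYPE('a) 1 N) \<le> real (K * (m + 2 ^ k))" by (simp only: of_nat_le_iff)
    also have "\<dots> = real K * real (m + 2 ^ k)" by (simp only: of_nat_mult)
    also have "\<dots> \<le> real K * (6 * (ln (real N) / ln (ln (real N))))"
      using mk(3) by (intro mult_left_mono) simp_all
    also have "\<dots> \<le> real K * (6 * norm (ln (real N) / ln (ln (real N))))"
      unfolding real_norm_def by (intro mult_left_mono abs_ge_self) simp_all
    finally show ?case by (simp only: real_norm_def abs_of_nat mult.assoc mult.left_commute)
  qed
  then show ?thesis by (rule bigoI)
qed

end
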